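(* For each $n$ let $V_n=(v_{nj}(x_i^{n}))_{i,j=0}^{n-1}$ be a unitary generalized trigonometric Vandermonde matrix, let $U_n=V_n^*$, and let $L_n[U_n]$ be the associated sequence of positive linear operators on $C[0,2\pi]$, with $\|L_n[U_n]\|\le 1$. Assume that the grids $\{x_i^n\}$ are uniformly distributed. Let $g_1,\dots,g_m$ be real-valued functions that are Lipschitz continuous and belong to the Krein algebra, such that for every $g$ in the finite set $\{g_1,\dots,g_m,\sum_{k=1}^m g_k^2\}$ one has $L_n[U_n](g)=g+\epsilon_n(g)$ with $\epsilon_n(g)=O(1/n)$ uniformly. Then $P_{U_n}(A_n(f))$ converges to $A_n(f)$ in strong cluster for every $f$ in the $C^*$-algebra generated by $\{g_1,\dots,g_m\}$.
   Context: Toeplitz matrices: for $f\in C[0,2\pi]$, $A_n(f)$ is the $n\times n$ matrix with entries $(A_n(f))_{j,k}=a_{j-k}$, $a_k=a_k(f)=\frac1{2\pi}\int_0^{2\pi}f(x)e^{-ikx}\,dx$. Krein algebra: the algebra of (essentially) bounded functions $f$ on $[0,2\pi]$ with $\sum_{k\in\mathbb{Z}}|k|\,|a_k(f)|^2<\infty$. Vandermonde matrices: for each $n$ let $v_{n0},\dots,v_{n,n-1}$ be trigonometric functions (trigonometric polynomials) and let $x_0^n<\dots<x_{n-1}^n$ be a grid of $n$ points in an interval $I=[a,b]\subseteq[0,2\pi]$ such that the matrix $V_n=(v_{nj}(x_i^n))_{i,j=0}^{n-1}$ is unitary. Put $U_n=V_n^*$. The grids are uniformly distributed if $\sum_{i=1}^{n-1}\left|\frac{b-a}{n}-(x_i^n-x_{i-1}^n)\right|=O(1/n)$.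 LPO: with the row vector $v(x)=(v_{n0}(x),\dots,v_{n,n-1}(x))$ (whose value at $x_j^n$ is the $j$-th row of $U_n^*$), define $L_n[U_n](f)(x)=v(x)A_n(f)v(x)^*$ for $f\in C[0,2\pi]$, $x\in[0,2\pi]$; $v(x)^*$ is the conjugate transpose. It is a standing assumption that these positive linear maps have norm at most $1$ on $C[0,2\pi]$ with the sup norm. Preconditioner: $P_{U_n}(X)=U_n\,\sigma(U_n^*XU_n)\,U_n^*$, where $\sigma(Y)$ is the diagonal part of $Y$; this is the Frobenius-norm best approximation of $X$ in $\{X\in M_n(\mathbb{C}): U_n^*XU_n\text{ diagonal}\}$. Thus the eigenvalues of $P_{U_n}(A_n(f))$ are the numbers $L_n[U_n](f)(x_j^n)$, $0\le j\le n-1$. Strong cluster: for sequences $\{X_n\},\{Y_n\}$ of $n\times n$ matrices, $X_n$ converges to $Y_n$ in strong cluster if for every $\epsilon>0$ there exist integers $N_{1,\epsilon},N_{2,\epsilon}$ (independent of $n$) such that for all $n>N_{2,\epsilon}$ all singular values of $X_n-Y_n$ lie in $[0,\epsilon)$ except for at most $N_{1,\epsilon}$ of them (with multiplicity). *)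

theory Defs
  imports
    "HOL-Analysis.Analysis"
    "HOL-Library.Landau_Symbols"
    "HOL-Computational_Algebra.Computational_Algebra"
    "Jordan_Normal_Form.Schur_Decomposition"
begin

text \<open>
  Matrices of size \<open>n\<close> are those of \<open>Jordan_Normal_Form\<close>, so that \<open>n\<close> may vary.
  Some of its names (\<open>mat\<close>, \<open>vec\<close>) also occur in \<open>HOL-Analysis\<close>; they are qualified below.
  Functions on \<open>[0, 2\<pi>]\<close> are total functions on the reals of which only the restriction to
  \<open>{0..2*pi}\<close> matters.
\<close>

definition cont_funs :: "(real \<Rightarrow> complex) set" where
  "cont_funs = {f. continuous_on {0..2*pi} f}"

text \<open>Meaningful only for functions that are bounded on \<open>[0, 2\<pi>]\<close>.\<close>

definition sup_norm :: "(real \<Rightarrow> complex) \<Rightarrow> real" where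
  "sup_norm f = (SUP x\<in>{0..2*pi}. cmod (f x))"

definition fourier_coeff :: "(real \<Rightarrow> complex) \<Rightarrow> int \<Rightarrow> complex" where
  "fourier_coeff f k =
     integral {0..2*pi} (\<lambda>x. f x * exp (- (\<i> * of_int k * of_real x))) / (2 * of_real pi)"

definition toeplitz :: "nat \<Rightarrow> (real \<Rightarrow> complex) \<Rightarrow> complex mat" where
  "toeplitz n f = Matrix.mat n n (\<lambda>(j, k). fourier_coeff f (int j - int k))"

definition krein_algebra :: "(real \<Rightarrow> complex) set" where
  "krein_algebra = {f. f \<in> borel_measurable (lebesgue_on {0..2*pi}) \<and>
     (\<exists>M. AE x in lebesgue_on {0..2*pi}. cmod (f x) \<le> M) \<and>
     (\<lambda>k::int. real_of_int \<bar>k\<bar> * (cmod (fourier_coeff f k))\<^sup>2) summable_on UNIV}"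

definition trig_poly :: "(real \<Rightarrow> complex) \<Rightarrow> bool" where
  "trig_poly p \<longleftrightarrow> (\<exists>(N::nat) (c :: int \<Rightarrow> complex). \<forall>x.
     p x = (\<Sum>k = - int N..int N. c k * exp (\<i> * of_int k * of_real x)))"

definition unitary_matrix :: "complex mat \<Rightarrow> bool" where
  "unitary_matrix U \<longleftrightarrow> square_mat U \<and>
     inverts_mat U (mat_adjoint U) \<and> inverts_mat (mat_adjoint U) U"

text \<open>For a fixed size \<open>n\<close>, \<open>w j\<close> (\<open>j < n\<close>) are the functions and \<open>x i\<close> (\<open>i < n\<close>) the grid points.\<close>

definition vandermonde :: "nat \<Rightarrow> (nat \<Rightarrow> real \<Rightarrow> complex) \<Rightarrow> (nat \<Rightarrow> real) \<Rightarrow> complex mat" where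
  "vandermonde n w x = Matrix.mat n n (\<lambda>(i, j). w j (x i))"

definition is_grid :: "nat \<Rightarrow> real \<Rightarrow> real \<Rightarrow> (nat \<Rightarrow> real) \<Rightarrow> bool" where
  "is_grid n a b x \<longleftrightarrow> strict_mono_on {..<n} x \<and> x ` {..<n} \<subseteq> {a..b}"

definition uniformly_distributed :: "real \<Rightarrow> real \<Rightarrow> (nat \<Rightarrow> nat \<Rightarrow> real) \<Rightarrow> bool" where
  "uniformly_distributed a b x \<longleftrightarrow>
     (\<lambda>n. \<Sum>i = 1..n - 1. \<bar>(b - a) / real n - (x n i - x n (i - 1))\<bar>) \<in> O(\<lambda>n. 1 / real n)"

text \<open>The product \<open>v(t) A\<^sub>n(f) v(t)\<^sup>*\<close> with \<open>v(t)\<close> the row vector of the values \<open>w j t\<close>;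
  \<open>scalar_prod\<close> is bilinear and does not conjugate.\<close>

definition LPO :: "nat \<Rightarrow> (nat \<Rightarrow> real \<Rightarrow> complex) \<Rightarrow> (real \<Rightarrow> complex) \<Rightarrow> real \<Rightarrow> complex" where
  "LPO n w f t = (let v = Matrix.vec n (\<lambda>j. w j t)
     in scalar_prod v (mult_mat_vec (toeplitz n f) (conjugate v)))"

definition diag_part :: "complex mat \<Rightarrow> complex mat" where
  "diag_part Y = Matrix.mat (dim_row Y) (dim_col Y) (\<lambda>(i, j). if i = j then Y $$ (i, j) else 0)"

definition precond :: "complex mat \<Rightarrow> complex mat \<Rightarrow> complex mat" where
  "precond U X = U * diag_part (mat_adjoint U * X * U) * mat_adjoint U"

text \<open>Square roots of the eigenvalues of \<open>A\<^sup>* A\<close>, with multiplicity; these eigenvalues are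
  real and nonnegative, hence the use of \<open>Re\<close>.\<close>

definition singular_values :: "complex mat \<Rightarrow> real multiset" where
  "singular_values A = image_mset (\<lambda>z. sqrt (Re z)) (proots (char_poly (mat_adjoint A * A)))"

definition strong_cluster :: "(nat \<Rightarrow> complex mat) \<Rightarrow> (nat \<Rightarrow> complex mat) \<Rightarrow> bool" where
  "strong_cluster X Y \<longleftrightarrow> (\<forall>\<epsilon>>0. \<exists>N1 N2 :: nat. \<forall>n>N2.
     size (filter_mset (\<lambda>s. s \<notin> {0..<\<epsilon>}) (singular_values (X n - Y n))) \<le> N1)"

text \<open>
  \<open>C*\<close>-subalgebras of \<open>C[0, 2\<pi>]\<close> are understood to contain its unit; the constants \<open>c\<close> give
  both the unit and, together with products, closure under complex scalars.
\<close>

definition cstar_subalgebra :: "(real \<Rightarrow> complex) set \<Rightarrow> bool" where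
  "cstar_subalgebra B \<longleftrightarrow> B \<subseteq> cont_funs \<and>
     (\<forall>c. (\<lambda>_. c) \<in> B) \<and>
     (\<forall>f\<in>B. \<forall>h\<in>B. (\<lambda>x. f x + h x) \<in> B) \<and>
     (\<forall>f\<in>B. \<forall>h\<in>B. (\<lambda>x. f x * h x) \<in> B) \<and>
     (\<forall>f\<in>B. (\<lambda>x. cnj (f x)) \<in> B) \<and>
     (\<forall>F f. range F \<subseteq> B \<and> uniform_limit {0..2*pi} F f sequentially \<longrightarrow> f \<in> B)"

definition cstar_generated :: "(real \<Rightarrow> complex) set \<Rightarrow> (real \<Rightarrow> complex) set" where
  "cstar_generated S = \<Inter>{B. cstar_subalgebra B \<and> S \<subseteq> B}"

end

theory Submission
  imports Defs
begin

text \<open>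
  The notion of strong cluster is replaced by one that is stronger and stable under every
  operation of the proof. Call a sequence of matrices \<open>Z n\<close> asymptotically compact if for each
  \<open>\<epsilon> > 0\<close> it splits, for large \<open>n\<close>, into a part of operator norm at most \<open>\<epsilon>\<close> and a part whose
  Frobenius norm is bounded independently of \<open>n\<close>. If \<open>Z = E + R\<close> is such a splitting, a unit
  vector that \<open>Z\<close> stretches by \<open>2\<epsilon>\<close> is stretched by \<open>R\<close> by at least \<open>\<epsilon>\<close>, and only boundedly many
  orthonormal vectors can have this property; so asymptotic compactness implies a cluster of the
  singular values at \<open>0\<close> (\<open>strong_cluster_if_asymptotically_compact\<close>). Sums, products with
  sequences of bounded operator norm, and limits in operator norm preserve asymptotic compactness;
  so does the preconditioner \<open>P\<close>, which contracts both norms.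

  Write \<open>T(f)\<close> for the Toeplitz sequence of \<open>f\<close>; its operator norm is at most the sup norm of \<open>f\<close>.
  Two properties of a continuous symbol \<open>f\<close> are followed: that \<open>T(fh) - T(f) T(h)\<close> is
  asymptotically compact for all continuous \<open>h\<close>, and that \<open>P(T(f)) - T(f)\<close> is. The symbols
  that have both, together with their conjugates, form a C*-algebra
  (\<open>cstar_subalgebra_approximated\<close>). For a product, \<open>T(fh)\<close> differs by an asymptotically compact
  sequence from \<open>D = P(T(f)) P(T(h))\<close>, which \<open>P\<close> fixes because both factors are diagonal in the same basis;
  hence \<open>P(T(fh))\<close> differs from \<open>D\<close>, and so from \<open>T(fh)\<close>, by an asymptotically compact sequence.

  It remains to treat the generators, and here both defects are even bounded in Frobenius norm.
  The matrix \<open>T(gh) - T(g) T(h)\<close> only sees the Fourier coefficients of \<open>g\<close> that leave the window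
  of size \<open>n\<close>; the \<open>k\<close>-th one does so at most \<open>\<bar>k\<bar>\<close> times, so that the Krein condition bounds the sum
  of squares (\<open>toeplitz_multiplier_krein\<close>). For the preconditioner, Pythagoras expresses the squared
  Frobenius norm of the defect as \<open>\<parallel>T(g)\<parallel>\<^sup>2\<close> minus the sum of the squares of the eigenvalues \<open>L(g)(x\<^sub>j)\<close> of \<open>P(T(g))\<close>.
  By Bessel, \<open>\<parallel>T(g)\<parallel>\<^sup>2\<close> is at most the trace of \<open>T(g\<^sup>2)\<close>, which is the sum of the \<open>L(g\<^sup>2)(x\<^sub>j)\<close>. Summing over
  the generators leaves \<open>n\<close> terms \<open>L(\<Sum>g\<^sub>k\<^sup>2)(x\<^sub>j) - \<Sum>(L(g\<^sub>k)(x\<^sub>j))\<^sup>2\<close>, each of which is \<open>O(1/n)\<close> by the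
  approximation hypotheses (\<open>sum_precond_defects_le\<close>).
\<close>

no_notation vec_nth (infixl "$" 90)
no_notation fps_nth (infixl "$" 75)

section \<open>Fourier coefficients and mean squares on a period\<close>

definition fourier_mode :: "int \<Rightarrow> real \<Rightarrow> complex" where
  "fourier_mode k t = exp (\<i> * of_int k * of_real t)"

definition mean_square :: "(real \<Rightarrow> complex) \<Rightarrow> real" where
  "mean_square f = integral {0..2*pi} (\<lambda>t. (cmod (f t))\<^sup>2) / (2 * pi)"

lemma cmod_fourier_mode [simp]: "cmod (fourier_mode k t) = 1"
  by (simp add: fourier_mode_def)

lemma fourier_mode_add: "fourier_mode (k + l) t = fourier_mode k t * fourier_mode l t"
  by (simp add: fourier_mode_def exp_add [symmetric] algebra_simps)

lemma fourier_mode_0 [simp]: "fourier_mode 0 t = 1"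
  by (simp add: fourier_mode_def)

lemma cnj_fourier_mode: "cnj (fourier_mode k t) = fourier_mode (- k) t"
  by (simp add: fourier_mode_def exp_cnj)

lemma continuous_on_fourier_mode [continuous_intros]: "continuous_on A (fourier_mode k)"
  unfolding fourier_mode_def by (intro continuous_intros)

lemma fourier_coeff_alt:
  "fourier_coeff f k = integral {0..2*pi} (\<lambda>t. f t * fourier_mode (- k) t) / (2 * of_real pi)"
  by (simp add: fourier_coeff_def fourier_mode_def)

lemma integral_fourier_mode:
  "integral {0..2*pi} (fourier_mode k) = (if k = 0 then 2 * of_real pi else 0)"
proof (cases "k = 0")
  case True
  then have "fourier_mode k = (\<lambda>t. 1)" by auto
  then show ?thesis using True by (simp add: scaleR_conv_of_real)
next
  case False
  define F where "F = (\<lambda>t::real. exp (\<i> * of_int k * of_real t) / (\<i> * of_int k))"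
  have "(fourier_mode k has_integral (F (2*pi) - F 0)) {0..2*pi}"
  proof (rule fundamental_theorem_of_calculus)
    fix t :: real assume "t \<in> {0..2*pi}"
    show "(F has_vector_derivative fourier_mode k t) (at t within {0..2 * pi})"
      unfolding F_def fourier_mode_def
      by (rule has_vector_derivative_real_field) (use False in \<open>auto intro!: derivative_eq_intros\<close>)
  qed simp
  moreover have "exp (\<i> * of_int k * of_real (2*pi)) = 1"
    by (simp add: exp_eq_1) 
  then have "F (2*pi) - F 0 = 0" by (simp add: F_def)
  ultimately show ?thesis using False by (auto simp: has_integral_integral integral_unique)
qed

lemma fourier_coeff_fourier_mode: "fourier_coeff (fourier_mode l) k = (if k = l then 1 else 0)"
  by (simp add: fourier_coeff_alt flip: fourier_mode_add) (simp add: integral_fourier_mode scaleR_conv_of_real)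

lemma fourier_coeff_add:
  assumes "continuous_on {0..2*pi} f" "continuous_on {0..2*pi} h"
  shows "fourier_coeff (\<lambda>t. f t + h t) k = fourier_coeff f k + fourier_coeff h k"
  unfolding fourier_coeff_alt using assms
  by (simp add: algebra_simps add_divide_distrib integral_add integrable_continuous_interval continuous_intros)

lemma fourier_coeff_cmult: "fourier_coeff (\<lambda>t. c * f t) k = c * fourier_coeff f k"
  unfolding fourier_coeff_alt by (simp add: mult.assoc)

lemma fourier_coeff_diff:
  assumes "continuous_on {0..2*pi} f" "continuous_on {0..2*pi} h"
  shows "fourier_coeff (\<lambda>t. f t - h t) k = fourier_coeff f k - fourier_coeff h k"
  unfolding fourier_coeff_alt using assms
  by (simp add: algebra_simps diff_divide_distrib integral_diff integrable_continuous_interval continuous_intros)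

lemma fourier_coeff_mult_mode:
  "fourier_coeff (\<lambda>t. f t * fourier_mode l t) k = fourier_coeff f (k - l)"
  by (simp add: fourier_coeff_alt mult.assoc flip: fourier_mode_add)

lemma fourier_coeff_sum:
  assumes "finite K" "\<And>i. i \<in> K \<Longrightarrow> continuous_on {0..2*pi} (F i)"
  shows "fourier_coeff (\<lambda>t. \<Sum>i\<in>K. F i t) k = (\<Sum>i\<in>K. fourier_coeff (F i) k)"
  using assms
proof (induction K)
  case empty
  then show ?case by (simp add: fourier_coeff_def)
next
  case (insert i K)
  then show ?case
    by (simp add: fourier_coeff_add continuous_on_sum)
qed

lemma mean_square_nonneg: "0 \<le> mean_square f"
proof (cases "(\<lambda>t. (cmod (f t))\<^sup>2) integrable_on {0..2*pi}")
  case True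
  then show ?thesis by (simp add: mean_square_def integral_nonneg)
qed (simp add: mean_square_def not_integrable_integral)

lemma mean_square_mono:
  assumes "continuous_on {0..2*pi} f" "continuous_on {0..2*pi} h"
    and "\<And>t. t \<in> {0..2*pi} \<Longrightarrow> cmod (f t) \<le> M * cmod (h t)" 
  shows "mean_square f \<le> M\<^sup>2 * mean_square h"
proof -
  have "integral {0..2*pi} (\<lambda>t. (cmod (f t))\<^sup>2) \<le> integral {0..2*pi} (\<lambda>t. M\<^sup>2 * (cmod (h t))\<^sup>2)"
    using assms(3)
    by (intro integral_le integrable_continuous_interval continuous_intros assms)
      (auto simp: power_mult_distrib [symmetric] intro!: power_mono)
  then show ?thesis by (simp add: mean_square_def divide_right_mono)
qed

text \<open>Completing the square. The modes are orthonormal, so the best coefficient is the Fourier coefficient.\<close>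

lemma mean_square_diff_mode:
  assumes f: "continuous_on {0..2*pi} f"
  shows "mean_square (\<lambda>t. f t - c * fourier_mode k t) =
    mean_square f - (cmod (fourier_coeff f k))\<^sup>2 + (cmod (c - fourier_coeff f k))\<^sup>2"
proof -
  have pt: "(cmod (z - c * w))\<^sup>2 = (cmod z)\<^sup>2 - 2 * Re (cnj c * (z * cnj w)) + (cmod c)\<^sup>2"
    if "cmod w = 1" for z w
  proof -
    have "of_real ((cmod (z - c * w))\<^sup>2) = (z - c * w) * cnj (z - c * w)" by (rule complex_norm_square)
    also have "\<dots> = z * cnj z - (c * w * cnj z + cnj (c * w * cnj z)) + c * cnj c * (w * cnj w)"
      by (simp add: algebra_simps)
    also have "w * cnj w = 1" using that by (simp add: complex_norm_square [symmetric])
    also have "c * w * cnj z + cnj (c * w * cnj z) = of_real (2 * Re (cnj c * (z * cnj w)))"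
      by (subst complex_add_cnj) (simp add: algebra_simps)
    finally have "complex_of_real ((cmod (z - c * w))\<^sup>2) = of_real ((cmod z)\<^sup>2 - 2 * Re (cnj c * (z * cnj w)) + (cmod c)\<^sup>2)"
      by (simp only: of_real_add of_real_diff complex_norm_square mult_1_right)
    then show ?thesis using of_real_eq_iff by blast
  qed
  let ?I = "integral {0..2*pi}"
  define G where "G = (\<lambda>t. cnj c * (f t * fourier_mode (- k) t))"
  have contG: "continuous_on {0..2*pi} G" unfolding G_def by (intro continuous_intros f)
  have "?I (\<lambda>t. (cmod (f t - c * fourier_mode k t))\<^sup>2) =
      ?I (\<lambda>t. (cmod (f t))\<^sup>2 - 2 * Re (G t) + (cmod c)\<^sup>2)"
    by (simp add: pt cnj_fourier_mode G_def)
  also have "\<dots> = ?I (\<lambda>t. (cmod (f t))\<^sup>2) - 2 * ?I (\<lambda>t. Re (G t)) + 2 * pi * (cmod c)\<^sup>2"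
    by (subst integral_add, (intro integrable_continuous_interval continuous_intros f contG)+,
        subst integral_diff, (intro integrable_continuous_interval continuous_intros f contG)+) simp
  also have "?I (\<lambda>t. Re (G t)) = Re (?I G)"
    using integral_linear[OF integrable_continuous_interval[OF contG] bounded_linear_Re] by (simp add: o_def)
  also have "?I G = 2 * pi * (cnj c * fourier_coeff f k)"
    by (simp add: G_def fourier_coeff_alt)
  finally have 1: "mean_square (\<lambda>t. f t - c * fourier_mode k t) = mean_square f - 2 * Re (cnj c * fourier_coeff f k) + (cmod c)\<^sup>2"
    by (simp add: mean_square_def field_simps)
  have "(cmod (c - fourier_coeff f k))\<^sup>2 = (cmod c)\<^sup>2 - 2 * Re (cnj c * fourier_coeff f k) + (cmod (fourier_coeff f k))\<^sup>2"
    unfolding cmod_power2 by (simp add: power2_eq_square algebra_simps)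
  with 1 show ?thesis by simp
qed

text \<open>Removing the modes one at a time does not change the remaining Fourier coefficients. The identity
  yields Bessel's inequality (take the Fourier coefficients for \<open>c\<close>), the norm of a trigonometric
  sum (take \<open>f = 0\<close>), and, since the last sum is nonnegative, the optimality of Fourier sums.\<close>

lemma mean_square_diff_trig_sum:
  assumes "finite K" "continuous_on {0..2*pi} f"
  shows "mean_square (\<lambda>t. f t - (\<Sum>k\<in>K. c k * fourier_mode k t)) =
    mean_square f - (\<Sum>k\<in>K. (cmod (fourier_coeff f k))\<^sup>2) + (\<Sum>k\<in>K. (cmod (c k - fourier_coeff f k))\<^sup>2)"
  using assms
proof (induction K arbitrary: f)
  case empty
  then show ?case by simp
next
  case (insert k K)
  define f' where "f' = (\<lambda>t. f t - c k * fourier_mode k t)"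
  have cf': "continuous_on {0..2*pi} f'" unfolding f'_def by (intro continuous_intros insert)
  have eq: "fourier_coeff f' l = fourier_coeff f l" if "l \<in> K" for l
  proof -
    have "fourier_coeff f' l = fourier_coeff f l - fourier_coeff (\<lambda>t. c k * fourier_mode k t) l"
      unfolding f'_def by (intro fourier_coeff_diff continuous_intros insert)
    then show ?thesis using that insert by (auto simp: fourier_coeff_cmult fourier_coeff_fourier_mode)
  qed
  have "mean_square (\<lambda>t. f t - (\<Sum>k\<in>insert k K. c k * fourier_mode k t)) =
      mean_square (\<lambda>t. f' t - (\<Sum>k\<in>K. c k * fourier_mode k t))"
    using insert by (simp add: f'_def algebra_simps)
  also have "\<dots> = mean_square f' - (\<Sum>k\<in>K. (cmod (fourier_coeff f' k))\<^sup>2) + (\<Sum>k\<in>K. (cmod (c k - fourier_coeff f' k))\<^sup>2)"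
    by (rule insert.IH[OF cf'])
  also have "\<dots> = mean_square f' - (\<Sum>k\<in>K. (cmod (fourier_coeff f k))\<^sup>2) + (\<Sum>k\<in>K. (cmod (c k - fourier_coeff f k))\<^sup>2)"
    using eq by simp
  also have "mean_square f' = mean_square f - (cmod (fourier_coeff f k))\<^sup>2 + (cmod (c k - fourier_coeff f k))\<^sup>2"
    unfolding f'_def by (rule mean_square_diff_mode[OF insert.prems])
  finally show ?case using insert by simp
qed

lemma bessel_inequality:
  assumes "finite K" "continuous_on {0..2*pi} f"
  shows "(\<Sum>k\<in>K. (cmod (fourier_coeff f k))\<^sup>2) \<le> mean_square f"
  using mean_square_diff_trig_sum[OF assms, of "fourier_coeff f"]
    mean_square_nonneg[of "\<lambda>t. f t - (\<Sum>k\<in>K. fourier_coeff f k * fourier_mode k t)"]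
  by simp

lemma mean_square_trig_sum:
  assumes "finite K"
  shows "mean_square (\<lambda>t. \<Sum>k\<in>K. c k * fourier_mode k t) = (\<Sum>k\<in>K. (cmod (c k))\<^sup>2)"
  using mean_square_diff_trig_sum[OF assms, of "\<lambda>t. 0" c]
  by (simp add: mean_square_def fourier_coeff_def)

text \<open>Trigonometric polynomials, with an arbitrary finite set of frequencies so that sums and products need no common degree.\<close>

definition finite_mode_sum :: "(real \<Rightarrow> complex) \<Rightarrow> bool" where
  "finite_mode_sum p \<longleftrightarrow> (\<exists>K c. finite K \<and> p = (\<lambda>t. \<Sum>k\<in>K. c k * fourier_mode k t))"

lemma finite_mode_sum_mode: "finite_mode_sum (\<lambda>t. c * fourier_mode k t)"
  unfolding finite_mode_sum_def by (rule exI[of _ "{k}"], rule exI[of _ "\<lambda>_. c"]) simp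

lemma finite_mode_sum_add:
  assumes "finite_mode_sum p" "finite_mode_sum q"
  shows "finite_mode_sum (\<lambda>t. p t + q t)"
proof -
  obtain K c L d where p: "finite K" "p = (\<lambda>t. \<Sum>k\<in>K. c k * fourier_mode k t)"
    and q: "finite L" "q = (\<lambda>t. \<Sum>k\<in>L. d k * fourier_mode k t)"
    using assms unfolding finite_mode_sum_def by blast
  define e where "e = (\<lambda>k. (if k \<in> K then c k else 0) + (if k \<in> L then d k else 0))"
  have "p t + q t = (\<Sum>k\<in>K \<union> L. e k * fourier_mode k t)" for t
  proof -
    have "p t = (\<Sum>k\<in>K \<union> L. (if k \<in> K then c k else 0) * fourier_mode k t)"
      unfolding p(2) by (rule sum.mono_neutral_cong_left) (use p q in auto)
    moreover have "q t = (\<Sum>k\<in>K \<union> L. (if k \<in> L then d k else 0) * fourier_mode k t)"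
      unfolding q(2) by (rule sum.mono_neutral_cong_left) (use p q in auto)
    ultimately show ?thesis by (simp only: e_def distrib_right sum.distrib)
  qed
  then show ?thesis unfolding finite_mode_sum_def using p(1) q(1) by blast
qed

lemma finite_mode_sum_sum:
  assumes "finite I" "\<And>i. i \<in> I \<Longrightarrow> finite_mode_sum (F i)"
  shows "finite_mode_sum (\<lambda>t. \<Sum>i\<in>I. F i t)"
  using assms
proof (induction I)
  case empty
  then show ?case using finite_mode_sum_mode[of 0 0] by simp
next
  case (insert i I)
  then show ?case by (simp add: finite_mode_sum_add)
qed

lemma finite_mode_sum_mult:
  assumes "finite_mode_sum p" "finite_mode_sum q"
  shows "finite_mode_sum (\<lambda>t. p t * q t)"
proof -
  obtain K c L d where p: "finite K" "p = (\<lambda>t. \<Sum>k\<in>K. c k * fourier_mode k t)"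
    and q: "finite L" "q = (\<lambda>t. \<Sum>k\<in>L. d k * fourier_mode k t)"
    using assms unfolding finite_mode_sum_def by blast
  have "(\<lambda>t. p t * q t) = (\<lambda>t. \<Sum>k\<in>K. \<Sum>l\<in>L. (c k * d l) * fourier_mode (k + l) t)"
    by (simp add: p(2) q(2) sum_product fourier_mode_add algebra_simps)
  moreover have "finite_mode_sum \<dots>"
    by (intro finite_mode_sum_sum finite_mode_sum_mode p q)
  ultimately show ?thesis by simp
qed

lemma finite_mode_sum_const: "finite_mode_sum (\<lambda>t. c)"
  using finite_mode_sum_mode[of c 0] by simp

text \<open>On the unit circle the real and imaginary parts are combinations of \<open>exp (\<i> t)\<close> and \<open>exp (- \<i> t)\<close>.\<close>

lemma finite_mode_sum_polynomial:
  assumes "real_polynomial_function p"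
  shows "finite_mode_sum (\<lambda>t. of_real (p (exp (\<i> * of_real t))))"
  using assms
proof induction
  case (linear f)
  have *: "f (exp (\<i> * of_real t)) = cos t * f 1 + sin t * f \<i>" for t
  proof -
    interpret bounded_linear f by (rule linear)
    have "exp (\<i> * of_real t) = cos t *\<^sub>R 1 + sin t *\<^sub>R \<i>"
      by (simp add: complex_eq_iff exp_Euler cos_of_real sin_of_real)
    then show ?thesis by (simp only: add scaleR real_scaleR_def)
  qed
  have "(\<lambda>t. complex_of_real (f (exp (\<i> * of_real t)))) = (\<lambda>t. (f 1 / 2 - \<i> * f \<i> / 2) * fourier_mode 1 t + (f 1 / 2 + \<i> * f \<i> / 2) * fourier_mode (-1) t)"
    unfolding * fourier_mode_def
    by (simp add: fun_eq_iff complex_eq_iff exp_Euler cos_of_real sin_of_real exp_minus Re_divide Im_divide algebra_simps Re_exp Im_exp)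
  then show ?case by (simp only: finite_mode_sum_add finite_mode_sum_mode)
next
  case (const c)
  then show ?case by (rule finite_mode_sum_const)
next
  case (add f g)
  then show ?case by (simp add: finite_mode_sum_add)
next
  case (mult f g)
  then show ?case by (simp add: finite_mode_sum_mult)
qed

section \<open>Parseval and the Hankel part of a Krein symbol\<close>

text \<open>Stone--Weierstrass on the circle.\<close>

lemma circle_approximation:
  assumes F: "continuous_on (sphere 0 1) (F :: complex \<Rightarrow> complex)" and e: "\<epsilon> > 0"
  shows "\<exists>p. finite_mode_sum p \<and> (\<forall>t. cmod (F (exp (\<i> * of_real t)) - p t) < \<epsilon>)"
proof -
  obtain q where q: "polynomial_function q" "\<And>z. z \<in> sphere 0 1 \<Longrightarrow> norm (F z - q z) < \<epsilon>"
    using Stone_Weierstrass_polynomial_function[OF compact_sphere F e] by metis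
  define p where "p = (\<lambda>t::real. q (exp (\<i> * of_real t)))"
  have "real_polynomial_function (Re \<circ> q)" "real_polynomial_function (Im \<circ> q)"
    using q(1) bounded_linear_Re bounded_linear_Im unfolding polynomial_function_def by blast+
  from this[THEN finite_mode_sum_polynomial]
  have "finite_mode_sum (\<lambda>t. of_real (Re (p t)) + \<i> * of_real (Im (p t)))"
    unfolding p_def by (intro finite_mode_sum_add finite_mode_sum_mult finite_mode_sum_const) (simp_all add: o_def)
  then have "finite_mode_sum p" by (simp add: complex_eq[symmetric])
  moreover have "cmod (F (exp (\<i> * of_real t)) - p t) < \<epsilon>" for t
    unfolding p_def by (rule q(2)) simp
  ultimately show ?thesis by blast
qed

text \<open>A continuous function on \<open>[0, 2\<pi>]\<close> with different values at the endpoints jumps at \<open>1\<close> when it is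
  carried to the circle. A continuous factor that vanishes there removes the jump.\<close>

lemma continuous_on_circle_cutoff:
  assumes f: "continuous_on {0..2*pi} f" and N: "(N::real) \<ge> 0"
  shows "continuous_on (sphere 0 1) (\<lambda>z. f (Arg2pi z) * of_real (min 1 (N * cmod (z - 1))) :: complex)"
proof -
  have bdd: "bounded (f ` {0..2*pi})"
    using compact_continuous_image[OF f] compact_imp_bounded by blast
  then obtain M where M: "\<And>t. t \<in> {0..2*pi} \<Longrightarrow> cmod (f t) \<le> M"
    unfolding bounded_iff by (metis imageI)
  have A: "Arg2pi z \<in> {0..2*pi}" for z using Arg2pi[of z] by auto
  have "continuous (at z within sphere 0 1) (\<lambda>z. f (Arg2pi z) * of_real (min 1 (N * cmod (z - 1))))"
    if z: "z \<in> sphere 0 1" for z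
  proof (cases "z = 1")
    case True
    have "((\<lambda>z. f (Arg2pi z) * of_real (min 1 (N * cmod (z - 1)))) \<longlongrightarrow> 0) (at 1 within sphere 0 1)"
    proof (rule Lim_null_comparison)
      show "\<forall>\<^sub>F z in at 1 within sphere 0 1. norm (f (Arg2pi z) * of_real (min 1 (N * cmod (z - 1)))) \<le> \<bar>M\<bar> * (N * cmod (z - 1))"
      proof (intro always_eventually allI)
        fix z
        have "cmod (f (Arg2pi z)) \<le> \<bar>M\<bar>" using M[OF A, of z] by linarith
        moreover have "\<bar>min 1 (N * cmod (z - 1))\<bar> \<le> N * cmod (z - 1)" using N by (auto simp: min_def)
        ultimately show "norm (f (Arg2pi z) * of_real (min 1 (N * cmod (z - 1)))) \<le> \<bar>M\<bar> * (N * cmod (z - 1))"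
          unfolding norm_mult norm_of_real by (intro mult_mono) auto
      qed
      have "((\<lambda>z::complex. \<bar>M\<bar> * (N * cmod (z - 1))) \<longlongrightarrow> \<bar>M\<bar> * (N * cmod (1 - 1))) (at 1 within sphere 0 1)"
        by (intro tendsto_intros)
      then show "((\<lambda>z::complex. \<bar>M\<bar> * (N * cmod (z - 1))) \<longlongrightarrow> 0) (at 1 within sphere 0 1)" by simp
    qed
    then show ?thesis by (simp add: True continuous_within)
  next
    case False
    then have nn: "z \<notin> \<real>\<^sub>\<ge>\<^sub>0"
      using z by (auto simp: complex_nonneg_Reals_iff complex_eq_iff cmod_def power2_eq_1_iff)
    then have "Arg2pi z \<noteq> 0" by (auto simp add: Arg2pi_eq_0 complex_nonneg_Reals_iff complex_is_Real_iff)
    then have "Arg2pi z \<in> {0<..<2*pi}" using Arg2pi[of z] by auto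
    then have "isCont f (Arg2pi z)"
      using f continuous_on_interior[of "{0..2*pi}" f "Arg2pi z"] by simp
    then have "isCont (\<lambda>z. f (Arg2pi z)) z"
      using continuous_at_Arg2pi[OF nn] by (rule isCont_o2[rotated])
    then have "isCont (\<lambda>z. f (Arg2pi z) * of_real (min 1 (N * cmod (z - 1)))) z"
      by (intro continuous_intros)
    then show ?thesis by (rule continuous_at_imp_continuous_within)
  qed
  then show ?thesis by (simp add: continuous_on_eq_continuous_within)
qed

text \<open>The cutoff alters the function only near the two endpoints, so its cost in mean square is negligible.\<close>

lemma mean_square_cutoff_tendsto_0:
  assumes f: "continuous_on {0..2*pi} f"
  shows "(\<lambda>N. mean_square (\<lambda>t. f t * of_real (1 - min 1 (real N * cmod (exp (\<i> * of_real t) - 1))))) \<longlonglongrightarrow> 0"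
proof -
  define G where "G = (\<lambda>N t. (cmod (f t * of_real (1 - min 1 (real N * cmod (exp (\<i> * of_real t) - 1)))))\<^sup>2)"
  define g where "g = (\<lambda>t. if t \<in> {0, 2*pi} then (cmod (f t))\<^sup>2 else 0)"
  have "(\<lambda>N. integral {0..2*pi} (G N)) \<longlonglongrightarrow> integral {0..2*pi} g"
  proof (rule dominated_convergence)
    show "G N integrable_on {0..2*pi}" for N
      unfolding G_def by (intro integrable_continuous_interval continuous_intros f)
    show "(\<lambda>t. (cmod (f t))\<^sup>2) integrable_on {0..2*pi}"
      by (intro integrable_continuous_interval continuous_intros f)
    show "norm (G N t) \<le> (cmod (f t))\<^sup>2" if "t \<in> {0..2*pi}" for N t
    proof -
      define s where "s = 1 - min 1 (real N * cmod (exp (\<i> * of_real t) - 1))"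
      have "\<bar>s\<bar> \<le> 1" by (simp add: s_def)
      then have "cmod (f t * of_real s) \<le> cmod (f t)" by (simp add: norm_mult mult_left_le)
      then show ?thesis unfolding G_def s_def by (simp add: power_mono)
    qed
    show "(\<lambda>N. G N t) \<longlonglongrightarrow> g t" if t: "t \<in> {0..2*pi}" for t
    proof (cases "t \<in> {0, 2*pi}")
      case True
      then have "exp (\<i> * complex_of_real t) = 1" by (auto simp: exp_eq_1)
      then show ?thesis using True by (simp add: G_def g_def)
    next
      case False
      have "exp (\<i> * complex_of_real t) \<noteq> 1"
      proof
        assume "exp (\<i> * complex_of_real t) = 1"
        then obtain n :: int where "t = of_int (2 * n) * pi" by (auto simp: exp_eq_1)
        then have "n \<ge> 0" "n \<le> 1" "n \<noteq> 0" "n \<noteq> 1"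
          using t False pi_gt_zero by (auto simp: zero_le_mult_iff)
        then show False by simp
      qed
      then have pos: "cmod (exp (\<i> * complex_of_real t) - 1) > 0" by simp
      then obtain N0 :: nat where N0: "real N0 * cmod (exp (\<i> * complex_of_real t) - 1) > 1"
        using reals_Archimedean3 by blast
      have "\<forall>\<^sub>F N in sequentially. G N t = g t"
        unfolding eventually_sequentially
      proof (intro exI allI impI)
        fix N assume "N0 \<le> N"
        then have "real N0 * cmod (exp (\<i> * complex_of_real t) - 1) \<le> real N * cmod (exp (\<i> * complex_of_real t) - 1)"
          by (intro mult_right_mono) auto
        then show "G N t = g t" using N0 False by (simp add: G_def g_def)
      qed
      then show ?thesis by (rule tendsto_eventually)
    qed
  qed
  also have "integral {0..2*pi} g = 0"
  proof (rule integral_unique)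
    show "(g has_integral 0) {0..2*pi}"
      by (rule has_integral_spike_finite[of "{0, 2*pi}" _ g "\<lambda>_. 0"]) (auto simp: g_def)
  qed
  finally have "(\<lambda>N. integral {0..2*pi} (G N) / (2 * pi)) \<longlonglongrightarrow> 0 / (2 * pi)"
    by (intro tendsto_intros) auto
  then show ?thesis by (simp add: mean_square_def G_def)
qed

lemma mean_square_add_le:
  assumes "continuous_on {0..2*pi} f" "continuous_on {0..2*pi} h"
  shows "mean_square (\<lambda>t. f t + h t) \<le> 2 * mean_square f + 2 * mean_square h"
proof -
  have pt: "(cmod (z + w))\<^sup>2 \<le> 2 * (cmod z)\<^sup>2 + 2 * (cmod w)\<^sup>2" for z w
  proof -
    have "(cmod (z + w))\<^sup>2 \<le> (cmod z + cmod w)\<^sup>2" by (intro power_mono norm_triangle_ineq) auto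
    also have "\<dots> \<le> 2 * (cmod z)\<^sup>2 + 2 * (cmod w)\<^sup>2"
      using sum_squares_bound[of "cmod z" "cmod w"] by (simp add: power2_sum)
    finally show ?thesis .
  qed
  have "integral {0..2*pi} (\<lambda>t. (cmod (f t + h t))\<^sup>2) \<le> integral {0..2*pi} (\<lambda>t. 2 * (cmod (f t))\<^sup>2 + 2 * (cmod (h t))\<^sup>2)"
    by (intro integral_le integrable_continuous_interval continuous_intros assms pt)
  also have "\<dots> = 2 * integral {0..2*pi} (\<lambda>t. (cmod (f t))\<^sup>2) + 2 * integral {0..2*pi} (\<lambda>t. (cmod (h t))\<^sup>2)"
    by (subst integral_add) (auto intro!: integrable_continuous_interval continuous_intros assms)
  finally show ?thesis by (simp add: mean_square_def field_simps)
qed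

text \<open>The reverse of Bessel's inequality up to \<open>\<epsilon>\<close>. Cutting off and then applying the
  Stone--Weierstrass theorem on the circle gives a trigonometric sum close to \<open>f\<close> in mean square, and the
  Fourier sum over the same frequencies is at least as close.\<close>

lemma parseval_approximation:
  assumes f: "continuous_on {0..2*pi} f" and e: "\<epsilon> > 0"
  shows "\<exists>K. finite K \<and> mean_square f < \<epsilon> + (\<Sum>k\<in>K. (cmod (fourier_coeff f k))\<^sup>2)"
proof -
  obtain N where N: "mean_square (\<lambda>t. f t * of_real (1 - min 1 (real N * cmod (exp (\<i> * of_real t) - 1)))) < \<epsilon> / 4"
    using order_tendstoD(2)[OF mean_square_cutoff_tendsto_0[OF f], of "\<epsilon> / 4"] e
    by (auto simp: eventually_sequentially)
  define F where "F = (\<lambda>z. f (Arg2pi z) * of_real (min 1 (real N * cmod (z - 1))) :: complex)"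
  define d where "d = sqrt (\<epsilon> / 4)"
  have d: "d > 0" using e by (simp add: d_def)
  obtain p where p: "finite_mode_sum p" "\<And>t. cmod (F (exp (\<i> * of_real t)) - p t) < d"
    using circle_approximation[OF continuous_on_circle_cutoff[OF f] d, of "real N"] unfolding F_def by auto
  obtain K c where K: "finite K" and pc: "p = (\<lambda>t. \<Sum>k\<in>K. c k * fourier_mode k t)"
    using p(1) unfolding finite_mode_sum_def by blast
  have cont_p: "continuous_on {0..2*pi} p" unfolding pc by (intro continuous_intros)
  have Ft: "F (exp (\<i> * of_real t)) = f t * of_real (min 1 (real N * cmod (exp (\<i> * of_real t) - 1)))"
    if t: "t \<in> {0..2*pi}" for t
  proof (cases "t = 2*pi")
    case True
    then have "exp (\<i> * complex_of_real t) = 1" by (auto simp: exp_eq_1)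
    then show ?thesis by (simp add: F_def)
  next
    case False
    then show ?thesis using t Arg2pi_exp[of "\<i> * complex_of_real t"] by (simp add: F_def)
  qed
  let ?f1 = "\<lambda>t. f t * of_real (1 - min 1 (real N * cmod (exp (\<i> * of_real t) - 1)))"
  let ?f2 = "\<lambda>t. f t * of_real (min 1 (real N * cmod (exp (\<i> * of_real t) - 1))) - p t"
  have c1: "continuous_on {0..2*pi} ?f1" and c2: "continuous_on {0..2*pi} ?f2"
    by (intro continuous_intros f cont_p)+
  have "mean_square ?f2 \<le> d\<^sup>2 * mean_square (\<lambda>_. 1)"
    using c2 by (rule mean_square_mono) (use p(2)[THEN less_imp_le] Ft[symmetric] in auto)
  also have "\<dots> = \<epsilon> / 4" using e by (simp add: mean_square_def d_def)
  finally have 2: "mean_square ?f2 \<le> \<epsilon> / 4" .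
  have "mean_square (\<lambda>t. f t - p t) = mean_square (\<lambda>t. ?f1 t + ?f2 t)" by (simp add: algebra_simps)
  also have "\<dots> < \<epsilon>" using mean_square_add_le[OF c1 c2] N 2 by simp
  finally have "mean_square f - (\<Sum>k\<in>K. (cmod (fourier_coeff f k))\<^sup>2) + (\<Sum>k\<in>K. (cmod (c k - fourier_coeff f k))\<^sup>2) < \<epsilon>"
    unfolding pc mean_square_diff_trig_sum[OF K f] .
  moreover have "(\<Sum>k\<in>K. (cmod (c k - fourier_coeff f k))\<^sup>2) \<ge> 0" by (intro sum_nonneg) auto
  ultimately have "mean_square f < \<epsilon> + (\<Sum>k\<in>K. (cmod (fourier_coeff f k))\<^sup>2)" by linarith
  then show ?thesis using K by blast
qed

text \<open>By Parseval, the summand for \<open>j\<close> is the sum of the \<open>\<bar>a\<^sub>k\<bar>\<^sup>2\<close> over those \<open>k\<close> for which \<open>j - k\<close> lies outside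
  \<open>{0..<n}\<close>. A given \<open>k\<close> is counted for at most \<open>\<bar>k\<bar>\<close> values of \<open>j\<close>. This sum is the squared
  Hilbert--Schmidt norm of multiplication by \<open>g\<close> from the complement of the window into the window.
  The summand \<open>1\<close> pays for the error in Parseval.\<close>

lemma hankel_tail_bound:
  fixes n :: nat
  assumes g: "continuous_on {0..2*pi} g"
    and krein: "(\<lambda>k::int. real_of_int \<bar>k\<bar> * (cmod (fourier_coeff g k))\<^sup>2) summable_on UNIV"
  shows "(\<Sum>j<n. mean_square g - (\<Sum>l<n. (cmod (fourier_coeff g (int j - int l)))\<^sup>2)) \<le>
    1 + (\<Sum>\<^sub>\<infinity>k::int. real_of_int \<bar>k\<bar> * (cmod (fourier_coeff g k))\<^sup>2)"
proof (cases "n = 0")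
  case True
  then show ?thesis by (auto intro!: add_nonneg_nonneg infsum_nonneg)
next
  case False
  define w where "w = (\<lambda>k. (cmod (fourier_coeff g k))\<^sup>2)"
  obtain K where K: "finite K" and *: "mean_square g < 1 / n + (\<Sum>k\<in>K. w k)"
    using parseval_approximation[OF g, of "1/n"] False unfolding w_def by auto
  have wn: "w k \<ge> 0" for k by (simp add: w_def)
  \<comment> \<open>The frequencies that row \<open>j\<close> of the matrix of size \<open>n\<close> sees.\<close>
  define J where "J = (\<lambda>j::nat. (\<lambda>l. int j - int l) ` {..<n})"
  have "(\<Sum>j<n. mean_square g - (\<Sum>l<n. w (int j - int l))) \<le> (\<Sum>j<n. 1 / n + (\<Sum>k\<in>K. if k \<in> J j then 0 else w k))"
  proof (rule sum_mono)
    fix j assume "j \<in> {..<n}"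
    have "(\<Sum>l<n. w (int j - int l)) = sum w (J j)"
      unfolding J_def by (subst sum.reindex) (auto simp: inj_on_def o_def)
    moreover have "(\<Sum>k\<in>K. w k) = (\<Sum>k\<in>K. if k \<in> J j then 0 else w k) + (\<Sum>k\<in>K \<inter> J j. w k)"
      using K by (simp add: sum.inter_restrict sum.distrib[symmetric] if_distrib) (intro sum.cong, auto)
    moreover have "(\<Sum>k\<in>K \<inter> J j. w k) \<le> sum w (J j)"
      by (rule sum_mono2) (auto simp: J_def wn)
    ultimately show "mean_square g - (\<Sum>l<n. w (int j - int l)) \<le> 1 / n + (\<Sum>k\<in>K. if k \<in> J j then 0 else w k)"
      using * by linarith
  qed
  also have "\<dots> = 1 + (\<Sum>k\<in>K. \<Sum>j<n. if k \<in> J j then 0 else w k)"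
    using False by (simp add: sum.distrib sum.swap[of _ K])
  also have "(\<Sum>k\<in>K. \<Sum>j<n. if k \<in> J j then 0 else w k) \<le> (\<Sum>k\<in>K. real_of_int \<bar>k\<bar> * w k)"
  proof (rule sum_mono)
    fix k :: int
    have "{j\<in>{..<n}. k \<notin> J j} \<subseteq> (if k \<ge> 0 then {..<nat k} else {n - nat (-k)..<n})"
    proof
      fix j assume "j \<in> {j\<in>{..<n}. k \<notin> J j}"
      then have j: "j < n" "k \<notin> J j" by auto
      have "\<not> (0 \<le> int j - k \<and> int j - k < int n)"
      proof
        assume "0 \<le> int j - k \<and> int j - k < int n"
        then have "nat (int j - k) < n" "k = int j - int (nat (int j - k))" by auto
        then show False using j(2) unfolding J_def by blast
      qed
      then show "j \<in> (if k \<ge> 0 then {..<nat k} else {n - nat (-k)..<n})" using j(1) by auto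
    qed
    then have "card {j\<in>{..<n}. k \<notin> J j} \<le> card (if k \<ge> 0 then {..<nat k} else {n - nat (-k)..<n})"
      by (intro card_mono) auto
    also have "\<dots> \<le> nat \<bar>k\<bar>" by auto
    finally have card: "real (card {j\<in>{..<n}. k \<notin> J j}) \<le> real_of_int \<bar>k\<bar>" by linarith
    have "(\<Sum>j<n. if k \<in> J j then 0 else w k) = (\<Sum>j\<in>{j\<in>{..<n}. k \<notin> J j}. w k)"
      by (intro sum.mono_neutral_cong_right) auto
    also have "\<dots> = real (card {j\<in>{..<n}. k \<notin> J j}) * w k" by simp
    also have "\<dots> \<le> real_of_int \<bar>k\<bar> * w k" using card wn by (rule mult_right_mono)
    finally show "(\<Sum>j<n. if k \<in> J j then 0 else w k) \<le> real_of_int \<bar>k\<bar> * w k" .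
  qed
  also have "(\<Sum>k\<in>K. real_of_int \<bar>k\<bar> * w k) \<le> (\<Sum>\<^sub>\<infinity>k::int. real_of_int \<bar>k\<bar> * w k)"
    using krein K unfolding w_def by (intro finite_sum_le_infsum) auto
  finally show ?thesis by (simp add: w_def)
qed

text \<open>The \<open>j\<close>-th row of \<open>T(gh) - T(g) T(h)\<close> consists of Fourier coefficients of \<open>R\<^sub>j h\<close>, where \<open>R\<^sub>j\<close> is \<open>g\<close>
  without the modes that row \<open>j\<close> of \<open>T(g)\<close> sees. Bessel's inequality reduces the claim to the
  mean squares of the \<open>R\<^sub>j\<close>.\<close>

lemma fourier_coeff_product_defect:
  fixes n :: nat
  assumes g: "continuous_on {0..2*pi} g" and h: "continuous_on {0..2*pi} h"
    and krein: "(\<lambda>k::int. real_of_int \<bar>k\<bar> * (cmod (fourier_coeff g k))\<^sup>2) summable_on UNIV"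
    and M: "\<And>t. t \<in> {0..2*pi} \<Longrightarrow> cmod (h t) \<le> M"
  shows "(\<Sum>j<n. \<Sum>k<n. (cmod (fourier_coeff (\<lambda>t. g t * h t) (int j - int k) -
      (\<Sum>l<n. fourier_coeff g (int j - int l) * fourier_coeff h (int l - int k))))\<^sup>2)
    \<le> M\<^sup>2 * (1 + (\<Sum>\<^sub>\<infinity>k::int. real_of_int \<bar>k\<bar> * (cmod (fourier_coeff g k))\<^sup>2))" (is "?L \<le> _")
proof -
  define R where "R = (\<lambda>j t. g t - (\<Sum>l<n. fourier_coeff g (int j - int l) * fourier_mode (int j - int l) t))"
  have cR: "continuous_on {0..2*pi} (R j)" for j unfolding R_def by (intro continuous_intros g)
  have row: "(\<Sum>k<n. (cmod (fourier_coeff (\<lambda>t. g t * h t) (int j - int k) -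
      (\<Sum>l<n. fourier_coeff g (int j - int l) * fourier_coeff h (int l - int k))))\<^sup>2)
      \<le> M\<^sup>2 * (mean_square g - (\<Sum>l<n. (cmod (fourier_coeff g (int j - int l)))\<^sup>2))" for j
  proof -
    let ?J = "(\<lambda>l. int j - int l) ` {..<n}"
    have inj: "inj_on (\<lambda>l. int j - int l) {..<n}" by (auto simp: inj_on_def)
    have 1: "fourier_coeff (\<lambda>t. g t * h t) (int j - int k) -
      (\<Sum>l<n. fourier_coeff g (int j - int l) * fourier_coeff h (int l - int k))
      = fourier_coeff (\<lambda>t. R j t * h t) (int j - int k)" for k
    proof -
      have "fourier_coeff (\<lambda>t. R j t * h t) (int j - int k) =
        fourier_coeff (\<lambda>t. g t * h t - (\<Sum>l<n. fourier_coeff g (int j - int l) * (h t * fourier_mode (int j - int l) t))) (int j - int k)"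
        by (simp add: R_def left_diff_distrib sum_distrib_right) (simp add: mult_ac)
      also have "\<dots> = fourier_coeff (\<lambda>t. g t * h t) (int j - int k) -
          (\<Sum>l<n. fourier_coeff g (int j - int l) * fourier_coeff h (int l - int k))"
        by (subst fourier_coeff_diff, (intro continuous_intros g h)+, subst fourier_coeff_sum)
          (auto intro!: continuous_intros g h simp: fourier_coeff_cmult fourier_coeff_mult_mode)
      finally show ?thesis by simp
    qed
    have "(\<Sum>k<n. (cmod (fourier_coeff (\<lambda>t. R j t * h t) (int j - int k)))\<^sup>2) =
        (\<Sum>k\<in>?J. (cmod (fourier_coeff (\<lambda>t. R j t * h t) k))\<^sup>2)"
      by (subst sum.reindex[OF inj]) (simp add: o_def)
    also have "\<dots> \<le> mean_square (\<lambda>t. R j t * h t)"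
      by (intro bessel_inequality continuous_intros h cR) auto
    also have "\<dots> \<le> M\<^sup>2 * mean_square (R j)"
      using cR h M by (intro mean_square_mono continuous_intros) (auto simp: norm_mult mult.commute mult_right_mono)
    also have "mean_square (R j) = mean_square (\<lambda>t. g t - (\<Sum>k\<in>?J. fourier_coeff g k * fourier_mode k t))"
      unfolding R_def by (subst sum.reindex[OF inj]) (simp add: o_def)
    also have "\<dots> = mean_square g - (\<Sum>k\<in>?J. (cmod (fourier_coeff g k))\<^sup>2)"
      by (subst mean_square_diff_trig_sum) (auto simp: g)
    also have "(\<Sum>k\<in>?J. (cmod (fourier_coeff g k))\<^sup>2) = (\<Sum>l<n. (cmod (fourier_coeff g (int j - int l)))\<^sup>2)"
      by (subst sum.reindex[OF inj]) (simp add: o_def)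
    finally show ?thesis by (simp only: 1)
  qed
  have "?L \<le> (\<Sum>j<n. M\<^sup>2 * (mean_square g - (\<Sum>l<n. (cmod (fourier_coeff g (int j - int l)))\<^sup>2)))"
    by (intro sum_mono row)
  also have "\<dots> = M\<^sup>2 * (\<Sum>j<n. mean_square g - (\<Sum>l<n. (cmod (fourier_coeff g (int j - int l)))\<^sup>2))"
    by (simp add: sum_distrib_left)
  also have "\<dots> \<le> M\<^sup>2 * (1 + (\<Sum>\<^sub>\<infinity>k::int. real_of_int \<bar>k\<bar> * (cmod (fourier_coeff g k))\<^sup>2))"
    by (intro mult_left_mono hankel_tail_bound g krein) auto
  finally show ?thesis .
qed

section \<open>Euclidean, Frobenius and operator norms\<close>

definition vnorm :: "complex vec \<Rightarrow> real" where
  "vnorm u = L2_set (\<lambda>i. cmod (u $ i)) {..<dim_vec u}"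

definition frobenius_norm :: "complex mat \<Rightarrow> real" where
  "frobenius_norm A = L2_set (\<lambda>(i, j). cmod (A $$ (i, j))) ({..<dim_row A} \<times> {..<dim_col A})"

definition opnorm_le :: "complex mat \<Rightarrow> real \<Rightarrow> bool" where
  "opnorm_le A c \<longleftrightarrow> c \<ge> 0 \<and> (\<forall>u\<in>carrier_vec (dim_col A). vnorm (A *\<^sub>v u) \<le> c * vnorm u)"

lemma vnorm_nonneg [simp]: "vnorm u \<ge> 0"
  by (simp add: vnorm_def)

lemma vnorm_sq: "(vnorm u)\<^sup>2 = (\<Sum>i<dim_vec u. (cmod (u $ i))\<^sup>2)"
  by (simp add: vnorm_def L2_set_def sum_nonneg)

lemma vnorm_add:
  assumes "u \<in> carrier_vec n" "w \<in> carrier_vec n"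
  shows "vnorm (u + w) \<le> vnorm u + vnorm w"
proof -
  have "vnorm (u + w) \<le> L2_set (\<lambda>i. cmod (u $ i) + cmod (w $ i)) {..<n}"
    unfolding vnorm_def using assms by (auto intro!: L2_set_mono norm_triangle_ineq)
  also have "\<dots> \<le> vnorm u + vnorm w"
    unfolding vnorm_def using assms L2_set_triangle_ineq by auto
  finally show ?thesis .
qed

lemma cmod_index_le_vnorm: "i < dim_vec u \<Longrightarrow> cmod (u $ i) \<le> vnorm u"
  unfolding vnorm_def by (rule member_le_L2_set) auto

lemma scalar_prod_conjugate_eq:
  "u \<in> carrier_vec n \<Longrightarrow> w \<in> carrier_vec n \<Longrightarrow>
    scalar_prod u (conjugate w) = (\<Sum>i<n. u $ i * cnj (w $ i))"
  unfolding scalar_prod_def by (intro sum.cong) auto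

lemma scalar_prod_self: "scalar_prod (u :: complex vec) (conjugate u) = of_real ((vnorm u)\<^sup>2)"
  unfolding scalar_prod_conjugate_eq[OF carrier_vec_dim_vec carrier_vec_dim_vec] vnorm_sq
  by (simp only: of_real_sum complex_norm_square)

lemma cauchy_schwarz_vec:
  assumes "u \<in> carrier_vec n" "w \<in> carrier_vec n"
  shows "cmod (scalar_prod u (conjugate w)) \<le> vnorm u * vnorm w"
proof -
  have "cmod (scalar_prod u (conjugate w)) \<le> (\<Sum>i<n. \<bar>cmod (u $ i)\<bar> * \<bar>cmod (w $ i)\<bar>)"
    unfolding scalar_prod_conjugate_eq[OF assms] by (rule sum_norm_le) (simp add: norm_mult)
  also have "\<dots> \<le> vnorm u * vnorm w"
    unfolding vnorm_def using assms L2_set_mult_ineq[of "\<lambda>i. cmod (u $ i)" "\<lambda>i. cmod (w $ i)" "{..<n}"] by auto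
  finally show ?thesis .
qed

lemma mat_adjoint_dim [simp]: "dim_row (mat_adjoint A) = dim_col A" "dim_col (mat_adjoint A) = dim_row A"
  by (simp_all add: mat_adjoint_def)

lemma mat_adjoint_carrier [simp]: "A \<in> carrier_mat n m \<Longrightarrow> mat_adjoint A \<in> carrier_mat m n"
  by (auto intro!: carrier_matI)

lemma mat_adjoint_index [simp]:
  "i < dim_col A \<Longrightarrow> j < dim_row A \<Longrightarrow> mat_adjoint A $$ (i, j) = cnj (A $$ (j, i))"
  by (simp add: mat_adjoint_def mat_of_rows_index)

lemma mat_adjoint_adjoint [simp]: "mat_adjoint (mat_adjoint A) = (A :: complex mat)"
  by (rule eq_matI) auto

lemma index_mult_mat_sum:
  "A \<in> carrier_mat n m \<Longrightarrow> B \<in> carrier_mat m p \<Longrightarrow> i < n \<Longrightarrow> j < p \<Longrightarrow>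
    (A * B) $$ (i, j) = (\<Sum>k<m. A $$ (i, k) * B $$ (k, j))"
  by (auto simp: scalar_prod_def lessThan_atLeast0 intro!: sum.cong)

lemma index_mult_mat_vec_sum:
  "A \<in> carrier_mat n m \<Longrightarrow> u \<in> carrier_vec m \<Longrightarrow> i < n \<Longrightarrow>
    (A *\<^sub>v u) $ i = (\<Sum>k<m. A $$ (i, k) * u $ k)"
  by (auto simp: scalar_prod_def lessThan_atLeast0 intro!: sum.cong)

lemma mat_adjoint_mult:
  assumes "A \<in> carrier_mat n m" "B \<in> carrier_mat m (p::nat)"
  shows "mat_adjoint (A * B) = mat_adjoint B * mat_adjoint (A :: complex mat)"
proof (rule eq_matI)
  fix i j assume ij: "i < dim_row (mat_adjoint B * mat_adjoint A)" "j < dim_col (mat_adjoint B * mat_adjoint A)"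
  then have ij: "i < p" "j < n" using assms by auto
  have "mat_adjoint (A * B) $$ (i, j) = cnj ((A * B) $$ (j, i))" using ij assms by simp
  also have "\<dots> = (\<Sum>k<m. cnj (A $$ (j, k)) * cnj (B $$ (k, i)))"
    by (subst index_mult_mat_sum[OF assms]) (use ij in auto)
  also have "\<dots> = (\<Sum>k<m. mat_adjoint B $$ (i, k) * mat_adjoint A $$ (k, j))"
    using ij assms by (intro sum.cong) auto
  also have "\<dots> = (mat_adjoint B * mat_adjoint A) $$ (i, j)"
    by (subst index_mult_mat_sum[of _ p m _ n]) (use ij assms in auto)
  finally show "mat_adjoint (A * B) $$ (i, j) = (mat_adjoint B * mat_adjoint A) $$ (i, j)" .
qed (use assms in auto)

lemma scalar_prod_mult_adjoint:
  fixes A :: "complex mat"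
  assumes A: "A \<in> carrier_mat n m" and u: "u \<in> carrier_vec m" and w: "w \<in> carrier_vec n"
  shows "scalar_prod (A *\<^sub>v u) (conjugate w) = scalar_prod u (conjugate (mat_adjoint A *\<^sub>v w))"
proof -
  have w': "mat_adjoint A *\<^sub>v w \<in> carrier_vec m" using A by (auto intro: carrier_vecI)
  have "scalar_prod (A *\<^sub>v u) (conjugate w) = (\<Sum>i<n. (\<Sum>k<m. A $$ (i, k) * u $ k) * cnj (w $ i))"
    by (subst scalar_prod_conjugate_eq[of _ n]) (use A u w in \<open>auto simp: index_mult_mat_vec_sum simp del: index_mult_mat_vec\<close>)
  also have "\<dots> = (\<Sum>k<m. \<Sum>i<n. A $$ (i, k) * u $ k * cnj (w $ i))"
    unfolding sum_distrib_right by (rule sum.swap)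
  also have "\<dots> = (\<Sum>k<m. u $ k * cnj (\<Sum>i<n. mat_adjoint A $$ (k, i) * w $ i))"
    using A by (intro sum.cong) (auto simp: sum_distrib_left mult_ac)
  also have "\<dots> = scalar_prod u (conjugate (mat_adjoint A *\<^sub>v w))"
    by (subst scalar_prod_conjugate_eq[of _ m])
      (use A u w w' in \<open>auto simp: index_mult_mat_vec_sum[OF mat_adjoint_carrier[OF A] w] simp del: index_mult_mat_vec cnj_sum\<close>)
  finally show ?thesis .
qed

lemma frobenius_norm_nonneg [simp]: "frobenius_norm A \<ge> 0"
  by (simp add: frobenius_norm_def)

lemma frobenius_norm_sq: "(frobenius_norm A)\<^sup>2 = (\<Sum>i<dim_row A. \<Sum>j<dim_col A. (cmod (A $$ (i, j)))\<^sup>2)"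
  by (simp add: frobenius_norm_def L2_set_def sum_nonneg sum.cartesian_product case_prod_unfold)

lemma frobenius_norm_sq_cols: "(frobenius_norm A)\<^sup>2 = (\<Sum>j<dim_col A. (vnorm (col A j))\<^sup>2)"
  unfolding frobenius_norm_sq vnorm_sq by (subst sum.swap) simp

lemma frobenius_norm_adjoint [simp]: "frobenius_norm (mat_adjoint A) = frobenius_norm A"
proof -
  have "(frobenius_norm (mat_adjoint A))\<^sup>2 = (frobenius_norm A)\<^sup>2"
    unfolding frobenius_norm_sq by (simp, subst sum.swap) simp
  then show ?thesis by simp
qed

lemma frobenius_norm_add:
  assumes "A \<in> carrier_mat n m" "B \<in> carrier_mat n m"
  shows "frobenius_norm (A + B) \<le> frobenius_norm A + frobenius_norm B"
proof -
  have "frobenius_norm (A + B) \<le>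
      L2_set (\<lambda>x. cmod (A $$ x) + cmod (B $$ x)) ({..<n} \<times> {..<m})"
    unfolding frobenius_norm_def using assms by (auto intro!: L2_set_mono norm_triangle_ineq)
  also have "\<dots> \<le> frobenius_norm A + frobenius_norm B"
    unfolding frobenius_norm_def using assms
      L2_set_triangle_ineq[of "\<lambda>x. cmod (A $$ x)" "\<lambda>x. cmod (B $$ x)" "{..<n} \<times> {..<m}"]
    by (auto simp: case_prod_unfold)
  finally show ?thesis .
qed

lemma opnorm_leD: "opnorm_le A c \<Longrightarrow> A \<in> carrier_mat n m \<Longrightarrow> u \<in> carrier_vec m \<Longrightarrow> vnorm (A *\<^sub>v u) \<le> c * vnorm u"
  by (auto simp: opnorm_le_def)

lemma opnorm_le_nonneg: "opnorm_le A c \<Longrightarrow> c \<ge> 0"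
  by (simp add: opnorm_le_def)

lemma opnorm_leI: "A \<in> carrier_mat n m \<Longrightarrow> c \<ge> 0 \<Longrightarrow> (\<And>u. u \<in> carrier_vec m \<Longrightarrow> vnorm (A *\<^sub>v u) \<le> c * vnorm u) \<Longrightarrow> opnorm_le A c"
  by (auto simp: opnorm_le_def)

lemma opnorm_le_add:
  assumes "A \<in> carrier_mat n m" "B \<in> carrier_mat n m" "opnorm_le A c" "opnorm_le B d"
  shows "opnorm_le (A + B) (c + d)"
proof (rule opnorm_leI)
  fix u :: "complex vec" assume u: "u \<in> carrier_vec m"
  have "vnorm ((A + B) *\<^sub>v u) = vnorm (A *\<^sub>v u + B *\<^sub>v u)"
    using assms u by (simp add: add_mult_distrib_mat_vec)
  also have "\<dots> \<le> vnorm (A *\<^sub>v u) + vnorm (B *\<^sub>v u)"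
    using assms u by (intro vnorm_add[of _ n]) auto
  also have "\<dots> \<le> (c + d) * vnorm u"
    using opnorm_leD[OF assms(3,1) u] opnorm_leD[OF assms(4,2) u] by (simp add: algebra_simps)
  finally show "vnorm ((A + B) *\<^sub>v u) \<le> (c + d) * vnorm u" .
qed (use assms opnorm_le_nonneg in auto)

lemma opnorm_le_mult:
  assumes "A \<in> carrier_mat n m" "B \<in> carrier_mat m p" "opnorm_le A c" "opnorm_le B d"
  shows "opnorm_le (A * B) (c * d)"
proof (rule opnorm_leI)
  fix u :: "complex vec" assume u: "u \<in> carrier_vec p"
  have "vnorm ((A * B) *\<^sub>v u) = vnorm (A *\<^sub>v (B *\<^sub>v u))"
    using assms u by (simp add: assoc_mult_mat_vec)
  also have "\<dots> \<le> c * vnorm (B *\<^sub>v u)"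
    using assms u by (intro opnorm_leD) auto
  also have "\<dots> \<le> c * (d * vnorm u)"
    using opnorm_leD[OF assms(4,2) u] opnorm_le_nonneg[OF assms(3)] by (rule mult_left_mono)
  finally show "vnorm ((A * B) *\<^sub>v u) \<le> (c * d) * vnorm u" by (simp add: mult_ac)
qed (use assms opnorm_le_nonneg in auto)

text \<open>From \<open>\<parallel>A\<^sup>* w\<parallel>\<^sup>2 = \<langle>A A\<^sup>* w, w\<rangle> \<le> c \<parallel>A\<^sup>* w\<parallel> \<parallel>w\<parallel>\<close>.\<close>

lemma opnorm_le_adjoint:
  assumes A: "A \<in> carrier_mat n m" and c: "opnorm_le A c"
  shows "opnorm_le (mat_adjoint A) c"
proof (rule opnorm_leI[OF mat_adjoint_carrier[OF A] opnorm_le_nonneg[OF c]])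
  fix w :: "complex vec" assume w: "w \<in> carrier_vec n"
  define u where "u = mat_adjoint A *\<^sub>v w"
  have u: "u \<in> carrier_vec m" using A w unfolding u_def by (auto intro: carrier_vecI)
  have "(vnorm u)\<^sup>2 = cmod (scalar_prod u (conjugate u))"
    unfolding scalar_prod_self norm_of_real by simp
  also have "scalar_prod u (conjugate u) = scalar_prod (A *\<^sub>v u) (conjugate w)"
    using scalar_prod_mult_adjoint[OF A u w] by (simp add: u_def)
  also have "cmod \<dots> \<le> vnorm (A *\<^sub>v u) * vnorm w"
    using A u w by (intro cauchy_schwarz_vec) auto
  also have "\<dots> \<le> c * vnorm u * vnorm w"
    using opnorm_leD[OF c A u] by (intro mult_right_mono) auto
  finally have "vnorm u * vnorm u \<le> (c * vnorm w) * vnorm u" by (simp add: power2_eq_square mult_ac)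
  then show "vnorm u \<le> c * vnorm w"
    using opnorm_le_nonneg[OF c] by (cases "vnorm u = 0") (auto simp: mult_le_cancel_right less_le)
qed

lemma frobenius_norm_mult_left:
  assumes A: "A \<in> carrier_mat n m" and B: "B \<in> carrier_mat m p" and c: "opnorm_le A c"
  shows "frobenius_norm (A * B) \<le> c * frobenius_norm B"
proof -
  have c0: "c \<ge> 0" by (rule opnorm_le_nonneg[OF c])
  have "(frobenius_norm (A * B))\<^sup>2 = (\<Sum>j<p. (vnorm (A *\<^sub>v col B j))\<^sup>2)"
    unfolding frobenius_norm_sq_cols using A B by (intro sum.cong) (auto simp: col_mult2[OF A B] simp del: col_mult)
  also have "\<dots> \<le> (\<Sum>j<p. (c * vnorm (col B j))\<^sup>2)"
    using B by (intro sum_mono power_mono opnorm_leD[OF c A]) auto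
  also have "\<dots> = (c * frobenius_norm B)\<^sup>2"
    using B by (simp add: power_mult_distrib frobenius_norm_sq_cols sum_distrib_left)
  finally show ?thesis by (rule power2_le_imp_le) (use c0 in simp)
qed

lemma frobenius_norm_mult_right:
  assumes A: "A \<in> carrier_mat n m" and B: "B \<in> carrier_mat m p" and c: "opnorm_le B c"
  shows "frobenius_norm (A * B) \<le> c * frobenius_norm A"
proof -
  have "frobenius_norm (A * B) = frobenius_norm (mat_adjoint B * mat_adjoint A)"
    using A B by (simp add: mat_adjoint_mult[symmetric])
  also have "\<dots> \<le> c * frobenius_norm (mat_adjoint A)"
    by (rule frobenius_norm_mult_left[OF mat_adjoint_carrier[OF B] mat_adjoint_carrier[OF A] opnorm_le_adjoint[OF B c]])
  finally show ?thesis by simp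
qed

lemma diag_part_carrier [simp]: "Y \<in> carrier_mat n m \<Longrightarrow> diag_part Y \<in> carrier_mat n m"
  by (auto simp: diag_part_def)

lemma frobenius_norm_diag_part:
  assumes "Y \<in> carrier_mat n n"
  shows "(frobenius_norm (diag_part Y))\<^sup>2 = (\<Sum>i<n. (cmod (Y $$ (i, i)))\<^sup>2)"
proof -
  have "(\<Sum>j<n. (cmod (diag_part Y $$ (i, j)))\<^sup>2) = (cmod (Y $$ (i, i)))\<^sup>2" if "i < n" for i
  proof -
    have "(\<Sum>j<n. (cmod (diag_part Y $$ (i, j)))\<^sup>2) = (\<Sum>j<n. if j = i then (cmod (Y $$ (i, i)))\<^sup>2 else 0)"
      using assms that by (intro sum.cong) (auto simp: diag_part_def)
    then show ?thesis using that by simp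
  qed
  then show ?thesis
    using assms by (simp add: frobenius_norm_sq carrier_matD[OF diag_part_carrier[OF assms]])
qed

lemma frobenius_norm_off_diag:
  assumes Y: "Y \<in> carrier_mat n n"
  shows "(frobenius_norm (Y - diag_part Y))\<^sup>2 = (frobenius_norm Y)\<^sup>2 - (\<Sum>i<n. (cmod (Y $$ (i, i)))\<^sup>2)"
proof -
  have "(\<Sum>j<n. (cmod ((Y - diag_part Y) $$ (i, j)))\<^sup>2) = (\<Sum>j<n. (cmod (Y $$ (i, j)))\<^sup>2) - (cmod (Y $$ (i, i)))\<^sup>2" if "i < n" for i
  proof -
    have "(\<Sum>j<n. (cmod ((Y - diag_part Y) $$ (i, j)))\<^sup>2) =
        (\<Sum>j<n. (cmod (Y $$ (i, j)))\<^sup>2 - (if j = i then (cmod (Y $$ (i, i)))\<^sup>2 else 0))"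
      using Y that by (intro sum.cong) (auto simp: diag_part_def)
    then show ?thesis using that by (simp add: sum_subtractf)
  qed
  then show ?thesis
    using Y by (simp add: frobenius_norm_sq diag_part_def sum_subtractf)
qed

lemma frobenius_norm_diag_part_le:
  assumes "Y \<in> carrier_mat n n"
  shows "frobenius_norm (diag_part Y) \<le> frobenius_norm Y"
proof (rule power2_le_imp_le)
  show "(frobenius_norm (diag_part Y))\<^sup>2 \<le> (frobenius_norm Y)\<^sup>2"
    using frobenius_norm_off_diag[OF assms] frobenius_norm_diag_part[OF assms]
      zero_le_power2[of "frobenius_norm (Y - diag_part Y)"] by linarith
qed simp

text \<open>Each diagonal entry is an entry of the image of a unit vector, hence bounded by \<open>c\<close>.\<close>

lemma opnorm_le_diag_part:
  assumes Y: "Y \<in> carrier_mat n n" and c: "opnorm_le Y c"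
  shows "opnorm_le (diag_part Y) c"
proof (rule opnorm_leI[OF diag_part_carrier[OF Y] opnorm_le_nonneg[OF c]])
  fix u :: "complex vec" assume u: "u \<in> carrier_vec n"
  have entry: "cmod (Y $$ (i, i)) \<le> c" if i: "i < n" for i
  proof -
    have col: "Y *\<^sub>v unit_vec n i = col Y i" using Y i by (auto intro!: eq_vecI)
    have "cmod (Y $$ (i, i)) = cmod ((Y *\<^sub>v unit_vec n i) $ i)" unfolding col using Y i by simp
    also have "\<dots> \<le> vnorm (Y *\<^sub>v unit_vec n i)" using Y i by (intro cmod_index_le_vnorm) auto
    also have "\<dots> \<le> c * vnorm (unit_vec n i)" by (rule opnorm_leD[OF c Y]) simp
    also have "(vnorm (unit_vec n i))\<^sup>2 = (\<Sum>j<n. if j = i then 1 else 0)"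
      unfolding vnorm_sq index_unit_vec(3) using i by (intro sum.cong) auto
    then have "vnorm (unit_vec n i) = 1" using i vnorm_nonneg[of "unit_vec n i"] by (simp add: power2_eq_1_iff)
    finally show ?thesis by simp
  qed
  have Du: "(diag_part Y *\<^sub>v u) $ i = Y $$ (i, i) * u $ i" if i: "i < n" for i
  proof -
    have "(diag_part Y *\<^sub>v u) $ i = (\<Sum>k<n. diag_part Y $$ (i, k) * u $ k)"
      by (rule index_mult_mat_vec_sum[OF diag_part_carrier[OF Y] u i])
    also have "\<dots> = (\<Sum>k<n. if k = i then Y $$ (i, i) * u $ i else 0)"
      using Y i by (intro sum.cong) (auto simp: diag_part_def)
    finally show ?thesis using i by simp
  qed
  have "(vnorm (diag_part Y *\<^sub>v u))\<^sup>2 = (\<Sum>i<n. (cmod (Y $$ (i, i) * u $ i))\<^sup>2)"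
    unfolding vnorm_sq using Y Du by (intro sum.cong) (auto simp: diag_part_def)
  also have "\<dots> \<le> (\<Sum>i<n. (c * cmod (u $ i))\<^sup>2)"
    by (intro sum_mono power_mono) (auto simp: norm_mult intro!: mult_right_mono entry)
  also have "\<dots> = (c * vnorm u)\<^sup>2"
    using u by (simp add: power_mult_distrib vnorm_sq sum_distrib_left)
  finally show "vnorm (diag_part Y *\<^sub>v u) \<le> c * vnorm u"
    by (rule power2_le_imp_le) (use opnorm_le_nonneg[OF c] in simp)
qed

lemma opnorm_le_isometry:
  assumes A: "A \<in> carrier_mat n m" and iso: "mat_adjoint A * A = 1\<^sub>m m"
  shows "opnorm_le A 1"
proof (rule opnorm_leI[OF A])
  fix u :: "complex vec" assume u: "u \<in> carrier_vec m"
  have "complex_of_real ((vnorm (A *\<^sub>v u))\<^sup>2) = scalar_prod u (conjugate (mat_adjoint A *\<^sub>v (A *\<^sub>v u)))"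
    unfolding scalar_prod_self[symmetric] using A u by (intro scalar_prod_mult_adjoint[OF A u]) auto
  also have "mat_adjoint A *\<^sub>v (A *\<^sub>v u) = (mat_adjoint A * A) *\<^sub>v u"
    using A u by (intro assoc_mult_mat_vec[symmetric]) auto
  also have "\<dots> = u" using iso u by simp
  finally have "(vnorm (A *\<^sub>v u))\<^sup>2 = (vnorm u)\<^sup>2"
    unfolding scalar_prod_self using of_real_eq_iff by blast
  then show "vnorm (A *\<^sub>v u) \<le> 1 * vnorm u" by simp
qed simp

section \<open>Sequences that are small up to bounded Frobenius norm\<close>

text \<open>A finite-section analogue of compactness: the compact operators are the limits in operator norm of
  Hilbert--Schmidt operators. Bounding the Frobenius norm of the second part, rather than its
  rank, makes the notion stable under the preconditioner, which contracts the Frobenius norm but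
  can raise the rank.\<close>

definition asymptotically_compact :: "(nat \<Rightarrow> complex mat) \<Rightarrow> bool" where
  "asymptotically_compact Z \<longleftrightarrow> (\<forall>\<epsilon>>0. \<exists>C. \<forall>\<^sub>F n in sequentially. \<exists>E R.
     E \<in> carrier_mat n n \<and> R \<in> carrier_mat n n \<and> Z n = E + R \<and>
     opnorm_le E \<epsilon> \<and> frobenius_norm R \<le> C)"

lemma opnorm_le_zero: "0 \<le> c \<Longrightarrow> opnorm_le (0\<^sub>m n n) c"
  by (rule opnorm_leI[of _ n n]) (auto simp: vnorm_def L2_set_def intro!: mult_nonneg_nonneg real_sqrt_ge_zero sum_nonneg)

lemma opnorm_le_mono: "opnorm_le A c \<Longrightarrow> c \<le> d \<Longrightarrow> opnorm_le A d"
  unfolding opnorm_le_def by (meson mult_right_mono order_trans vnorm_nonneg)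

lemma asymptotically_compact_frobenius:
  assumes "\<forall>\<^sub>F n in sequentially. Z n \<in> carrier_mat n n \<and> frobenius_norm (Z n) \<le> C"
  shows "asymptotically_compact Z"
  unfolding asymptotically_compact_def
proof (intro allI impI exI)
  fix \<epsilon> :: real assume "\<epsilon> > 0"
  show "\<forall>\<^sub>F n in sequentially. \<exists>E R. E \<in> carrier_mat n n \<and> R \<in> carrier_mat n n \<and> Z n = E + R \<and>
     opnorm_le E \<epsilon> \<and> frobenius_norm R \<le> C"
    using assms
  proof eventually_elim
    case (elim n)
    then show ?case using \<open>\<epsilon> > 0\<close>
      by (intro exI[of _ "0\<^sub>m n n"] exI[of _ "Z n"]) (auto simp: opnorm_le_zero)
  qed
qed

lemma add_add_interchange_mat:
  assumes "A \<in> carrier_mat n m" "B \<in> carrier_mat n m" "C \<in> carrier_mat n m" "D \<in> carrier_mat n m"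
  shows "(A + B) + (C + D) = (A + C) + (B + (D :: complex mat))"
  by (rule eq_matI) (use assms in auto)

lemma asymptotically_compact_add:
  assumes "asymptotically_compact Y" "asymptotically_compact Z"
  shows "asymptotically_compact (\<lambda>n. Y n + Z n)"
  unfolding asymptotically_compact_def
proof (intro allI impI)
  fix \<epsilon> :: real assume "\<epsilon> > 0"
  then have e: "\<epsilon> / 2 > 0" by simp
  obtain C where C: "\<forall>\<^sub>F n in sequentially. \<exists>E R. E \<in> carrier_mat n n \<and> R \<in> carrier_mat n n \<and> Y n = E + R \<and>
     opnorm_le E (\<epsilon> / 2) \<and> frobenius_norm R \<le> C"
    using assms(1) e unfolding asymptotically_compact_def by blast
  obtain D where D: "\<forall>\<^sub>F n in sequentially. \<exists>E R. E \<in> carrier_mat n n \<and> R \<in> carrier_mat n n \<and> Z n = E + R \<and>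
     opnorm_le E (\<epsilon> / 2) \<and> frobenius_norm R \<le> D"
    using assms(2) e unfolding asymptotically_compact_def by blast
  show "\<exists>C. \<forall>\<^sub>F n in sequentially. \<exists>E R. E \<in> carrier_mat n n \<and> R \<in> carrier_mat n n \<and> Y n + Z n = E + R \<and>
     opnorm_le E \<epsilon> \<and> frobenius_norm R \<le> C"
  proof
    show "\<forall>\<^sub>F n in sequentially. \<exists>E R. E \<in> carrier_mat n n \<and> R \<in> carrier_mat n n \<and> Y n + Z n = E + R \<and>
     opnorm_le E \<epsilon> \<and> frobenius_norm R \<le> C + D"
      using C D
    proof eventually_elim
      case (elim n)
      obtain E R where 1: "E \<in> carrier_mat n n" "R \<in> carrier_mat n n" "Y n = E + R"
        "opnorm_le E (\<epsilon> / 2)" "frobenius_norm R \<le> C" using elim(1) by blast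
      obtain E' R' where 2: "E' \<in> carrier_mat n n" "R' \<in> carrier_mat n n" "Z n = E' + R'"
        "opnorm_le E' (\<epsilon> / 2)" "frobenius_norm R' \<le> D" using elim(2) by blast
      show ?case
      proof (intro exI conjI)
        show "Y n + Z n = (E + E') + (R + R')"
          unfolding 1(3) 2(3) by (rule add_add_interchange_mat[OF 1(1,2) 2(1,2)])
        show "opnorm_le (E + E') \<epsilon>" using opnorm_le_add[OF 1(1) 2(1) 1(4) 2(4)] by simp
        show "frobenius_norm (R + R') \<le> C + D" using frobenius_norm_add[OF 1(2) 2(2)] 1(5) 2(5) by simp
      qed (use 1 2 in auto)
    qed
  qed
qed

text \<open>The common reason for the stability under multiplication, negation and preconditioning.\<close>

lemma asymptotically_compact_linear_image:
  assumes Z: "asymptotically_compact Z" and c: "c \<ge> 0"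
    and add: "\<And>n E R. n > 0 \<Longrightarrow> E \<in> carrier_mat n n \<Longrightarrow> R \<in> carrier_mat n n \<Longrightarrow> \<Phi> n (E + R) = \<Phi> n E + \<Phi> n R"
    and car: "\<And>n E. n > 0 \<Longrightarrow> E \<in> carrier_mat n n \<Longrightarrow> \<Phi> n E \<in> carrier_mat n n"
    and op: "\<And>n E \<epsilon>. n > 0 \<Longrightarrow> E \<in> carrier_mat n n \<Longrightarrow> opnorm_le E \<epsilon> \<Longrightarrow> opnorm_le (\<Phi> n E) (c * \<epsilon>)"
    and fro: "\<And>n R. n > 0 \<Longrightarrow> R \<in> carrier_mat n n \<Longrightarrow> frobenius_norm (\<Phi> n R) \<le> c * frobenius_norm R"
  shows "asymptotically_compact (\<lambda>n. \<Phi> n (Z n))"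
  unfolding asymptotically_compact_def
proof (intro allI impI)
  fix \<epsilon> :: real assume e: "\<epsilon> > 0"
  then have e': "\<epsilon> / (c + 1) > 0" using c by simp
  obtain C where C: "\<forall>\<^sub>F n in sequentially. \<exists>E R. E \<in> carrier_mat n n \<and> R \<in> carrier_mat n n \<and> Z n = E + R \<and>
     opnorm_le E (\<epsilon> / (c + 1)) \<and> frobenius_norm R \<le> C"
    using Z e' unfolding asymptotically_compact_def by blast
  have le: "c * (\<epsilon> / (c + 1)) \<le> \<epsilon>" using e c by (simp add: field_simps)
  show "\<exists>C. \<forall>\<^sub>F n in sequentially. \<exists>E R. E \<in> carrier_mat n n \<and> R \<in> carrier_mat n n \<and> \<Phi> n (Z n) = E + R \<and>
     opnorm_le E \<epsilon> \<and> frobenius_norm R \<le> C"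
  proof
    show "\<forall>\<^sub>F n in sequentially. \<exists>E R. E \<in> carrier_mat n n \<and> R \<in> carrier_mat n n \<and> \<Phi> n (Z n) = E + R \<and>
     opnorm_le E \<epsilon> \<and> frobenius_norm R \<le> c * C"
      using C eventually_gt_at_top[of 0]
    proof eventually_elim
      case (elim n)
      obtain E R where 1: "E \<in> carrier_mat n n" "R \<in> carrier_mat n n" "Z n = E + R"
        "opnorm_le E (\<epsilon> / (c + 1))" "frobenius_norm R \<le> C" using elim(1) by blast
      have "frobenius_norm (\<Phi> n R) \<le> c * C"
        using fro[OF elim(2) 1(2)] mult_left_mono[OF 1(5) c] by linarith
      moreover have "\<Phi> n (Z n) = \<Phi> n E + \<Phi> n R" unfolding 1(3) by (rule add[OF elim(2) 1(1,2)])
      moreover have "opnorm_le (\<Phi> n E) \<epsilon>" by (rule opnorm_le_mono[OF op[OF elim(2) 1(1,4)] le])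
      ultimately show ?case using car[OF elim(2) 1(1)] car[OF elim(2) 1(2)] by metis
    qed
  qed
qed

lemma asymptotically_compact_mult_left:
  assumes Z: "asymptotically_compact Z"
    and T: "\<And>n. T n \<in> carrier_mat n n" "\<And>n. n > 0 \<Longrightarrow> opnorm_le (T n) c"
  shows "asymptotically_compact (\<lambda>n. T n * Z n)"
proof (rule asymptotically_compact_linear_image[where \<Phi> = "\<lambda>n X. T n * X", OF Z opnorm_le_nonneg[OF T(2)[OF zero_less_Suc]]])
  fix n :: nat and E :: "complex mat" and \<epsilon> :: real
  assume "n > 0" "E \<in> carrier_mat n n" "opnorm_le E \<epsilon>"
  then show "opnorm_le (T n * E) (c * \<epsilon>)" by (intro opnorm_le_mult[OF T(1) _ T(2)])
qed (use mult_add_distrib_mat[OF T(1)] mult_carrier_mat[OF T(1)] frobenius_norm_mult_left[OF T(1) _ T(2)] in blast)+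

lemma asymptotically_compact_mult_right:
  assumes Z: "asymptotically_compact Z"
    and T: "\<And>n. T n \<in> carrier_mat n n" "\<And>n. n > 0 \<Longrightarrow> opnorm_le (T n) c"
  shows "asymptotically_compact (\<lambda>n. Z n * T n)"
proof (rule asymptotically_compact_linear_image[where \<Phi> = "\<lambda>n X. X * T n", OF Z opnorm_le_nonneg[OF T(2)[OF zero_less_Suc]]])
  fix n :: nat and E :: "complex mat" and \<epsilon> :: real
  assume "n > 0" "E \<in> carrier_mat n n" "opnorm_le E \<epsilon>"
  then show "opnorm_le (E * T n) (c * \<epsilon>)"
    using opnorm_le_mult[of E n n "T n" n \<epsilon> c] T[of n] by (simp add: mult.commute)
qed (use add_mult_distrib_mat[OF _ _ T(1)] mult_carrier_mat[OF _ T(1)] frobenius_norm_mult_right[OF _ T(1) T(2)] in blast)+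

lemma opnorm_le_uminus: "opnorm_le A c \<Longrightarrow> opnorm_le (- A) c"
proof -
  assume A: "opnorm_le A c"
  have "vnorm (- A *\<^sub>v u) = vnorm (A *\<^sub>v u)" if "u \<in> carrier_vec (dim_col A)" for u
    unfolding vnorm_def using that by (intro L2_set_cong) (auto simp: scalar_prod_def sum_negf norm_minus_cancel)
  then show ?thesis using A by (auto simp: opnorm_le_def)
qed

lemma frobenius_norm_uminus: "frobenius_norm (- A) = frobenius_norm A"
  unfolding frobenius_norm_def by (intro L2_set_cong) auto

lemma asymptotically_compact_uminus:
  assumes Z: "asymptotically_compact Z"
  shows "asymptotically_compact (\<lambda>n. - Z n)"
proof (rule asymptotically_compact_linear_image[where c = 1, OF Z])
  fix n :: nat and E R :: "complex mat"
  assume "E \<in> carrier_mat n n" "R \<in> carrier_mat n n"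
  then show "- (E + R) = - E + - R" by (intro eq_matI) auto
qed (auto simp: frobenius_norm_uminus opnorm_le_uminus)

lemma asymptotically_compact_limit:
  assumes "\<And>\<epsilon>. \<epsilon> > 0 \<Longrightarrow> \<exists>Y. asymptotically_compact Y \<and> (\<forall>\<^sub>F n in sequentially. Y n \<in> carrier_mat n n \<and>
      Z n \<in> carrier_mat n n \<and> opnorm_le (Z n - Y n) \<epsilon>)"
  shows "asymptotically_compact Z"
  unfolding asymptotically_compact_def
proof (intro allI impI)
  fix \<epsilon> :: real assume "\<epsilon> > 0"
  then have e: "\<epsilon> / 2 > 0" by simp
  from assms[OF this] obtain Y where Y: "asymptotically_compact Y"
    and ZY: "\<forall>\<^sub>F n in sequentially. Y n \<in> carrier_mat n n \<and> Z n \<in> carrier_mat n n \<and> opnorm_le (Z n - Y n) (\<epsilon> / 2)"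
    by blast
  obtain C where C: "\<forall>\<^sub>F n in sequentially. \<exists>E R. E \<in> carrier_mat n n \<and> R \<in> carrier_mat n n \<and> Y n = E + R \<and>
     opnorm_le E (\<epsilon> / 2) \<and> frobenius_norm R \<le> C"
    using Y e unfolding asymptotically_compact_def by blast
  have "\<forall>\<^sub>F n in sequentially. \<exists>E R. E \<in> carrier_mat n n \<and> R \<in> carrier_mat n n \<and> Z n = E + R \<and>
     opnorm_le E \<epsilon> \<and> frobenius_norm R \<le> C"
    using C ZY
  proof eventually_elim
    case (elim n)
    obtain E R where 1: "E \<in> carrier_mat n n" "R \<in> carrier_mat n n" "Y n = E + R"
        "opnorm_le E (\<epsilon> / 2)" "frobenius_norm R \<le> C" using elim(1) by blast
    have Zn: "Z n \<in> carrier_mat n n" and Yn: "Y n \<in> carrier_mat n n" and op: "opnorm_le (Z n - Y n) (\<epsilon> / 2)" using elim(2) by auto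
    show ?case
    proof (intro exI conjI)
      show "Z n = ((Z n - Y n) + E) + R" using Zn 1 by (intro eq_matI) auto
      show "opnorm_le ((Z n - Y n) + E) \<epsilon>"
        using opnorm_le_add[OF minus_carrier_mat[OF Yn] 1(1) op 1(4)] by simp
      show "(Z n - Y n) + E \<in> carrier_mat n n" using 1 elim(2) by auto
    qed (use 1 in auto)
  qed
  then show "\<exists>C. \<forall>\<^sub>F n in sequentially. \<exists>E R. E \<in> carrier_mat n n \<and> R \<in> carrier_mat n n \<and> Z n = E + R \<and>
     opnorm_le E \<epsilon> \<and> frobenius_norm R \<le> C" by blast
qed

section \<open>The optimal preconditioner\<close>

lemma unitary_matrixD:
  assumes "U \<in> carrier_mat n n" "unitary_matrix U"
  shows "U * mat_adjoint U = 1\<^sub>m n" "mat_adjoint U * U = 1\<^sub>m n"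
  using assms by (auto simp: unitary_matrix_def inverts_mat_def)

lemma unitary_matrix_adjoint: "unitary_matrix U \<Longrightarrow> unitary_matrix (mat_adjoint U)"
  by (auto simp: unitary_matrix_def square_mat.simps)

lemma opnorm_le_unitary: "U \<in> carrier_mat n n \<Longrightarrow> unitary_matrix U \<Longrightarrow> opnorm_le U 1"
  using opnorm_le_isometry unitary_matrixD by blast

lemma frobenius_norm_unitary_conj_le:
  assumes U: "U \<in> carrier_mat n n" "unitary_matrix U" and X: "X \<in> carrier_mat n n"
  shows "frobenius_norm (mat_adjoint U * X * U) \<le> frobenius_norm X"
proof -
  have "frobenius_norm (mat_adjoint U * X * U) \<le> 1 * frobenius_norm (mat_adjoint U * X)"
    using U X by (intro frobenius_norm_mult_right opnorm_le_unitary) (auto intro: mult_carrier_mat)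
  also have "\<dots> \<le> 1 * (1 * frobenius_norm X)"
    using U X by (intro mult_left_mono frobenius_norm_mult_left opnorm_le_unitary unitary_matrix_adjoint) auto
  finally show ?thesis by simp
qed

lemma opnorm_le_unitary_conj:
  assumes U: "U \<in> carrier_mat n n" "unitary_matrix U" and X: "X \<in> carrier_mat n n" "opnorm_le X c"
  shows "opnorm_le (mat_adjoint U * X * U) c"
proof -
  have "opnorm_le (mat_adjoint U * X) (1 * c)"
    by (rule opnorm_le_mult[OF mat_adjoint_carrier[OF U(1)] X(1) opnorm_le_adjoint[OF U(1) opnorm_le_unitary[OF U]] X(2)])
  then have "opnorm_le (mat_adjoint U * X * U) (1 * c * 1)"
    by (rule opnorm_le_mult[OF mult_carrier_mat[OF mat_adjoint_carrier[OF U(1)] X(1)] U(1) _ opnorm_le_unitary[OF U]])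
  then show ?thesis by simp
qed

lemma unitary_conj_cancel:
  assumes U: "U \<in> carrier_mat n n" "unitary_matrix U" and X: "X \<in> carrier_mat n n"
  shows "mat_adjoint U * (U * X * mat_adjoint U) * U = X"
proof -
  note V = mat_adjoint_carrier[OF U(1)]
  have "mat_adjoint U * (U * X * mat_adjoint U) * U = mat_adjoint U * (U * X * mat_adjoint U * U)"
    by (rule assoc_mult_mat[OF V mult_carrier_mat[OF mult_carrier_mat[OF U(1) X] V] U(1)])
  also have "U * X * mat_adjoint U * U = U * X * (mat_adjoint U * U)"
    by (rule assoc_mult_mat[OF mult_carrier_mat[OF U(1) X] V U(1)])
  also have "\<dots> = U * X"
    unfolding unitary_matrixD(2)[OF U] by (rule right_mult_one_mat[OF mult_carrier_mat[OF U(1) X]])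
  also have "mat_adjoint U * (U * X) = mat_adjoint U * U * X"
    by (rule assoc_mult_mat[symmetric, OF V U(1) X])
  also have "\<dots> = X" unfolding unitary_matrixD(2)[OF U] by (rule left_mult_one_mat[OF X])
  finally show ?thesis .
qed

lemma frobenius_norm_unitary_conj:
  assumes U: "U \<in> carrier_mat n n" "unitary_matrix U" and X: "X \<in> carrier_mat n n"
  shows "frobenius_norm (mat_adjoint U * X * U) = frobenius_norm X"
proof (rule antisym[OF frobenius_norm_unitary_conj_le[OF assms]])
  let ?V = "mat_adjoint U"
  have V: "?V \<in> carrier_mat n n" "unitary_matrix ?V" using U by (auto intro: unitary_matrix_adjoint)
  have Y: "?V * X * U \<in> carrier_mat n n" using U X by (auto intro: mult_carrier_mat)
  have "X = U * (?V * X * U) * ?V"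
    using unitary_conj_cancel[OF V X] by simp
  then show "frobenius_norm X \<le> frobenius_norm (?V * X * U)"
    using frobenius_norm_unitary_conj_le[OF V Y] by simp
qed

lemma precond_carrier [simp]:
  assumes "U \<in> carrier_mat n n" "X \<in> carrier_mat n n"
  shows "precond U X \<in> carrier_mat n n"
  unfolding precond_def using assms by (auto intro!: mult_carrier_mat diag_part_carrier)

lemma diag_part_add: "A \<in> carrier_mat n n \<Longrightarrow> B \<in> carrier_mat n n \<Longrightarrow> diag_part (A + B) = diag_part A + diag_part B"
  by (rule eq_matI) (auto simp: diag_part_def)

lemma unitary_conj_add:
  assumes "U \<in> carrier_mat n n" "W \<in> carrier_mat n n" "X \<in> carrier_mat n n" "Y \<in> carrier_mat n n"
  shows "W * (X + Y) * U = W * X * U + W * Y * (U :: complex mat)"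
  using assms by (simp add: mult_add_distrib_mat[of _ n n] add_mult_distrib_mat[of _ n n])

lemma precond_add:
  assumes U: "U \<in> carrier_mat n n" and X: "X \<in> carrier_mat n n" and Y: "Y \<in> carrier_mat n n"
  shows "precond U (X + Y) = precond U X + precond U Y"
proof -
  have c: "mat_adjoint U * Z * U \<in> carrier_mat n n" if "Z \<in> carrier_mat n n" for Z
    using U that by (auto intro: mult_carrier_mat)
  show ?thesis
    unfolding precond_def unitary_conj_add[OF U mat_adjoint_carrier[OF U] X Y]
      diag_part_add[OF c[OF X] c[OF Y]]
    by (rule unitary_conj_add) (use U c X Y in \<open>auto intro: diag_part_carrier\<close>)
qed

lemma frobenius_norm_precond:
  assumes U: "U \<in> carrier_mat n n" "unitary_matrix U" and X: "X \<in> carrier_mat n n"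
  shows "frobenius_norm (precond U X) \<le> frobenius_norm X"
proof -
  have V: "mat_adjoint U \<in> carrier_mat n n" "unitary_matrix (mat_adjoint U)" using U by (auto intro: unitary_matrix_adjoint)
  have Y: "mat_adjoint U * X * U \<in> carrier_mat n n" using U X by (auto intro: mult_carrier_mat)
  show ?thesis
    using frobenius_norm_unitary_conj_le[OF V diag_part_carrier[OF Y]] frobenius_norm_diag_part_le[OF Y]
      frobenius_norm_unitary_conj_le[OF U X] by (simp add: precond_def)
qed

lemma opnorm_le_precond:
  assumes U: "U \<in> carrier_mat n n" "unitary_matrix U" and X: "X \<in> carrier_mat n n" "opnorm_le X c"
  shows "opnorm_le (precond U X) c"
proof -
  have V: "mat_adjoint U \<in> carrier_mat n n" "unitary_matrix (mat_adjoint U)" using U by (auto intro: unitary_matrix_adjoint)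
  have Y: "mat_adjoint U * X * U \<in> carrier_mat n n" using U X by (auto intro: mult_carrier_mat)
  show ?thesis
    using opnorm_le_unitary_conj[OF V diag_part_carrier[OF Y] opnorm_le_diag_part[OF Y opnorm_le_unitary_conj[OF U X]]]
    by (simp add: precond_def)
qed

lemma diag_part_mult_diag_parts:
  assumes A: "A \<in> carrier_mat n n" and B: "B \<in> carrier_mat n n"
  shows "diag_part (diag_part A * diag_part B) = diag_part A * diag_part B"
proof (rule eq_matI)
  note c = diag_part_carrier[OF A] diag_part_carrier[OF B]
  fix i j assume "i < dim_row (diag_part A * diag_part B)" "j < dim_col (diag_part A * diag_part B)"
  then have ij: "i < n" "j < n" using c by auto
  have "(diag_part A * diag_part B) $$ (i, j) = 0" if "i \<noteq> j"
    unfolding index_mult_mat_sum[OF c ij] using A B ij that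
    by (intro sum.neutral) (auto simp: diag_part_def)
  then show "diag_part (diag_part A * diag_part B) $$ (i, j) = (diag_part A * diag_part B) $$ (i, j)"
    using ij c by (auto simp: diag_part_def[of "_ * _"])
qed (auto simp: diag_part_def)

text \<open>Matrices that \<open>U\<close> diagonalises are closed under products and fixed by the preconditioner.\<close>

lemma precond_mult_preconds:
  assumes U: "U \<in> carrier_mat n n" "unitary_matrix U" and X: "X \<in> carrier_mat n n" and Y: "Y \<in> carrier_mat n n"
  shows "precond U (precond U X * precond U Y) = precond U X * precond U Y"
proof -
  let ?V = "mat_adjoint U"
  define A where "A = ?V * X * U"
  define B where "B = ?V * Y * U"
  have A: "A \<in> carrier_mat n n" and B: "B \<in> carrier_mat n n"
    unfolding A_def B_def using U X Y by (auto intro: mult_carrier_mat)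
  note DA = diag_part_carrier[OF A] and DB = diag_part_carrier[OF B] and V = mat_adjoint_carrier[OF U(1)]
  have "precond U X * precond U Y = (U * diag_part A * ?V) * (U * diag_part B * ?V)"
    by (simp add: precond_def A_def B_def)
  also have "\<dots> = U * diag_part A * (?V * (U * diag_part B * ?V))"
    by (rule assoc_mult_mat[OF mult_carrier_mat[OF U(1) DA] V mult_carrier_mat[OF mult_carrier_mat[OF U(1) DB] V]])
  also have "U * diag_part B * ?V = U * (diag_part B * ?V)"
    by (rule assoc_mult_mat[OF U(1) DB V])
  also have "?V * (U * (diag_part B * ?V)) = ?V * U * (diag_part B * ?V)"
    by (rule assoc_mult_mat[symmetric, OF V U(1) mult_carrier_mat[OF DB V]])
  also have "\<dots> = diag_part B * ?V"
    unfolding unitary_matrixD(2)[OF U] by (rule left_mult_one_mat[OF mult_carrier_mat[OF DB V]])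
  also have "U * diag_part A * (diag_part B * ?V) = U * diag_part A * diag_part B * ?V"
    by (rule assoc_mult_mat[symmetric, OF mult_carrier_mat[OF U(1) DA] DB V])
  also have "U * diag_part A * diag_part B = U * (diag_part A * diag_part B)"
    by (rule assoc_mult_mat[OF U(1) DA DB])
  finally have eq: "precond U X * precond U Y = U * (diag_part A * diag_part B) * ?V" .
  have AB: "diag_part A * diag_part B \<in> carrier_mat n n" by (rule mult_carrier_mat[OF DA DB])
  show ?thesis
    unfolding eq unfolding precond_def
    unfolding unitary_conj_cancel[OF U AB] diag_part_mult_diag_parts[OF A B] ..
qed

text \<open>Pythagoras in the basis given by \<open>U\<close>: the defect is the off-diagonal part of \<open>U\<^sup>* X U\<close>.\<close>

lemma frobenius_norm_precond_defect:
  assumes U: "U \<in> carrier_mat n n" "unitary_matrix U" and X: "X \<in> carrier_mat n n"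
  shows "(frobenius_norm (precond U X - X))\<^sup>2 =
    (frobenius_norm X)\<^sup>2 - (\<Sum>i<n. (cmod ((mat_adjoint U * X * U) $$ (i, i)))\<^sup>2)"
proof -
  let ?V = "mat_adjoint U"
  define Y where "Y = ?V * X * U"
  have V: "?V \<in> carrier_mat n n" "unitary_matrix ?V" using U by (auto intro: unitary_matrix_adjoint)
  have Y: "Y \<in> carrier_mat n n" unfolding Y_def using U X by (auto intro: mult_carrier_mat)
  have PX: "precond U X \<in> carrier_mat n n" using U X by simp
  have D: "?V * precond U X * U = diag_part Y"
    unfolding precond_def Y_def[symmetric] by (rule unitary_conj_cancel[OF U diag_part_carrier[OF Y]])
  have "frobenius_norm (precond U X - X) = frobenius_norm (?V * (precond U X - X) * U)"
    by (rule frobenius_norm_unitary_conj[OF U minus_carrier_mat[OF X], symmetric])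
  also have "?V * (precond U X - X) * U = ?V * precond U X * U - ?V * X * U"
    unfolding mult_minus_distrib_mat[OF V(1) PX X]
    by (rule minus_mult_distrib_mat[OF mult_carrier_mat[OF V(1) PX] mult_carrier_mat[OF V(1) X] U(1)])
  also have "\<dots> = - (Y - diag_part Y)"
    unfolding D Y_def[symmetric] using Y by (intro eq_matI) (auto simp: diag_part_def)
  finally show ?thesis
    using frobenius_norm_off_diag[OF Y] frobenius_norm_unitary_conj[OF U X]
    by (simp add: frobenius_norm_uminus Y_def)
qed

section \<open>Counting large singular values\<close>

lemma mat_adjoint_four_block:
  assumes "A \<in> carrier_mat n1 m1" "B \<in> carrier_mat n1 m2" "C \<in> carrier_mat n2 m1" "D \<in> carrier_mat n2 m2"
  shows "mat_adjoint (four_block_mat A B C D) =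
    four_block_mat (mat_adjoint A) (mat_adjoint C) (mat_adjoint B) (mat_adjoint (D :: complex mat))"
  by (rule eq_matI) (use assms in auto)

lemma adjoint_mult_index:
  assumes "A \<in> carrier_mat n m" "B \<in> carrier_mat n p" "i < m" "j < p"
  shows "(mat_adjoint A * B) $$ (i, j) = scalar_prod (col B j) (conjugate (col (A :: complex mat) i))"
proof -
  have "(mat_adjoint A * B) $$ (i, j) = (\<Sum>k<n. mat_adjoint A $$ (i, k) * B $$ (k, j))"
    by (rule index_mult_mat_sum[OF mat_adjoint_carrier[OF assms(1)] assms(2-4)])
  also have "\<dots> = (\<Sum>k<n. col B j $ k * cnj (col A i $ k))"
    using assms by (intro sum.cong) auto
  also have "\<dots> = scalar_prod (col B j) (conjugate (col A i))"
    by (rule scalar_prod_conjugate_eq[symmetric]) (use assms in auto)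
  finally show ?thesis .
qed

text \<open>Gram--Schmidt produces orthogonal vectors whose lengths are not normalised; dividing by the lengths gives the
  columns of a unitary matrix.\<close>

lemma unitary_completion:
  assumes v: "v \<in> carrier_vec n" "v \<noteq> 0\<^sub>v n" and n: "n \<noteq> 0"
  shows "\<exists>W c. W \<in> carrier_mat n n \<and> mat_adjoint W * W = 1\<^sub>m n \<and> col W 0 = c \<cdot>\<^sub>v (v :: complex vec)"
proof -
  interpret cof_vec_space n "TYPE(complex)" .
  define b where "b = basis_completion v"
  define ws where "ws = gram_schmidt n b"
  from basis_completion[OF v, folded b_def]
  have dist_b: "distinct b" and indep: "\<not> lin_dep (set b)" and b: "set b \<subseteq> carrier_vec n" and hdb: "hd b = v"
    and len_b: "length b = n" by auto
  from hdb len_b n obtain vs where bv: "b = v # vs" by (cases b) auto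
  from gram_schmidt_result[OF b dist_b indep refl, folded ws_def]
  have ws: "set ws \<subseteq> carrier_vec n" "corthogonal ws" "length ws = n"
    by (auto simp: len_b)
  from gram_schmidt_hd[OF v(1), of vs, folded bv] have "hd ws = v" unfolding ws_def .
  then have ws0: "ws ! 0 = v" using ws(3) n by (cases ws) auto
  have wsc: "ws ! i \<in> carrier_vec n" if "i < n" for i using ws that by auto
  define d where "d = (\<lambda>i. complex_of_real (vnorm (ws ! i)))"
  have dd: "scalar_prod (ws ! i) (conjugate (ws ! i)) = d i * d i" for i
    unfolding scalar_prod_self d_def by (simp add: power2_eq_square)
  define W where "W = Matrix.mat n n (\<lambda>(i, j). ws ! j $ i / d j)"
  have W: "W \<in> carrier_mat n n" by (simp add: W_def)
  have colW: "col W j = (1 / d j) \<cdot>\<^sub>v ws ! j" if "j < n" for j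
    using that wsc[OF that] by (intro eq_vecI) (auto simp: W_def)
  have "mat_adjoint W * W = 1\<^sub>m n"
  proof (rule eq_matI)
    fix i j assume "i < dim_row (1\<^sub>m n :: complex mat)" "j < dim_col (1\<^sub>m n :: complex mat)"
    then have ij: "i < n" "j < n" by auto
    have "(mat_adjoint W * W) $$ (i, j) = (\<Sum>k<n. col W j $ k * cnj (col W i $ k))"
      unfolding adjoint_mult_index[OF W W ij] by (rule scalar_prod_conjugate_eq) (use W ij in auto)
    also have "\<dots> = (\<Sum>k<n. ws ! j $ k * cnj (ws ! i $ k)) / (d j * d i)"
      unfolding sum_divide_distrib colW[OF ij(1)] colW[OF ij(2)] using wsc[OF ij(1)] wsc[OF ij(2)]
      by (intro sum.cong) (auto simp: d_def)
    also have "(\<Sum>k<n. ws ! j $ k * cnj (ws ! i $ k)) = scalar_prod (ws ! j) (conjugate (ws ! i))"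
      by (rule scalar_prod_conjugate_eq[symmetric, OF wsc[OF ij(2)] wsc[OF ij(1)]])
    finally have eq: "(mat_adjoint W * W) $$ (i, j) = scalar_prod (ws ! j) (conjugate (ws ! i)) / (d j * d i)" .
    show "(mat_adjoint W * W) $$ (i, j) = 1\<^sub>m n $$ (i, j)"
    proof (cases "i = j")
      case True
      have "scalar_prod (ws ! i) (conjugate (ws ! i)) \<noteq> 0"
        using corthogonalD[OF ws(2), of i i] ij ws(3) by auto
      then show ?thesis using True ij eq dd[of i] by auto
    next
      case False
      have "scalar_prod (ws ! j) (conjugate (ws ! i)) = 0"
        using corthogonalD[OF ws(2), of j i] ij ws(3) False by auto
      then show ?thesis using False ij eq by auto
    qed
  qed (use W in auto)
  then show ?thesis using W colW[of 0] n ws0 by auto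
qed

text \<open>Schur's theorem, restricted to the diagonal. With a unit eigenvector as first basis vector the matrix is
  block triangular, and the induction hypothesis applies to the lower right block. Unitarity of
  the change of basis is what relates eigenvalues of \<open>Z\<^sup>* Z\<close> to lengths \<open>\<parallel>Z u\<parallel>\<close> of images of unit vectors.\<close>

lemma unitary_eigenvalue_diagonal:
  assumes "A \<in> carrier_mat n n" "char_poly A = (\<Prod>e\<leftarrow>es. [:- e, 1:])"
  shows "\<exists>U. U \<in> carrier_mat n n \<and> mat_adjoint U * U = 1\<^sub>m n \<and>
    (\<forall>i<n. (mat_adjoint U * A * U) $$ (i, i) = (es ! i :: complex))"
  using assms
proof (induction es arbitrary: n A)
  case Nil
  then have "n = 0" using degree_monic_char_poly[of A n] by auto
  then show ?case using Nil(1) by (intro exI[of _ A]) auto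
next
  case (Cons e es)
  note A = Cons.prems(1)
  have cp: "char_poly A = [:- e, 1:] * (\<Prod>e\<leftarrow>es. [:- e, 1:])" using Cons.prems(2) by simp
  have "eigenvalue A e" unfolding eigenvalue_root_char_poly[OF A] cp by simp
  then obtain v where "eigenvector A v e" unfolding eigenvalue_def by blast
  then have v: "v \<in> carrier_vec n" "v \<noteq> 0\<^sub>v n" and Av: "A *\<^sub>v v = e \<cdot>\<^sub>v v"
    using A by (auto simp: eigenvector_def)
  have n: "n \<noteq> 0" using v by (auto intro: eq_vecI)
  define m where "m = n - 1"
  have nm: "n = 1 + m" using n by (simp add: m_def)
  obtain W c where W: "W \<in> carrier_mat n n" and WW: "mat_adjoint W * W = 1\<^sub>m n" and W0: "col W 0 = c \<cdot>\<^sub>v v"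
    using unitary_completion[OF v n] by blast
  note Wa = mat_adjoint_carrier[OF W]
  have WW': "W * mat_adjoint W = 1\<^sub>m n" by (rule mat_mult_left_right_inverse[OF Wa W WW])
  define A' where "A' = mat_adjoint W * A * W"
  have A': "A' \<in> carrier_mat n n" unfolding A'_def using W Wa A by auto
  have col0: "A' $$ (i, 0) = (if i = 0 then e else 0)" if i: "i < n" for i
  proof -
    have AW0: "col (A * W) 0 = e \<cdot>\<^sub>v col W 0"
    proof -
      have "col (A * W) 0 = A *\<^sub>v col W 0" by (rule col_mult2[OF A W]) (use n in simp)
      also have "\<dots> = c \<cdot>\<^sub>v (A *\<^sub>v v)" unfolding W0 using A v by (simp add: mult_mat_vec)
      also have "\<dots> = e \<cdot>\<^sub>v col W 0" unfolding Av W0 by (simp add: smult_smult_assoc mult.commute)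
      finally show ?thesis .
    qed
    have "A' = mat_adjoint W * (A * W)" unfolding A'_def by (rule assoc_mult_mat[OF Wa A W])
    then have "A' $$ (i, 0) = scalar_prod (col (A * W) 0) (conjugate (col W i))"
      using adjoint_mult_index[OF W mult_carrier_mat[OF A W] i, of 0] n by simp
    also have "\<dots> = e * scalar_prod (col W 0) (conjugate (col W i))"
      unfolding AW0 by (rule smult_scalar_prod_distrib[of _ n]) (use W i n in auto)
    also have "scalar_prod (col W 0) (conjugate (col W i)) = (mat_adjoint W * W) $$ (i, 0)"
      using adjoint_mult_index[OF W W i, of 0] n by simp
    finally show ?thesis using WW i n by simp
  qed
  obtain A1 A2 A0 A3 where split: "split_block A' 1 1 = (A1, A2, A0, A3)"
    by (cases "split_block A' 1 1") auto
  have "dim_row A' = 1 + m" "dim_col A' = 1 + m" using A' nm by auto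
  from split_block[OF split this] have A1: "A1 \<in> carrier_mat 1 1" and A2: "A2 \<in> carrier_mat 1 m"
    and A0: "A0 \<in> carrier_mat m 1" and A3: "A3 \<in> carrier_mat m m"
    and block: "A' = four_block_mat A1 A2 A0 A3" by auto
  have A1e: "A1 $$ (0, 0) = e" using col0[of 0] n A1 A3 block by simp
  have A0z: "A0 = 0\<^sub>m m 1"
  proof (rule eq_matI)
    fix i j assume "i < dim_row (0\<^sub>m m 1 :: complex mat)" "j < dim_col (0\<^sub>m m 1 :: complex mat)"
    then have ij: "i < m" "j = 0" by auto
    then have "A' $$ (Suc i, 0) = A0 $$ (i, 0)" using A1 A3 A0 A2 unfolding block by simp
    then show "A0 $$ (i, j) = 0\<^sub>m m 1 $$ (i, j)" using col0[of "Suc i"] ij nm by simp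
  qed (use A0 in auto)
  have "similar_mat_wit A' A (mat_adjoint W) W"
    by (rule similar_mat_witI[OF WW WW' A'_def A' A Wa W])
  then have "similar_mat A' A" unfolding similar_mat_def by blast
  then have "char_poly A' = [:- e, 1:] * (\<Prod>e\<leftarrow>es. [:- e, 1:])" using char_poly_similar cp by metis
  moreover have "char_poly A' = char_poly A1 * char_poly A3"
    unfolding block A0z by (rule char_poly_four_block_zeros_col[OF A1 A2 A3])
  moreover have "char_poly A1 = [:- e, 1:]"
  proof -
    have "A1 = Matrix.mat 1 1 (\<lambda>_. e)" using A1 A1e by (intro eq_matI) auto
    then show ?thesis by (simp add: char_poly_defs det_def sign_def)
  qed
  ultimately have cp3: "char_poly A3 = (\<Prod>e\<leftarrow>es. [:- e, 1:])"
    by (metis mult_cancel_left pCons_eq_0_iff zero_neq_one)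
  obtain U where U: "U \<in> carrier_mat m m" and UU: "mat_adjoint U * U = 1\<^sub>m m"
    and diag: "\<And>i. i < m \<Longrightarrow> (mat_adjoint U * A3 * U) $$ (i, i) = es ! i"
    using Cons.IH[OF A3 cp3] by blast
  note Ua = mat_adjoint_carrier[OF U]
  define G where "G = four_block_mat (1\<^sub>m 1) (0\<^sub>m 1 m) (0\<^sub>m m 1) U"
  have G: "G \<in> carrier_mat n n" unfolding G_def nm using U by (intro four_block_carrier_mat) auto
  note Ga = mat_adjoint_carrier[OF G]
  have adj0: "mat_adjoint (0\<^sub>m k l) = (0\<^sub>m l k :: complex mat)" for k l by (rule eq_matI) auto
  have adj1: "mat_adjoint (1\<^sub>m k) = (1\<^sub>m k :: complex mat)" for k by (rule eq_matI) auto
  have Gadj: "mat_adjoint G = four_block_mat (1\<^sub>m 1) (0\<^sub>m 1 m) (0\<^sub>m m 1) (mat_adjoint U)"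
    unfolding G_def by (subst mat_adjoint_four_block[of _ 1 1 _ m _ m]) (use U in \<open>auto simp: adj0 adj1\<close>)
  have GG: "mat_adjoint G * G = 1\<^sub>m n"
    unfolding Gadj unfolding G_def
    by (subst mult_four_block_mat[of _ 1 1 _ m _ m _ _ 1 _ m]) (use U Ua in \<open>auto simp: UU nm\<close>)
  have GAG: "mat_adjoint G * A' * G = four_block_mat A1 (A2 * U) (0\<^sub>m m 1) (mat_adjoint U * A3 * U)"
  proof -
    have "mat_adjoint G * A' = four_block_mat A1 A2 (0\<^sub>m m 1) (mat_adjoint U * A3)"
      unfolding Gadj block A0z
      by (subst mult_four_block_mat[of _ 1 1 _ m _ m _ _ 1 _ m]) (use A1 A2 A3 U Ua in auto)
    then show ?thesis
      unfolding G_def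
      by (simp only:) (subst mult_four_block_mat[of _ 1 1 _ m _ m _ _ 1 _ m], use A1 A2 A3 U Ua in auto)
  qed
  define T where "T = W * G"
  have T: "T \<in> carrier_mat n n" unfolding T_def using W G by auto
  have Ta: "mat_adjoint T = mat_adjoint G * mat_adjoint W" unfolding T_def by (rule mat_adjoint_mult[OF W G])
  have TXT: "mat_adjoint T * X * T = mat_adjoint G * (mat_adjoint W * X * W) * G" if X: "X \<in> carrier_mat n n" for X
  proof -
    have "mat_adjoint T * X * T = mat_adjoint G * mat_adjoint W * X * (W * G)" unfolding Ta unfolding T_def ..
    also have "\<dots> = mat_adjoint G * mat_adjoint W * X * W * G"
      by (rule assoc_mult_mat[symmetric, OF _ W G]) (use Ga Wa X in auto)
    also have "mat_adjoint G * mat_adjoint W * X = mat_adjoint G * (mat_adjoint W * X)"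
      by (rule assoc_mult_mat[OF Ga Wa X])
    also have "\<dots> * W = mat_adjoint G * (mat_adjoint W * X * W)"
      by (rule assoc_mult_mat[OF Ga _ W]) (use Wa X in auto)
    finally show ?thesis .
  qed
  have TT: "mat_adjoint T * T = 1\<^sub>m n"
    using TXT[of "1\<^sub>m n"] T W G by (simp add: WW GG right_mult_one_mat[OF mat_adjoint_carrier])
  have "(mat_adjoint T * A * T) $$ (i, i) = (e # es) ! i" if i: "i < n" for i
  proof -
    define D where "D = mat_adjoint U * A3 * U"
    have D: "D \<in> carrier_mat m m"
      unfolding D_def by (rule mult_carrier_mat[OF mult_carrier_mat[OF Ua A3] U])
    have Di: "D $$ (j, j) = es ! j" if "j < m" for j
      unfolding D_def by (rule diag[OF that])
    have "mat_adjoint T * A * T = four_block_mat A1 (A2 * U) (0\<^sub>m m 1) D"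
      unfolding TXT[OF A] A'_def[symmetric] GAG D_def ..
    then show ?thesis
      using i A1 D A1e Di[of "i - 1"] nm by (cases i) auto
  qed
  then show ?case using T TT by blast
qed

lemma proots_prod_linear: "proots (\<Prod>e\<leftarrow>es. [:- e, 1:]) = mset (es :: complex list)"
proof (induction es)
  case (Cons e es)
  have "(\<Prod>e\<leftarrow>es. [:- e, 1:]) \<noteq> 0" by (auto simp: prod_list_zero_iff)
  then show ?case using Cons by (simp add: proots_mult del: mult_pCons_left)
qed simp

text \<open>In a Schur basis \<open>u\<^sub>i\<close> of \<open>Z\<^sup>* Z\<close>, where \<open>Z = E + R\<close>, the singular values of \<open>Z\<close> are the \<open>\<parallel>Z u\<^sub>i\<parallel>\<close>. If one is at least
  \<open>2\<delta>\<close>, then \<open>\<parallel>R u\<^sub>i\<parallel> \<ge> \<delta>\<close>, and the \<open>\<parallel>R u\<^sub>i\<parallel>\<^sup>2\<close> add up to at most \<open>C\<^sup>2\<close>.\<close>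

lemma large_singular_values_le:
  assumes E: "E \<in> carrier_mat n n" "opnorm_le E \<delta>" and R: "R \<in> carrier_mat n n" "frobenius_norm R \<le> C"
    and \<delta>: "\<delta> > 0"
  shows "real (size (filter_mset (\<lambda>s. s \<notin> {0..<2 * \<delta>}) (singular_values (E + R)))) \<le> C\<^sup>2 / \<delta>\<^sup>2"
proof -
  define Z where "Z = E + R"
  have Z: "Z \<in> carrier_mat n n" using E R by (simp add: Z_def)
  define H where "H = mat_adjoint Z * Z"
  have H: "H \<in> carrier_mat n n" unfolding H_def using Z by (auto intro: mult_carrier_mat mat_adjoint_carrier)
  obtain es where es: "char_poly H = (\<Prod>e\<leftarrow>es. [:- e, 1:])" and len: "length es = n"
    using char_poly_factorized[OF H] by blast
  obtain U where U: "U \<in> carrier_mat n n" and UU: "mat_adjoint U * U = 1\<^sub>m n"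
    and diag: "\<And>i. i < n \<Longrightarrow> (mat_adjoint U * H * U) $$ (i, i) = es ! i"
    using unitary_eigenvalue_diagonal[OF H es] by blast
  have ZU: "Z * U \<in> carrier_mat n n" using Z U by auto
  have eig: "es ! i = of_real ((vnorm (Z *\<^sub>v col U i))\<^sup>2)" if i: "i < n" for i
  proof -
    note Za = mat_adjoint_carrier[OF Z] and Ua = mat_adjoint_carrier[OF U]
    have "mat_adjoint U * H * U = mat_adjoint U * (H * U)" by (rule assoc_mult_mat[OF Ua H U])
    also have "H * U = mat_adjoint Z * (Z * U)" unfolding H_def by (rule assoc_mult_mat[OF Za Z U])
    also have "mat_adjoint U * \<dots> = mat_adjoint U * mat_adjoint Z * (Z * U)"
      by (rule assoc_mult_mat[symmetric, OF Ua Za ZU])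
    also have "mat_adjoint U * mat_adjoint Z = mat_adjoint (Z * U)" by (rule mat_adjoint_mult[symmetric, OF Z U])
    finally have "es ! i = (mat_adjoint (Z * U) * (Z * U)) $$ (i, i)" using diag[OF i] by simp
    also have "\<dots> = of_real ((vnorm (col (Z * U) i))\<^sup>2)"
      unfolding adjoint_mult_index[OF ZU ZU i i] by (rule scalar_prod_self)
    also have "col (Z * U) i = Z *\<^sub>v col U i" by (rule col_mult2[OF Z U i])
    finally show ?thesis .
  qed
  have unit: "vnorm (col U i) = 1" if i: "i < n" for i
  proof -
    have "complex_of_real ((vnorm (col U i))\<^sup>2) = (mat_adjoint U * U) $$ (i, i)"
      unfolding adjoint_mult_index[OF U U i i] scalar_prod_self ..
    also have "\<dots> = 1" using UU i by simp
    finally have "(vnorm (col U i))\<^sup>2 = 1" using of_real_eq_1_iff by blast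
    then show ?thesis using vnorm_nonneg[of "col U i"] by (simp add: power2_eq_1_iff)
  qed
  define I where "I = {i. i < n \<and> vnorm (Z *\<^sub>v col U i) \<ge> 2 * \<delta>}"
  have "size (filter_mset (\<lambda>s. s \<notin> {0..<2 * \<delta>}) (singular_values Z)) =
      length (filter (\<lambda>z. sqrt (Re z) \<notin> {0..<2 * \<delta>}) es)"
    unfolding singular_values_def H_def[symmetric] es proots_prod_linear
    by (simp add: filter_mset_image_mset o_def flip: mset_filter)
  also have "\<dots> = card {i. i < length es \<and> sqrt (Re (es ! i)) \<notin> {0..<2 * \<delta>}}"
    by (rule length_filter_conv_card)
  also have "{i. i < length es \<and> sqrt (Re (es ! i)) \<notin> {0..<2 * \<delta>}} = I"
    unfolding I_def len using eig by (auto simp: not_le)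
  finally have size: "size (filter_mset (\<lambda>s. s \<notin> {0..<2 * \<delta>}) (singular_values Z)) = card I" .
  have fin: "finite I" "I \<subseteq> {..<n}" by (auto simp: I_def)
  have "real (card I) * \<delta>\<^sup>2 = (\<Sum>i\<in>I. \<delta>\<^sup>2)" by simp
  also have "\<dots> \<le> (\<Sum>i\<in>I. (vnorm (R *\<^sub>v col U i))\<^sup>2)"
  proof (intro sum_mono power_mono)
    fix i assume i: "i \<in> I"
    then have i': "i < n" by (simp add: I_def)
    have u: "col U i \<in> carrier_vec n" using U i' by auto
    have "2 * \<delta> \<le> vnorm (Z *\<^sub>v col U i)" using i by (simp add: I_def)
    also have "Z *\<^sub>v col U i = E *\<^sub>v col U i + R *\<^sub>v col U i"
      unfolding Z_def by (rule add_mult_distrib_mat_vec[OF E(1) R(1) u])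
    also have "vnorm \<dots> \<le> vnorm (E *\<^sub>v col U i) + vnorm (R *\<^sub>v col U i)"
      using E R u by (intro vnorm_add[of _ n]) auto
    also have "vnorm (E *\<^sub>v col U i) \<le> \<delta>"
      using opnorm_leD[OF E(2,1) u] unit[OF i'] by simp
    finally show "\<delta> \<le> vnorm (R *\<^sub>v col U i)" by simp
  qed (use \<delta> in simp)
  also have "\<dots> \<le> (\<Sum>i<n. (vnorm (R *\<^sub>v col U i))\<^sup>2)"
    using fin by (intro sum_mono2) auto
  also have "\<dots> = (frobenius_norm (R * U))\<^sup>2"
    unfolding frobenius_norm_sq_cols using R U col_mult2[OF R(1) U] by simp
  also have "\<dots> \<le> C\<^sup>2"
    using frobenius_norm_mult_right[OF R(1) U opnorm_le_isometry[OF U UU]] R(2)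
    by (intro power_mono) auto
  finally show ?thesis unfolding Z_def[symmetric] size using \<delta> by (simp add: pos_le_divide_eq)
qed

lemma strong_cluster_if_asymptotically_compact:
  assumes "asymptotically_compact (\<lambda>n. X n - Y n)"
  shows "strong_cluster X Y"
  unfolding strong_cluster_def
proof (intro allI impI)
  fix \<epsilon> :: real assume "\<epsilon> > 0"
  then have d: "\<epsilon> / 2 > 0" by simp
  obtain C where "\<forall>\<^sub>F n in sequentially. \<exists>E R. E \<in> carrier_mat n n \<and> R \<in> carrier_mat n n \<and>
     X n - Y n = E + R \<and> opnorm_le E (\<epsilon> / 2) \<and> frobenius_norm R \<le> C"
    using assms d unfolding asymptotically_compact_def by blast
  then obtain N2 where N2: "\<And>n. n \<ge> N2 \<Longrightarrow> \<exists>E R. E \<in> carrier_mat n n \<and> R \<in> carrier_mat n n \<and>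
     X n - Y n = E + R \<and> opnorm_le E (\<epsilon> / 2) \<and> frobenius_norm R \<le> C"
    unfolding eventually_sequentially by blast
  define N1 where "N1 = nat \<lceil>C\<^sup>2 / (\<epsilon> / 2)\<^sup>2\<rceil>"
  have "size (filter_mset (\<lambda>s. s \<notin> {0..<\<epsilon>}) (singular_values (X n - Y n))) \<le> N1" if n: "n > N2" for n
  proof -
    obtain E R where ER: "E \<in> carrier_mat n n" "R \<in> carrier_mat n n" "X n - Y n = E + R"
      "opnorm_le E (\<epsilon> / 2)" "frobenius_norm R \<le> C"
      using N2[of n] n by auto
    have "real (size (filter_mset (\<lambda>s. s \<notin> {0..<\<epsilon>}) (singular_values (X n - Y n)))) \<le> C\<^sup>2 / (\<epsilon> / 2)\<^sup>2"
      using large_singular_values_le[OF ER(1,4,2,5) d] ER(3) by simp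
    then show ?thesis unfolding N1_def by linarith
  qed
  then show "\<exists>N1 N2. \<forall>n>N2. size (filter_mset (\<lambda>s. s \<notin> {0..<\<epsilon>}) (singular_values (X n - Y n))) \<le> N1"
    by blast
qed

section \<open>Toeplitz matrices and multiplicativity of symbols\<close>

lemma toeplitz_carrier [simp]: "toeplitz n f \<in> carrier_mat n n"
  by (simp add: toeplitz_def)

lemma toeplitz_dim [simp]: "dim_row (toeplitz n f) = n" "dim_col (toeplitz n f) = n"
  by (simp_all add: toeplitz_def)

lemma toeplitz_index [simp]:
  "j < n \<Longrightarrow> k < n \<Longrightarrow> toeplitz n f $$ (j, k) = fourier_coeff f (int j - int k)"
  by (simp add: toeplitz_def)

lemma toeplitz_add:
  assumes "f \<in> cont_funs" "h \<in> cont_funs"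
  shows "toeplitz n (\<lambda>t. f t + h t) = toeplitz n f + toeplitz n h"
  by (rule eq_matI) (use assms in \<open>auto simp: cont_funs_def fourier_coeff_add\<close>)

lemma toeplitz_diff:
  assumes "f \<in> cont_funs" "h \<in> cont_funs"
  shows "toeplitz n (\<lambda>t. f t - h t) = toeplitz n f - toeplitz n h"
  by (rule eq_matI) (use assms in \<open>auto simp: cont_funs_def fourier_coeff_diff\<close>)

lemma toeplitz_cmult: "toeplitz n (\<lambda>t. c * f t) = c \<cdot>\<^sub>m toeplitz n f"
  by (rule eq_matI) (auto simp: fourier_coeff_cmult)

lemma toeplitz_const: "toeplitz n (\<lambda>_. c) = c \<cdot>\<^sub>m 1\<^sub>m n"
proof (rule eq_matI)
  fix i j assume "i < dim_row (c \<cdot>\<^sub>m 1\<^sub>m n)" "j < dim_col (c \<cdot>\<^sub>m 1\<^sub>m n)"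
  then show "toeplitz n (\<lambda>_. c) $$ (i, j) = (c \<cdot>\<^sub>m 1\<^sub>m n) $$ (i, j)"
    using fourier_coeff_cmult[of c "fourier_mode 0" "int i - int j"]
    by (auto simp: fourier_coeff_fourier_mode)
qed auto

text \<open>If \<open>p\<close> is the trigonometric sum with coefficients \<open>u\<close>, then \<open>T(f) u\<close> consists of Fourier coefficients of \<open>f p\<close>,
  and Bessel's inequality bounds its length by the mean square of \<open>f p\<close>.\<close>

lemma opnorm_le_toeplitz:
  assumes f: "f \<in> cont_funs" and M: "\<And>t. t \<in> {0..2*pi} \<Longrightarrow> cmod (f t) \<le> M" and M0: "M \<ge> 0"
  shows "opnorm_le (toeplitz n f) M"
proof (rule opnorm_leI[OF toeplitz_carrier M0])
  fix u :: "complex vec" assume u: "u \<in> carrier_vec n"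
  have cf: "continuous_on {0..2*pi} f" using f by (simp add: cont_funs_def)
  have inj: "inj_on int {..<n}" by (auto simp: inj_on_def)
  define p where "p = (\<lambda>t. \<Sum>k\<in>int ` {..<n}. u $ nat k * fourier_mode k t)"
  have cp: "continuous_on {0..2*pi} p" unfolding p_def by (intro continuous_intros)
  have coeff: "fourier_coeff (\<lambda>t. f t * p t) (int j) = (toeplitz n f *\<^sub>v u) $ j" if j: "j < n" for j
  proof -
    have "fourier_coeff (\<lambda>t. f t * p t) (int j) =
        fourier_coeff (\<lambda>t. \<Sum>k\<in>int ` {..<n}. u $ nat k * (f t * fourier_mode k t)) (int j)"
      unfolding p_def sum_distrib_left by (simp only: mult.left_commute)
    also have "\<dots> = (\<Sum>k\<in>int ` {..<n}. u $ nat k * fourier_coeff f (int j - k))"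
      by (subst fourier_coeff_sum)
        (auto intro!: continuous_intros cf simp: fourier_coeff_cmult fourier_coeff_mult_mode)
    also have "\<dots> = (\<Sum>k<n. toeplitz n f $$ (j, k) * u $ k)"
      by (subst sum.reindex[OF inj]) (use j in \<open>auto intro!: sum.cong\<close>)
    also have "\<dots> = (toeplitz n f *\<^sub>v u) $ j"
      by (rule index_mult_mat_vec_sum[OF toeplitz_carrier u j, symmetric])
    finally show ?thesis .
  qed
  have "(vnorm (toeplitz n f *\<^sub>v u))\<^sup>2 = (\<Sum>j<n. (cmod (fourier_coeff (\<lambda>t. f t * p t) (int j)))\<^sup>2)"
    unfolding vnorm_sq using coeff by (intro sum.cong) auto
  also have "\<dots> = (\<Sum>k\<in>int ` {..<n}. (cmod (fourier_coeff (\<lambda>t. f t * p t) k))\<^sup>2)"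
    by (subst sum.reindex[OF inj]) (simp add: o_def)
  also have "\<dots> \<le> mean_square (\<lambda>t. f t * p t)"
    by (intro bessel_inequality continuous_intros cf cp) auto
  also have "\<dots> \<le> M\<^sup>2 * mean_square p"
    using cf cp M by (intro mean_square_mono continuous_intros) (auto simp: norm_mult intro!: mult_right_mono)
  also have "mean_square p = (\<Sum>k\<in>int ` {..<n}. (cmod (u $ nat k))\<^sup>2)"
    unfolding p_def by (rule mean_square_trig_sum) simp
  also have "\<dots> = (vnorm u)\<^sup>2"
    unfolding vnorm_sq by (subst sum.reindex[OF inj]) (use u in \<open>auto intro!: sum.cong\<close>)
  also have "M\<^sup>2 * (vnorm u)\<^sup>2 = (M * vnorm u)\<^sup>2" by (simp add: power_mult_distrib)
  finally show "vnorm (toeplitz n f *\<^sub>v u) \<le> M * vnorm u"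
    by (rule power2_le_imp_le) (use M0 in simp)
qed

lemma cont_funs_bounded:
  assumes "f \<in> cont_funs"
  shows "\<exists>M\<ge>0. \<forall>t\<in>{0..2*pi}. cmod (f t) \<le> M"
proof -
  have "bounded (f ` {0..2*pi})"
    using assms compact_continuous_image[of "{0..2*pi}" f] compact_imp_bounded by (auto simp: cont_funs_def)
  then obtain M where "\<And>t. t \<in> {0..2*pi} \<Longrightarrow> cmod (f t) \<le> M"
    unfolding bounded_iff by (metis imageI)
  moreover from this[of 0] have "M \<ge> 0" using norm_ge_zero[of "f 0"] pi_ge_zero by (simp del: norm_ge_zero)
  ultimately show ?thesis by blast
qed

lemma cont_funs_add: "f \<in> cont_funs \<Longrightarrow> h \<in> cont_funs \<Longrightarrow> (\<lambda>t. f t + h t) \<in> cont_funs"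
  and cont_funs_diff: "f \<in> cont_funs \<Longrightarrow> h \<in> cont_funs \<Longrightarrow> (\<lambda>t. f t - h t) \<in> cont_funs"
  and cont_funs_mult: "f \<in> cont_funs \<Longrightarrow> h \<in> cont_funs \<Longrightarrow> (\<lambda>t. f t * h t) \<in> cont_funs"
  and cont_funs_const: "(\<lambda>_. c) \<in> cont_funs"
  and cont_funs_cnj: "f \<in> cont_funs \<Longrightarrow> (\<lambda>t. cnj (f t)) \<in> cont_funs"
  by (auto simp: cont_funs_def intro!: continuous_intros)

text \<open>Asking for all continuous \<open>h\<close> at once makes the property an algebraic one: it passes from \<open>f\<close> and \<open>f'\<close> to \<open>f f'\<close>
  by applying it to \<open>f\<close> with \<open>f' h\<close>, to \<open>f'\<close> with \<open>h\<close>, and to \<open>f\<close> with \<open>f'\<close>.\<close>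

definition toeplitz_multiplier :: "(real \<Rightarrow> complex) \<Rightarrow> bool" where
  "toeplitz_multiplier f \<longleftrightarrow> (\<forall>h\<in>cont_funs.
     asymptotically_compact (\<lambda>n. toeplitz n (\<lambda>t. f t * h t) - toeplitz n f * toeplitz n h))"

lemma toeplitz_multiplier_krein:
  assumes g: "g \<in> cont_funs"
    and krein: "(\<lambda>k::int. real_of_int \<bar>k\<bar> * (cmod (fourier_coeff g k))\<^sup>2) summable_on UNIV"
  shows "toeplitz_multiplier g"
  unfolding toeplitz_multiplier_def
proof
  fix h assume h: "h \<in> cont_funs"
  then obtain M where M: "M \<ge> 0" "\<And>t. t \<in> {0..2*pi} \<Longrightarrow> cmod (h t) \<le> M" using cont_funs_bounded by blast
  define S where "S = (\<Sum>\<^sub>\<infinity>k::int. real_of_int \<bar>k\<bar> * (cmod (fourier_coeff g k))\<^sup>2)"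
  have "frobenius_norm (toeplitz n (\<lambda>t. g t * h t) - toeplitz n g * toeplitz n h) \<le> sqrt (M\<^sup>2 * (1 + S))" for n
  proof (rule real_le_rsqrt)
    have "(frobenius_norm (toeplitz n (\<lambda>t. g t * h t) - toeplitz n g * toeplitz n h))\<^sup>2 =
        (\<Sum>j<n. \<Sum>k<n. (cmod (fourier_coeff (\<lambda>t. g t * h t) (int j - int k) -
          (\<Sum>l<n. fourier_coeff g (int j - int l) * fourier_coeff h (int l - int k))))\<^sup>2)"
      unfolding frobenius_norm_sq
      by (intro sum.cong)
        (auto simp: index_mult_mat_sum[OF toeplitz_carrier toeplitz_carrier] simp del: index_mult_mat(1))
    also have "\<dots> \<le> M\<^sup>2 * (1 + S)"
      unfolding S_def using g h M(2) krein by (intro fourier_coeff_product_defect) (auto simp: cont_funs_def)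
    finally show "(frobenius_norm (toeplitz n (\<lambda>t. g t * h t) - toeplitz n g * toeplitz n h))\<^sup>2 \<le> M\<^sup>2 * (1 + S)" .
  qed
  then show "asymptotically_compact (\<lambda>n. toeplitz n (\<lambda>t. g t * h t) - toeplitz n g * toeplitz n h)"
    by (intro asymptotically_compact_frobenius[of _ "sqrt (M\<^sup>2 * (1 + S))"] always_eventually allI conjI
        minus_carrier_mat mult_carrier_mat[OF toeplitz_carrier toeplitz_carrier])
qed

lemma asymptotically_compact_zero: "asymptotically_compact (\<lambda>n. 0\<^sub>m n n)"
proof -
  have "frobenius_norm (0\<^sub>m n n) = 0" for n
    unfolding frobenius_norm_def by (rule L2_set_0') auto
  then show ?thesis by (intro asymptotically_compact_frobenius[of _ 0]) auto
qed

lemma toeplitz_multiplier_const: "toeplitz_multiplier (\<lambda>_. c)"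
  unfolding toeplitz_multiplier_def
proof
  fix h
  have "toeplitz n (\<lambda>t. c * h t) - toeplitz n (\<lambda>_. c) * toeplitz n h = 0\<^sub>m n n" for n
    by (simp add: toeplitz_cmult toeplitz_const mult_smult_assoc_mat[OF one_carrier_mat toeplitz_carrier]
        minus_r_inv_mat[of _ n n])
  then show "asymptotically_compact (\<lambda>n. toeplitz n (\<lambda>t. c * h t) - toeplitz n (\<lambda>_. c) * toeplitz n h)"
    using asymptotically_compact_zero by simp
qed

lemma toeplitz_multiplier_add:
  assumes f: "f \<in> cont_funs" "toeplitz_multiplier f" and f': "f' \<in> cont_funs" "toeplitz_multiplier f'"
  shows "toeplitz_multiplier (\<lambda>t. f t + f' t)"
  unfolding toeplitz_multiplier_def
proof
  fix h assume h: "h \<in> cont_funs"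
  let ?T = toeplitz
  have "asymptotically_compact (\<lambda>n. (?T n (\<lambda>t. f t * h t) - ?T n f * ?T n h) + (?T n (\<lambda>t. f' t * h t) - ?T n f' * ?T n h))"
    using f f' h unfolding toeplitz_multiplier_def by (intro asymptotically_compact_add) auto
  moreover have "(?T n (\<lambda>t. f t * h t) - ?T n f * ?T n h) + (?T n (\<lambda>t. f' t * h t) - ?T n f' * ?T n h) =
      ?T n (\<lambda>t. (f t + f' t) * h t) - ?T n (\<lambda>t. f t + f' t) * ?T n h" for n
  proof -
    have m: "?T n F * ?T n h \<in> carrier_mat n n" for F by (rule mult_carrier_mat[OF toeplitz_carrier toeplitz_carrier])
    show ?thesis
      unfolding toeplitz_add[OF f(1) f'(1)] add_mult_distrib_mat[OF toeplitz_carrier toeplitz_carrier toeplitz_carrier]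
        distrib_right toeplitz_add[OF cont_funs_mult[OF f(1) h] cont_funs_mult[OF f'(1) h]]
      using m[of f] m[of f'] by (intro eq_matI) (auto simp del: index_mult_mat(1))
  qed
  ultimately show "asymptotically_compact (\<lambda>n. ?T n (\<lambda>t. (f t + f' t) * h t) - ?T n (\<lambda>t. f t + f' t) * ?T n h)"
    by simp
qed

lemma toeplitz_multiplier_mult:
  assumes f: "f \<in> cont_funs" "toeplitz_multiplier f" and f': "f' \<in> cont_funs" "toeplitz_multiplier f'"
  shows "toeplitz_multiplier (\<lambda>t. f t * f' t)"
  unfolding toeplitz_multiplier_def
proof
  fix h assume h: "h \<in> cont_funs"
  let ?T = toeplitz
  obtain M where M: "M \<ge> 0" "\<And>t. t \<in> {0..2*pi} \<Longrightarrow> cmod (f t) \<le> M" using cont_funs_bounded[OF f(1)] by blast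
  obtain N where N: "N \<ge> 0" "\<And>t. t \<in> {0..2*pi} \<Longrightarrow> cmod (h t) \<le> N" using cont_funs_bounded[OF h] by blast
  define Z1 where "Z1 = (\<lambda>n. ?T n (\<lambda>t. f t * (f' t * h t)) - ?T n f * ?T n (\<lambda>t. f' t * h t))"
  define Z2 where "Z2 = (\<lambda>n. ?T n (\<lambda>t. f' t * h t) - ?T n f' * ?T n h)"
  define Z3 where "Z3 = (\<lambda>n. ?T n (\<lambda>t. f t * f' t) - ?T n f * ?T n f')"
  have "asymptotically_compact Z1" "asymptotically_compact Z2" "asymptotically_compact Z3"
    unfolding Z1_def Z2_def Z3_def using f f' h cont_funs_mult[OF f'(1) h] unfolding toeplitz_multiplier_def by auto
  then have "asymptotically_compact (\<lambda>n. (Z1 n + ?T n f * Z2 n) + - (Z3 n * ?T n h))"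
    by (intro asymptotically_compact_add asymptotically_compact_uminus
        asymptotically_compact_mult_left[of _ _ M] asymptotically_compact_mult_right[of _ _ N]
        toeplitz_carrier opnorm_le_toeplitz f h M N)
  moreover have "(Z1 n + ?T n f * Z2 n) + - (Z3 n * ?T n h) = ?T n (\<lambda>t. f t * f' t * h t) - ?T n (\<lambda>t. f t * f' t) * ?T n h" for n
  proof -
    note c = toeplitz_carrier and m = mult_carrier_mat[OF toeplitz_carrier toeplitz_carrier]
    have "?T n f * Z2 n = ?T n f * ?T n (\<lambda>t. f' t * h t) - ?T n f * (?T n f' * ?T n h)"
      unfolding Z2_def by (rule mult_minus_distrib_mat[OF c c m])
    moreover have "Z3 n * ?T n h = ?T n (\<lambda>t. f t * f' t) * ?T n h - ?T n f * (?T n f' * ?T n h)"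
      unfolding Z3_def minus_mult_distrib_mat[OF c m c] assoc_mult_mat[OF c c c] ..
    ultimately show ?thesis
      using m[of n f f'] mult_carrier_mat[OF c m, of n f f' h] m[of n f "\<lambda>t. f' t * h t"] m[of n "\<lambda>t. f t * f' t" h]
      unfolding Z1_def by (intro eq_matI) (auto simp: mult.assoc simp del: index_mult_mat(1) assoc_mult_mat)
  qed
  ultimately show "asymptotically_compact (\<lambda>n. ?T n (\<lambda>t. f t * f' t * h t) - ?T n (\<lambda>t. f t * f' t) * ?T n h)"
    by simp
qed

text \<open>The defect \<open>T(fh) - T(f) T(h)\<close> is linear in \<open>f\<close>, and its operator norm is at most twice the product of the sup norms.\<close>

lemma toeplitz_multiplier_limit:
  assumes f: "f \<in> cont_funs"
    and lim: "\<And>\<epsilon>. \<epsilon> > 0 \<Longrightarrow> \<exists>F\<in>cont_funs. toeplitz_multiplier F \<and> (\<forall>t\<in>{0..2*pi}. cmod (f t - F t) \<le> \<epsilon>)"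
  shows "toeplitz_multiplier f"
  unfolding toeplitz_multiplier_def
proof
  fix h assume h: "h \<in> cont_funs"
  let ?T = toeplitz
  obtain M where M: "M \<ge> 0" "\<And>t. t \<in> {0..2*pi} \<Longrightarrow> cmod (h t) \<le> M" using cont_funs_bounded[OF h] by blast
  show "asymptotically_compact (\<lambda>n. ?T n (\<lambda>t. f t * h t) - ?T n f * ?T n h)"
  proof (rule asymptotically_compact_limit)
    fix \<epsilon> :: real assume "\<epsilon> > 0"
    define d where "d = \<epsilon> / (2 * (M + 1))"
    have d: "d > 0" using \<open>\<epsilon> > 0\<close> M(1) by (simp add: d_def)
    have "2 * M + 2 \<noteq> 0" using M(1) by linarith
    then have "2 * d * (M + 1) = \<epsilon>" by (simp add: d_def field_simps)
    then have dM: "d * M + d * M \<le> \<epsilon>" using d by (simp add: algebra_simps)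
    obtain F where F: "F \<in> cont_funs" "toeplitz_multiplier F" "\<And>t. t \<in> {0..2*pi} \<Longrightarrow> cmod (f t - F t) \<le> d"
      using lim[OF d] by blast
    have "opnorm_le ((?T n (\<lambda>t. f t * h t) - ?T n f * ?T n h) - (?T n (\<lambda>t. F t * h t) - ?T n F * ?T n h)) \<epsilon>" for n
    proof -
      note c = toeplitz_carrier and m = mult_carrier_mat[OF toeplitz_carrier toeplitz_carrier]
      have op1: "opnorm_le (?T n (\<lambda>t. f t - F t)) d"
        using d by (intro opnorm_le_toeplitz[OF cont_funs_diff[OF f F(1)]] F(3)) auto
      have "opnorm_le (?T n (\<lambda>t. (f t - F t) * h t)) (d * M)"
      proof (rule opnorm_le_toeplitz[OF cont_funs_mult[OF cont_funs_diff[OF f F(1)] h]])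
        fix t :: real assume t: "t \<in> {0..2*pi}"
        show "cmod ((f t - F t) * h t) \<le> d * M"
          unfolding norm_mult using F(3)[OF t] M(2)[OF t] d by (intro mult_mono) auto
      qed (use d M(1) in simp)
      moreover have "opnorm_le (- (?T n (\<lambda>t. f t - F t) * ?T n h)) (d * M)"
        using M by (intro opnorm_le_uminus opnorm_le_mult[OF c c op1] opnorm_le_toeplitz h)
      ultimately have "opnorm_le (?T n (\<lambda>t. (f t - F t) * h t) + - (?T n (\<lambda>t. f t - F t) * ?T n h)) \<epsilon>"
        by (rule opnorm_le_mono[OF opnorm_le_add[OF c uminus_carrier_mat[OF m]] dM])
      moreover have "?T n (\<lambda>t. (f t - F t) * h t) + - (?T n (\<lambda>t. f t - F t) * ?T n h) =
          (?T n (\<lambda>t. f t * h t) - ?T n f * ?T n h) - (?T n (\<lambda>t. F t * h t) - ?T n F * ?T n h)"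
        unfolding left_diff_distrib toeplitz_diff[OF f F(1)] toeplitz_diff[OF cont_funs_mult[OF f h] cont_funs_mult[OF F(1) h]]
          minus_mult_distrib_mat[OF c c c]
        using m[of n f h] m[of n F h] by (intro eq_matI) (auto simp del: index_mult_mat(1))
      ultimately show ?thesis by simp
    qed
    then show "\<exists>Y. asymptotically_compact Y \<and> (\<forall>\<^sub>F n in sequentially. Y n \<in> carrier_mat n n \<and>
        ?T n (\<lambda>t. f t * h t) - ?T n f * ?T n h \<in> carrier_mat n n \<and>
        opnorm_le ((?T n (\<lambda>t. f t * h t) - ?T n f * ?T n h) - Y n) \<epsilon>)"
      using F(2) h unfolding toeplitz_multiplier_def
      by (intro exI[of _ "\<lambda>n. ?T n (\<lambda>t. F t * h t) - ?T n F * ?T n h"] conjI always_eventually allI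
          minus_carrier_mat mult_carrier_mat[OF toeplitz_carrier toeplitz_carrier]) auto
  qed
qed

section \<open>Symbols approximated by their preconditioners\<close>

definition precond_approximates :: "(nat \<Rightarrow> complex mat) \<Rightarrow> (real \<Rightarrow> complex) \<Rightarrow> bool" where
  "precond_approximates U f \<longleftrightarrow> asymptotically_compact (\<lambda>n. precond (U n) (toeplitz n f) - toeplitz n f)"

lemma asymptotically_compact_precond:
  assumes U: "\<And>n. U n \<in> carrier_mat n n" "\<And>n. n > 0 \<Longrightarrow> unitary_matrix (U n)"
    and Z: "asymptotically_compact Z"
  shows "asymptotically_compact (\<lambda>n. precond (U n) (Z n))"
proof (rule asymptotically_compact_linear_image[where c = 1 and \<Phi> = "\<lambda>n. precond (U n)", OF Z])
  fix n :: nat and E :: "complex mat" and \<epsilon> :: real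
  assume n: "n > 0" and E: "E \<in> carrier_mat n n"
  show "precond (U n) E \<in> carrier_mat n n" by (rule precond_carrier[OF U(1) E])
  show "frobenius_norm (precond (U n) E) \<le> 1 * frobenius_norm E"
    using frobenius_norm_precond[OF U(1) U(2)[OF n] E] by simp
  show "opnorm_le (precond (U n) E) (1 * \<epsilon>)" if "opnorm_le E \<epsilon>"
    using opnorm_le_precond[OF U(1) U(2)[OF n] E that] by simp
  show "precond (U n) (E + R) = precond (U n) E + precond (U n) R" if "R \<in> carrier_mat n n" for R
    by (rule precond_add[OF U(1) E that])
qed simp

lemma precond_approximates_add:
  assumes U: "\<And>n. U n \<in> carrier_mat n n"
    and f: "f \<in> cont_funs" "precond_approximates U f" and h: "h \<in> cont_funs" "precond_approximates U h"
  shows "precond_approximates U (\<lambda>t. f t + h t)"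
proof -
  let ?T = toeplitz
  have "asymptotically_compact (\<lambda>n. (precond (U n) (?T n f) - ?T n f) + (precond (U n) (?T n h) - ?T n h))"
    using f h unfolding precond_approximates_def by (intro asymptotically_compact_add)
  moreover have "(precond (U n) (?T n f) - ?T n f) + (precond (U n) (?T n h) - ?T n h) =
      precond (U n) (?T n (\<lambda>t. f t + h t)) - ?T n (\<lambda>t. f t + h t)" for n
    unfolding toeplitz_add[OF f(1) h(1)] precond_add[OF U toeplitz_carrier toeplitz_carrier]
    using precond_carrier[OF U toeplitz_carrier, of n f] precond_carrier[OF U toeplitz_carrier, of n h]
    by (intro eq_matI) auto
  ultimately show ?thesis unfolding precond_approximates_def by simp
qed

lemma precond_scalar:
  assumes U: "U \<in> carrier_mat n n" "unitary_matrix U"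
  shows "precond U (c \<cdot>\<^sub>m 1\<^sub>m n) = c \<cdot>\<^sub>m 1\<^sub>m n"
proof -
  note V = mat_adjoint_carrier[OF U(1)]
  have "mat_adjoint U * (c \<cdot>\<^sub>m 1\<^sub>m n) * U = c \<cdot>\<^sub>m 1\<^sub>m n"
    unfolding mult_smult_distrib[OF V one_carrier_mat] right_mult_one_mat[OF V]
      mult_smult_assoc_mat[OF V U(1)] unitary_matrixD(2)[OF U] ..
  moreover have "diag_part (c \<cdot>\<^sub>m 1\<^sub>m n) = c \<cdot>\<^sub>m 1\<^sub>m n"
    by (rule eq_matI) (auto simp: diag_part_def)
  moreover have "U * (c \<cdot>\<^sub>m 1\<^sub>m n) * mat_adjoint U = c \<cdot>\<^sub>m 1\<^sub>m n"
    unfolding mult_smult_distrib[OF U(1) one_carrier_mat] right_mult_one_mat[OF U(1)]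
      mult_smult_assoc_mat[OF U(1) V] unitary_matrixD(1)[OF U] ..
  ultimately show ?thesis by (simp add: precond_def)
qed

lemma precond_approximates_const:
  assumes U: "\<And>n. U n \<in> carrier_mat n n" "\<And>n. n > 0 \<Longrightarrow> unitary_matrix (U n)"
  shows "precond_approximates U (\<lambda>_. c)"
  unfolding precond_approximates_def
proof (rule asymptotically_compact_frobenius[of _ 0])
  show "\<forall>\<^sub>F n in sequentially. precond (U n) (toeplitz n (\<lambda>_. c)) - toeplitz n (\<lambda>_. c) \<in> carrier_mat n n \<and>
      frobenius_norm (precond (U n) (toeplitz n (\<lambda>_. c)) - toeplitz n (\<lambda>_. c)) \<le> 0"
    using eventually_gt_at_top[of 0]
  proof eventually_elim
    case (elim n)
    have "precond (U n) (toeplitz n (\<lambda>_. c)) - toeplitz n (\<lambda>_. c) = 0\<^sub>m n n"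
      unfolding toeplitz_const precond_scalar[OF U(1) U(2)[OF elim]] by (intro eq_matI) auto
    moreover have "frobenius_norm (0\<^sub>m n n) = 0"
      unfolding frobenius_norm_def by (rule L2_set_0') auto
    ultimately show ?case by simp
  qed
qed

text \<open>With \<open>D = P(T(f)) P(T(h))\<close>, the difference \<open>R = T(fh) - D\<close> is asymptotically compact, and \<open>P(D) = D\<close>. Hence
  \<open>P(T(fh)) - T(fh) = P(R) - R\<close>.\<close>

lemma precond_approximates_mult:
  assumes U: "\<And>n. U n \<in> carrier_mat n n" "\<And>n. n > 0 \<Longrightarrow> unitary_matrix (U n)"
    and f: "f \<in> cont_funs" "toeplitz_multiplier f" "precond_approximates U f"
    and h: "h \<in> cont_funs" "precond_approximates U h"
  shows "precond_approximates U (\<lambda>t. f t * h t)"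
proof -
  let ?T = toeplitz
  let ?P = "\<lambda>n. precond (U n)"
  note c = toeplitz_carrier and Pc = precond_carrier[OF U(1) toeplitz_carrier]
  obtain M where M: "M \<ge> 0" "\<And>t. t \<in> {0..2*pi} \<Longrightarrow> cmod (f t) \<le> M" using cont_funs_bounded[OF f(1)] by blast
  obtain N where N: "N \<ge> 0" "\<And>t. t \<in> {0..2*pi} \<Longrightarrow> cmod (h t) \<le> N" using cont_funs_bounded[OF h(1)] by blast
  define Z1 where "Z1 = (\<lambda>n. ?T n (\<lambda>t. f t * h t) - ?T n f * ?T n h)"
  define Z2 where "Z2 = (\<lambda>n. ?P n (?T n f) - ?T n f)"
  define Z3 where "Z3 = (\<lambda>n. ?P n (?T n h) - ?T n h)"
  have Z: "asymptotically_compact Z1" "asymptotically_compact Z2" "asymptotically_compact Z3"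
    unfolding Z1_def Z2_def Z3_def using f h unfolding toeplitz_multiplier_def precond_approximates_def by auto
  define D where "D = (\<lambda>n. ?P n (?T n f) * ?P n (?T n h))"
  have Dc: "D n \<in> carrier_mat n n" for n unfolding D_def by (rule mult_carrier_mat[OF Pc Pc])
  define R where "R = (\<lambda>n. Z1 n + (- (Z2 n * ?T n h) + - (?P n (?T n f) * Z3 n)))"
  have opP: "opnorm_le (?P n (?T n f)) M" if "n > 0" for n
    by (intro opnorm_le_precond[OF U(1) U(2)[OF that] c] opnorm_le_toeplitz f M)
  have R: "asymptotically_compact R"
    unfolding R_def
    by (intro asymptotically_compact_add asymptotically_compact_uminus Z
        asymptotically_compact_mult_left[of _ _ M] asymptotically_compact_mult_right[of _ _ N]
        c Pc opP opnorm_le_toeplitz h N)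
  have TR: "?T n (\<lambda>t. f t * h t) = R n + D n" and Rc: "R n \<in> carrier_mat n n" for n
  proof -
    have 2: "Z2 n * ?T n h = ?P n (?T n f) * ?T n h - ?T n f * ?T n h"
      unfolding Z2_def by (rule minus_mult_distrib_mat[OF Pc c c])
    have 3: "?P n (?T n f) * Z3 n = D n - ?P n (?T n f) * ?T n h"
      unfolding Z3_def D_def by (rule mult_minus_distrib_mat[OF Pc Pc c])
    note m = mult_carrier_mat[OF c c, of n f h] mult_carrier_mat[OF Pc c, of n f h] Dc[of n]
    show "?T n (\<lambda>t. f t * h t) = R n + D n"
      unfolding R_def 2 3 Z1_def using m by (intro eq_matI) (auto simp del: index_mult_mat(1))
    show "R n \<in> carrier_mat n n"
      unfolding R_def 2 3 Z1_def by (intro add_carrier_mat uminus_carrier_mat minus_carrier_mat m)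
  qed
  \<comment> \<open>The two sides agree where \<open>U n\<close> is unitary, that is for \<open>n > 0\<close>; the limit rule, which looks at large \<open>n\<close> only, closes the gap.\<close>
  have eq: "?P n (?T n (\<lambda>t. f t * h t)) - ?T n (\<lambda>t. f t * h t) = ?P n (R n) + - R n" if n: "n > 0" for n
  proof -
    have "?P n (D n) = D n" unfolding D_def by (rule precond_mult_preconds[OF U(1) U(2)[OF n] c c])
    then show ?thesis
      unfolding TR precond_add[OF U(1) Rc Dc]
      using precond_carrier[OF U(1) Rc, of n] Rc[of n] Dc[of n] by (intro eq_matI) auto
  qed
  have comp: "asymptotically_compact (\<lambda>n. ?P n (R n) + - R n)"
    by (intro asymptotically_compact_add asymptotically_compact_uminus asymptotically_compact_precond U R)
  show ?thesis
    unfolding precond_approximates_def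
  proof (rule asymptotically_compact_limit)
    fix \<epsilon> :: real assume "\<epsilon> > 0"
    have "\<forall>\<^sub>F n in sequentially. ?P n (R n) + - R n \<in> carrier_mat n n \<and>
      ?P n (?T n (\<lambda>t. f t * h t)) - ?T n (\<lambda>t. f t * h t) \<in> carrier_mat n n \<and>
      opnorm_le (?P n (?T n (\<lambda>t. f t * h t)) - ?T n (\<lambda>t. f t * h t) - (?P n (R n) + - R n)) \<epsilon>"
      using eventually_gt_at_top[of 0]
    proof eventually_elim
      case (elim n)
      have c': "?P n (R n) + - R n \<in> carrier_mat n n"
        using precond_carrier[OF U(1) Rc] Rc by auto
      then show ?case unfolding eq[OF elim] using \<open>\<epsilon> > 0\<close>
        by (simp add: minus_r_inv_mat[OF c'] opnorm_le_zero)
    qed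
    then show "\<exists>Y. asymptotically_compact Y \<and> (\<forall>\<^sub>F n in sequentially. Y n \<in> carrier_mat n n \<and>
      ?P n (?T n (\<lambda>t. f t * h t)) - ?T n (\<lambda>t. f t * h t) \<in> carrier_mat n n \<and>
      opnorm_le (?P n (?T n (\<lambda>t. f t * h t)) - ?T n (\<lambda>t. f t * h t) - Y n) \<epsilon>)"
      using comp by blast
  qed
qed

lemma precond_approximates_limit:
  assumes U: "\<And>n. U n \<in> carrier_mat n n" "\<And>n. n > 0 \<Longrightarrow> unitary_matrix (U n)"
    and f: "f \<in> cont_funs"
    and lim: "\<And>\<epsilon>. \<epsilon> > 0 \<Longrightarrow> \<exists>F\<in>cont_funs. precond_approximates U F \<and> (\<forall>t\<in>{0..2*pi}. cmod (f t - F t) \<le> \<epsilon>)"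
  shows "precond_approximates U f"
  unfolding precond_approximates_def
proof (rule asymptotically_compact_limit)
  let ?T = toeplitz
  let ?P = "\<lambda>n. precond (U n)"
  note c = toeplitz_carrier and Pc = precond_carrier[OF U(1) toeplitz_carrier]
  fix \<epsilon> :: real assume "\<epsilon> > 0"
  then have e: "\<epsilon> / 2 > 0" by simp
  obtain F where F: "F \<in> cont_funs" "precond_approximates U F" "\<And>t. t \<in> {0..2*pi} \<Longrightarrow> cmod (f t - F t) \<le> \<epsilon> / 2"
    using lim[OF e] by blast
  have "\<forall>\<^sub>F n in sequentially. ?P n (?T n F) - ?T n F \<in> carrier_mat n n \<and>
      ?P n (?T n f) - ?T n f \<in> carrier_mat n n \<and>
      opnorm_le (?P n (?T n f) - ?T n f - (?P n (?T n F) - ?T n F)) \<epsilon>"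
    using eventually_gt_at_top[of 0]
  proof eventually_elim
    case (elim n)
    define G where "G = (\<lambda>t. f t - F t)"
    have G: "G \<in> cont_funs" unfolding G_def by (rule cont_funs_diff[OF f F(1)])
    have op: "opnorm_le (?T n G) (\<epsilon> / 2)"
      using e F(3) by (intro opnorm_le_toeplitz G) (auto simp: G_def)
    have "opnorm_le (?P n (?T n G) + - ?T n G) (\<epsilon> / 2 + \<epsilon> / 2)"
      by (intro opnorm_le_add[OF Pc uminus_carrier_mat[OF c]] opnorm_le_uminus op
          opnorm_le_precond[OF U(1) U(2)[OF elim] c])
    moreover have "?T n f = ?T n F + ?T n G"
      using toeplitz_add[OF F(1) G, of n] by (simp add: G_def)
    then have "?P n (?T n f) - ?T n f - (?P n (?T n F) - ?T n F) = ?P n (?T n G) + - ?T n G"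
      using precond_add[OF U(1) c c, of n F G] Pc[of n F] Pc[of n G] by (intro eq_matI) auto
    ultimately show ?case by (auto intro!: minus_carrier_mat)
  qed
  then show "\<exists>Y. asymptotically_compact Y \<and> (\<forall>\<^sub>F n in sequentially. Y n \<in> carrier_mat n n \<and>
      ?P n (?T n f) - ?T n f \<in> carrier_mat n n \<and> opnorm_le (?P n (?T n f) - ?T n f - Y n) \<epsilon>)"
    using F(2) unfolding precond_approximates_def by blast
qed

text \<open>The conjugate is included in the condition, so that closure under conjugation holds by symmetry; conjugation
  commutes with all the other operations.\<close>

lemma cstar_subalgebra_approximated:
  assumes U: "\<And>n. U n \<in> carrier_mat n n" "\<And>n. n > 0 \<Longrightarrow> unitary_matrix (U n)"
  defines "good \<equiv> \<lambda>f. toeplitz_multiplier f \<and> precond_approximates U f"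
  shows "cstar_subalgebra {f \<in> cont_funs. good f \<and> good (\<lambda>t. cnj (f t))}"
proof -
  have add: "good (\<lambda>t. f t + h t)" if "f \<in> cont_funs" "good f" "h \<in> cont_funs" "good h" for f h
    using that toeplitz_multiplier_add precond_approximates_add[OF U(1)] unfolding good_def by blast
  have mult: "good (\<lambda>t. f t * h t)" if "f \<in> cont_funs" "good f" "h \<in> cont_funs" "good h" for f h
    using that toeplitz_multiplier_mult precond_approximates_mult[OF U] unfolding good_def by blast
  have const: "good (\<lambda>_. c)" for c
    using toeplitz_multiplier_const precond_approximates_const[OF U] unfolding good_def by blast
  have lim: "good f" if f: "f \<in> cont_funs"
    and a: "\<And>\<epsilon>. \<epsilon> > 0 \<Longrightarrow> \<exists>F\<in>cont_funs. good F \<and> (\<forall>t\<in>{0..2*pi}. cmod (f t - F t) \<le> \<epsilon>)" for f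
    unfolding good_def
  proof
    show "toeplitz_multiplier f"
      by (rule toeplitz_multiplier_limit[OF f]) (use a in \<open>unfold good_def, blast\<close>)
    show "precond_approximates U f"
      by (rule precond_approximates_limit[OF U f]) (use a in \<open>unfold good_def, blast\<close>)+
  qed
  let ?B = "{f \<in> cont_funs. good f \<and> good (\<lambda>t. cnj (f t))}"
  have "f \<in> ?B" if F: "range F \<subseteq> ?B" and ul: "uniform_limit {0..2*pi} F f sequentially" for F f
  proof -
    have Fn: "F n \<in> cont_funs" "good (F n)" "good (\<lambda>t. cnj (F n t))" for n using F by auto
    have fc: "f \<in> cont_funs"
      using uniform_limit_theorem[OF _ ul] Fn(1) by (simp add: cont_funs_def)
    have ex: "\<exists>n. \<forall>t\<in>{0..2*pi}. cmod (f t - F n t) \<le> \<epsilon>" if "\<epsilon> > 0" for \<epsilon>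
    proof -
      have "\<forall>\<^sub>F n in sequentially. \<forall>t\<in>{0..2*pi}. dist (F n t) (f t) < \<epsilon>"
        by (rule uniform_limitD[OF ul that])
      then obtain n where "\<forall>t\<in>{0..2*pi}. dist (F n t) (f t) < \<epsilon>"
        unfolding eventually_sequentially by blast
      then show ?thesis by (intro exI[of _ n]) (auto simp: dist_norm norm_minus_commute intro: less_imp_le)
    qed
    have "good f"
      by (rule lim[OF fc]) (use ex Fn in blast)
    moreover have "good (\<lambda>t. cnj (f t))"
    proof (rule lim[OF cont_funs_cnj[OF fc]])
      fix \<epsilon> :: real assume "\<epsilon> > 0"
      then obtain n where n: "\<forall>t\<in>{0..2*pi}. cmod (f t - F n t) \<le> \<epsilon>" using ex by blast
      have "cmod (cnj (f t) - cnj (F n t)) = cmod (f t - F n t)" for t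
        by (simp only: complex_cnj_diff[symmetric] complex_mod_cnj)
      then show "\<exists>G\<in>cont_funs. good G \<and> (\<forall>t\<in>{0..2*pi}. cmod (cnj (f t) - G t) \<le> \<epsilon>)"
        using n Fn(3) cont_funs_cnj[OF Fn(1)] by (intro bexI[of _ "\<lambda>t. cnj (F n t)"]) auto
    qed
    ultimately show ?thesis using fc by blast
  qed
  note limit_B = this
  show ?thesis
    unfolding cstar_subalgebra_def
  proof (intro conjI allI ballI impI)
    show "?B \<subseteq> cont_funs" by blast
    show "(\<lambda>_. c) \<in> ?B" for c
      using const[of c] const[of "cnj c"] cont_funs_const[of c] by simp
    show "(\<lambda>t. f t + h t) \<in> ?B" if "f \<in> ?B" "h \<in> ?B" for f h
      using that add[of f h] add[of "\<lambda>t. cnj (f t)" "\<lambda>t. cnj (h t)"]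
      by (simp add: cont_funs_add cont_funs_cnj)
    show "(\<lambda>t. f t * h t) \<in> ?B" if "f \<in> ?B" "h \<in> ?B" for f h
      using that mult[of f h] mult[of "\<lambda>t. cnj (f t)" "\<lambda>t. cnj (h t)"]
      by (simp add: cont_funs_mult cont_funs_cnj)
    show "(\<lambda>t. cnj (f t)) \<in> ?B" if "f \<in> ?B" for f
      using that by (simp add: cont_funs_cnj)
    show "f \<in> ?B" if "range F \<subseteq> ?B \<and> uniform_limit {0..2*pi} F f sequentially" for F f
      by (rule limit_B[OF conjunct1[OF that] conjunct2[OF that]])
  qed
qed

section \<open>The trace estimate for the generators\<close>

lemma LPO_sum:
  "LPO n w f t = (\<Sum>j<n. w j t * (\<Sum>k<n. fourier_coeff f (int j - int k) * cnj (w k t)))"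
  unfolding LPO_def Let_def scalar_prod_def
  by (auto simp: scalar_prod_def lessThan_atLeast0 intro!: sum.cong)

lemma vandermonde_carrier [simp]: "vandermonde n w x \<in> carrier_mat n n"
  by (simp add: vandermonde_def)

text \<open>The values of the operator at the grid points are the diagonal entries of \<open>V T(f) V\<^sup>*\<close>, hence the eigenvalues of the preconditioner.\<close>

lemma vandermonde_conj_diag:
  assumes "i < n"
  shows "(vandermonde n w x * toeplitz n f * mat_adjoint (vandermonde n w x)) $$ (i, i) = LPO n w f (x i)"
proof -
  let ?V = "vandermonde n w x"
  have "?V * toeplitz n f * mat_adjoint ?V = ?V * (toeplitz n f * mat_adjoint ?V)"
    by (rule assoc_mult_mat[of _ n n _ n _ n]) auto
  also have "\<dots> $$ (i, i) = (\<Sum>j<n. ?V $$ (i, j) * (toeplitz n f * mat_adjoint ?V) $$ (j, i))"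
    by (rule index_mult_mat_sum[OF vandermonde_carrier
          mult_carrier_mat[OF toeplitz_carrier mat_adjoint_carrier[OF vandermonde_carrier]] assms assms])
  also have "\<dots> = (\<Sum>j<n. w j (x i) * (\<Sum>k<n. fourier_coeff f (int j - int k) * cnj (w k (x i))))"
  proof (rule sum.cong[OF refl])
    fix j assume "j \<in> {..<n}"
    then have j: "j < n" by simp
    have "(toeplitz n f * mat_adjoint ?V) $$ (j, i) = (\<Sum>k<n. toeplitz n f $$ (j, k) * mat_adjoint ?V $$ (k, i))"
      by (rule index_mult_mat_sum[of _ n n _ n]) (use assms j in auto)
    also have "\<dots> = (\<Sum>k<n. fourier_coeff f (int j - int k) * cnj (w k (x i)))"
      using assms j by (intro sum.cong) (auto simp: vandermonde_def)
    finally show "?V $$ (i, j) * (toeplitz n f * mat_adjoint ?V) $$ (j, i) =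
        w j (x i) * (\<Sum>k<n. fourier_coeff f (int j - int k) * cnj (w k (x i)))"
      using assms j by (simp add: vandermonde_def)
  qed
  finally show ?thesis by (simp add: LPO_sum)
qed

lemma trace_unitary_conj:
  assumes V: "V \<in> carrier_mat n n" "unitary_matrix V" and X: "X \<in> carrier_mat n n"
  shows "(\<Sum>i<n. (V * X * mat_adjoint V) $$ (i, i)) = (\<Sum>i<n. X $$ (i, i) :: complex)"
proof -
  note Va = mat_adjoint_carrier[OF V(1)] and VX = mult_carrier_mat[OF V(1) X]
  have "(\<Sum>i<n. (V * X * mat_adjoint V) $$ (i, i)) = (\<Sum>i<n. \<Sum>k<n. (V * X) $$ (i, k) * mat_adjoint V $$ (k, i))"
    by (intro sum.cong refl index_mult_mat_sum[OF VX Va]) auto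
  also have "\<dots> = (\<Sum>k<n. \<Sum>i<n. mat_adjoint V $$ (k, i) * (V * X) $$ (i, k))"
    by (subst sum.swap) (simp only: mult.commute)
  also have "\<dots> = (\<Sum>k<n. (mat_adjoint V * (V * X)) $$ (k, k))"
    by (intro sum.cong refl index_mult_mat_sum[OF Va VX, symmetric]) auto
  also have "mat_adjoint V * (V * X) = mat_adjoint V * V * X"
    by (rule assoc_mult_mat[symmetric, OF Va V(1) X])
  also have "\<dots> = X" unfolding unitary_matrixD(2)[OF V] by (rule left_mult_one_mat[OF X])
  finally show ?thesis .
qed

text \<open>Both sides are the trace of the Toeplitz matrix.\<close>

lemma sum_LPO_grid:
  assumes "unitary_matrix (vandermonde n w x)"
  shows "(\<Sum>i<n. LPO n w f (x i)) = of_nat n * fourier_coeff f 0"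
proof -
  have "(\<Sum>i<n. LPO n w f (x i)) =
      (\<Sum>i<n. (vandermonde n w x * toeplitz n f * mat_adjoint (vandermonde n w x)) $$ (i, i))"
    by (intro sum.cong) (auto simp: vandermonde_conj_diag)
  also have "\<dots> = (\<Sum>i<n. toeplitz n f $$ (i, i))"
    by (rule trace_unitary_conj[OF vandermonde_carrier assms toeplitz_carrier])
  finally show ?thesis by simp
qed

text \<open>Bessel in each row. The right-hand side is the trace of the Toeplitz matrix of \<open>\<bar>f\<bar>\<^sup>2\<close>.\<close>

lemma frobenius_norm_toeplitz_le:
  assumes "continuous_on {0..2*pi} f"
  shows "(frobenius_norm (toeplitz n f))\<^sup>2 \<le> real n * mean_square f"
proof -
  have "(\<Sum>k<n. (cmod (fourier_coeff f (int j - int k)))\<^sup>2) \<le> mean_square f" for j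
  proof -
    have "inj_on (\<lambda>k. int j - int k) {..<n}" by (auto simp: inj_on_def)
    then have "(\<Sum>k<n. (cmod (fourier_coeff f (int j - int k)))\<^sup>2) =
        (\<Sum>l\<in>(\<lambda>k. int j - int k) ` {..<n}. (cmod (fourier_coeff f l))\<^sup>2)"
      by (subst sum.reindex) (auto simp: o_def)
    also have "\<dots> \<le> mean_square f" by (intro bessel_inequality assms) simp
    finally show ?thesis .
  qed
  then have "(\<Sum>j<n. \<Sum>k<n. (cmod (fourier_coeff f (int j - int k)))\<^sup>2) \<le> (\<Sum>j<n. mean_square f)"
    by (intro sum_mono)
  then show ?thesis by (simp add: frobenius_norm_sq)
qed

lemma mean_square_of_real:
  assumes "continuous_on {0..2*pi} g"
  shows "fourier_coeff (\<lambda>t. complex_of_real ((g t)\<^sup>2)) 0 = of_real (mean_square (\<lambda>t. complex_of_real (g t)))"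
proof -
  have "((\<lambda>t. complex_of_real ((g t)\<^sup>2)) has_integral of_real (integral {0..2*pi} (\<lambda>t. (g t)\<^sup>2))) {0..2*pi}"
    by (intro has_integral_of_real integrable_integral integrable_continuous_interval continuous_intros assms)
  then have "integral {0..2*pi} (\<lambda>t. complex_of_real ((g t)\<^sup>2)) = of_real (integral {0..2*pi} (\<lambda>t. (g t)\<^sup>2))"
    by (rule integral_unique)
  then show ?thesis by (simp add: fourier_coeff_alt mean_square_def)
qed

lemma continuous_on_trig_poly: "trig_poly p \<Longrightarrow> continuous_on A p"
proof -
  assume "trig_poly p"
  then obtain N c where "p = (\<lambda>x. \<Sum>k = - int N..int N. c k * exp (\<i> * of_int k * of_real x))"
    unfolding trig_poly_def by (auto simp: fun_eq_iff)
  then show ?thesis by (auto intro!: continuous_intros)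
qed

lemma continuous_on_LPO:
  assumes "\<And>j. j < n \<Longrightarrow> trig_poly (w j)"
  shows "continuous_on A (LPO n w f)"
proof -
  have "continuous_on A (\<lambda>t. \<Sum>j<n. w j t * (\<Sum>k<n. fourier_coeff f (int j - int k) * cnj (w k t)))"
    by (intro continuous_intros continuous_on_trig_poly assms) auto
  then show ?thesis by (simp add: LPO_sum[abs_def])
qed

lemma cmod_le_sup_norm:
  assumes "f \<in> cont_funs" "t \<in> {0..2*pi}"
  shows "cmod (f t) \<le> sup_norm f"
proof -
  obtain M where "\<forall>t\<in>{0..2*pi}. cmod (f t) \<le> M" using cont_funs_bounded[OF assms(1)] by blast
  then have "bdd_above ((\<lambda>t. cmod (f t)) ` {0..2*pi})" by (auto simp: bdd_above_def)
  then show ?thesis unfolding sup_norm_def by (rule cSUP_upper[OF assms(2)])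
qed

lemma sq_cmod_ge:
  assumes "cmod (z - of_real r) \<le> d"
  shows "r\<^sup>2 - 2 * \<bar>r\<bar> * d \<le> (cmod z)\<^sup>2"
proof -
  have d0: "d \<ge> 0" using assms norm_ge_zero order_trans by blast
  have "\<bar>r\<bar> \<le> cmod z + cmod (of_real r - z)"
    using norm_triangle_ineq[of z "of_real r - z"] by simp
  then have le: "\<bar>r\<bar> - d \<le> cmod z" using assms by (simp add: norm_minus_commute)
  show ?thesis
  proof (cases "\<bar>r\<bar> \<ge> d")
    case True
    then have "(\<bar>r\<bar> - d)\<^sup>2 \<le> (cmod z)\<^sup>2" using le by (intro power_mono) auto
    moreover have "(\<bar>r\<bar> - d)\<^sup>2 = r\<^sup>2 - 2 * \<bar>r\<bar> * d + d\<^sup>2" by (simp add: power2_diff)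
    ultimately show ?thesis using zero_le_power2[of d] by linarith
  next
    case False
    then have "\<bar>r\<bar> * \<bar>r\<bar> \<le> \<bar>r\<bar> * d" by (intro mult_left_mono) auto
    moreover have "0 \<le> \<bar>r\<bar> * d" using d0 by simp
    moreover have "r\<^sup>2 = \<bar>r\<bar> * \<bar>r\<bar>" by (simp add: power2_eq_square)
    moreover have "2 * \<bar>r\<bar> * d = 2 * (\<bar>r\<bar> * d)" by simp
    ultimately have "r\<^sup>2 - 2 * \<bar>r\<bar> * d \<le> 0" by linarith
    then show ?thesis using zero_le_power2[of "cmod z"] by linarith
  qed
qed

text \<open>The trace identity turns the sum of the \<open>\<parallel>T(g\<^sub>k)\<parallel>\<^sup>2\<close> into a sum over the grid of the values of the operator on \<open>\<Sum>g\<^sub>k\<^sup>2\<close>.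
  At each point this value and the sum of the squares \<open>\<bar>L(g\<^sub>k)\<bar>\<^sup>2\<close> approximate the same number, so only errors of
  order \<open>d\<close> remain. The squares have to be summed before they are compared, since an
  approximation is given for \<open>\<Sum>g\<^sub>k\<^sup>2\<close> and not for the individual squares.\<close>

lemma sum_precond_defects_le:
  fixes g :: "'i \<Rightarrow> real \<Rightarrow> real" and K :: "'i set"
  assumes K: "finite K"
    and V: "unitary_matrix (vandermonde n w x)"
    and cont: "\<And>k. k \<in> K \<Longrightarrow> continuous_on {0..2*pi} (g k)"
    and M: "\<And>k t. k \<in> K \<Longrightarrow> t \<in> {0..2*pi} \<Longrightarrow> \<bar>g k t\<bar> \<le> M"
    and grid: "\<And>i. i < n \<Longrightarrow> x i \<in> {0..2*pi}"
    and appr: "\<And>k i. k \<in> K \<Longrightarrow> i < n \<Longrightarrow> cmod (LPO n w (\<lambda>s. of_real (g k s)) (x i) - of_real (g k (x i))) \<le> d"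
    and appr_sq: "\<And>i. i < n \<Longrightarrow>
      cmod (LPO n w (\<lambda>s. of_real (\<Sum>k\<in>K. (g k s)\<^sup>2)) (x i) - of_real (\<Sum>k\<in>K. (g k (x i))\<^sup>2)) \<le> d"
  shows "(\<Sum>k\<in>K. (frobenius_norm (precond (mat_adjoint (vandermonde n w x)) (toeplitz n (\<lambda>t. of_real (g k t))) -
      toeplitz n (\<lambda>t. of_real (g k t))))\<^sup>2) \<le> real n * (d + 2 * M * d * real (card K))"
proof -
  let ?V = "vandermonde n w x"
  let ?g = "\<lambda>k t. complex_of_real (g k t)"
  let ?h = "\<lambda>t. \<Sum>k\<in>K. (g k t)\<^sup>2"
  have U: "mat_adjoint ?V \<in> carrier_mat n n" "unitary_matrix (mat_adjoint ?V)"
    using V by (auto intro: unitary_matrix_adjoint)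
  have defect: "(frobenius_norm (precond (mat_adjoint ?V) (toeplitz n (?g k)) - toeplitz n (?g k)))\<^sup>2
      \<le> real n * mean_square (?g k) - (\<Sum>i<n. (cmod (LPO n w (?g k) (x i)))\<^sup>2)" if k: "k \<in> K" for k
  proof -
    have "(frobenius_norm (precond (mat_adjoint ?V) (toeplitz n (?g k)) - toeplitz n (?g k)))\<^sup>2 =
        (frobenius_norm (toeplitz n (?g k)))\<^sup>2 - (\<Sum>i<n. (cmod (LPO n w (?g k) (x i)))\<^sup>2)"
      unfolding frobenius_norm_precond_defect[OF U toeplitz_carrier] mat_adjoint_adjoint
      using vandermonde_conj_diag[of _ n w x] by simp
    moreover have "(frobenius_norm (toeplitz n (?g k)))\<^sup>2 \<le> real n * mean_square (?g k)"
      by (intro frobenius_norm_toeplitz_le continuous_intros cont k)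
    ultimately show ?thesis by linarith
  qed
  have "complex_of_real (\<Sum>k\<in>K. real n * mean_square (?g k)) =
      of_nat n * fourier_coeff (\<lambda>t. \<Sum>k\<in>K. complex_of_real ((g k t)\<^sup>2)) 0"
    by (subst fourier_coeff_sum[OF K])
      (auto intro!: continuous_intros cont sum.cong simp: mean_square_of_real[OF cont, unfolded of_real_power] sum_distrib_left)
  also have "\<dots> = (\<Sum>i<n. LPO n w (\<lambda>t. of_real (?h t)) (x i))"
    by (simp add: sum_LPO_grid[OF V])
  finally have "complex_of_real (\<Sum>k\<in>K. real n * mean_square (?g k)) = (\<Sum>i<n. LPO n w (\<lambda>t. of_real (?h t)) (x i))" .
  then have "(\<Sum>k\<in>K. real n * mean_square (?g k)) = Re (\<Sum>i<n. LPO n w (\<lambda>t. of_real (?h t)) (x i))"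
    by (metis Re_complex_of_real)
  then have trace: "(\<Sum>k\<in>K. real n * mean_square (?g k)) = (\<Sum>i<n. Re (LPO n w (\<lambda>t. of_real (?h t)) (x i)))"
    by simp
  have "(\<Sum>k\<in>K. (frobenius_norm (precond (mat_adjoint ?V) (toeplitz n (?g k)) - toeplitz n (?g k)))\<^sup>2)
      \<le> (\<Sum>k\<in>K. real n * mean_square (?g k) - (\<Sum>i<n. (cmod (LPO n w (?g k) (x i)))\<^sup>2))"
    by (intro sum_mono defect)
  also have "\<dots> = (\<Sum>i<n. Re (LPO n w (\<lambda>t. of_real (?h t)) (x i)) - (\<Sum>k\<in>K. (cmod (LPO n w (?g k) (x i)))\<^sup>2))"
    unfolding sum_subtractf trace by (subst sum.swap) simp
  also have "\<dots> \<le> (\<Sum>i<n. d + 2 * M * d * real (card K))"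
  proof (rule sum_mono)
    fix i assume "i \<in> {..<n}"
    then have i: "i < n" by simp
    have d0: "d \<ge> 0" using appr_sq[OF i] norm_ge_zero order_trans by blast
    have "Re (LPO n w (\<lambda>t. of_real (?h t)) (x i)) - ?h (x i) =
        Re (LPO n w (\<lambda>t. of_real (?h t)) (x i) - of_real (?h (x i)))" by simp
    also have "\<dots> \<le> d" using appr_sq[OF i] complex_Re_le_cmod order_trans by blast
    finally have 1: "Re (LPO n w (\<lambda>t. of_real (?h t)) (x i)) \<le> ?h (x i) + d" by simp
    have "?h (x i) - (\<Sum>k\<in>K. 2 * M * d) \<le> (\<Sum>k\<in>K. (cmod (LPO n w (?g k) (x i)))\<^sup>2)"
      unfolding sum_subtractf[symmetric]
    proof (rule sum_mono)
      fix k assume k: "k \<in> K"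
      have "2 * \<bar>g k (x i)\<bar> * d \<le> 2 * M * d"
        using M[OF k grid[OF i]] d0 by (intro mult_right_mono mult_left_mono) auto
      then show "(g k (x i))\<^sup>2 - 2 * M * d \<le> (cmod (LPO n w (?g k) (x i)))\<^sup>2"
        using sq_cmod_ge[OF appr[OF k i]] by linarith
    qed
    then show "Re (LPO n w (\<lambda>t. of_real (?h t)) (x i)) - (\<Sum>k\<in>K. (cmod (LPO n w (?g k) (x i)))\<^sup>2)
        \<le> d + 2 * M * d * real (card K)"
      using 1 by (simp add: mult.commute)
  qed
  also have "\<dots> = real n * (d + 2 * M * d * real (card K))" by simp
  finally show ?thesis .
qed

text \<open>The supremum norm controls the error at the grid points because the error is continuous, hence bounded.\<close>

lemma eventually_LPO_error_le:
  assumes grid: "\<And>n i. i < n \<Longrightarrow> x n i \<in> {0..2*pi}"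
    and trig: "\<And>n j. j < n \<Longrightarrow> trig_poly (v n j)"
    and h: "continuous_on {0..2*pi} h"
    and bigo: "(\<lambda>n. sup_norm (\<lambda>t. LPO n (v n) (\<lambda>s. complex_of_real (h s)) t - complex_of_real (h t))) \<in> O(\<lambda>n. 1 / real n)"
  shows "\<exists>c. \<forall>\<^sub>F n in sequentially. \<forall>i<n.
    cmod (LPO n (v n) (\<lambda>s. of_real (h s)) (x n i) - of_real (h (x n i))) \<le> c / real n"
proof -
  let ?D = "\<lambda>n t. LPO n (v n) (\<lambda>s. complex_of_real (h s)) t - complex_of_real (h t)"
  obtain c where c: "\<forall>\<^sub>F n in sequentially. norm (sup_norm (?D n)) \<le> c * norm (1 / real n)"
    using landau_o.bigE[OF bigo] by blast
  have "\<forall>\<^sub>F n in sequentially. \<forall>i<n. cmod (?D n (x n i)) \<le> c / real n"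
    using c
  proof eventually_elim
    case (elim n)
    have "?D n \<in> cont_funs"
      unfolding cont_funs_def by (auto intro!: continuous_intros continuous_on_LPO trig h)
    then have "cmod (?D n (x n i)) \<le> sup_norm (?D n)" if "i < n" for i
      using cmod_le_sup_norm grid[OF that] by blast
    then show ?case using elim by (force intro: order_trans)
  qed
  then show ?thesis by blast
qed

section \<open>Clustering on the generated algebra\<close>

theorem theorem5p2:
  fixes v :: "nat \<Rightarrow> nat \<Rightarrow> real \<Rightarrow> complex"
    and x :: "nat \<Rightarrow> nat \<Rightarrow> real"
    and a b :: real
    and U :: "nat \<Rightarrow> complex mat"
    and m :: nat
    and g :: "nat \<Rightarrow> real \<Rightarrow> real"
    and f :: "real \<Rightarrow> complex"
  assumes interval: "0 \<le> a" "a < b" "b \<le> 2 * pi"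
    and grid: "\<And>n. n \<ge> 1 \<Longrightarrow> is_grid n a b (x n)"
    and trig: "\<And>n j. j < n \<Longrightarrow> trig_poly (v n j)"
    and unitary: "\<And>n. n \<ge> 1 \<Longrightarrow> unitary_matrix (vandermonde n (v n) (x n))"
    and U_eq: "\<And>n. U n = mat_adjoint (vandermonde n (v n) (x n))"
    and norm_le_1: "\<And>n h. n \<ge> 1 \<Longrightarrow> h \<in> cont_funs \<Longrightarrow> sup_norm (LPO n (v n) h) \<le> sup_norm h"
    and unif: "uniformly_distributed a b x"
    and m_pos: "m \<ge> 1"
    and lipschitz: "\<And>k. k \<in> {1..m} \<Longrightarrow> \<exists>C. C-lipschitz_on {0..2*pi} (g k)"
    and krein: "\<And>k. k \<in> {1..m} \<Longrightarrow> (\<lambda>t. complex_of_real (g k t)) \<in> krein_algebra"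
    and approx: "\<And>h. h \<in> insert (\<lambda>t. \<Sum>k = 1..m. (g k t)\<^sup>2) (g ` {1..m}) \<Longrightarrow>
        (\<lambda>n. sup_norm (\<lambda>t. LPO n (v n) (\<lambda>s. complex_of_real (h s)) t - complex_of_real (h t)))
          \<in> O(\<lambda>n. 1 / real n)"
    and f: "f \<in> cstar_generated ((\<lambda>k t. complex_of_real (g k t)) ` {1..m})"
  shows "strong_cluster (\<lambda>n. precond (U n) (toeplitz n f)) (\<lambda>n. toeplitz n f)"
proof -
  have carrier: "U n \<in> carrier_mat n n" for n by (simp add: U_eq)
  have unitary_U: "unitary_matrix (U n)" if "n > 0" for n
    using unitary_matrix_adjoint[OF unitary] that by (simp add: U_eq)
  have points: "x n i \<in> {0..2*pi}" if "i < n" for n i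
  proof -
    have "x n i \<in> {a..b}" using grid[of n] that by (auto simp: is_grid_def)
    then show ?thesis using interval by auto
  qed
  have cont_g: "continuous_on {0..2*pi} (g k)" if "k \<in> {1..m}" for k
    using lipschitz[OF that] lipschitz_on_continuous_on by blast
  let ?g = "\<lambda>k t. complex_of_real (g k t)"
  have g_cont_funs: "?g k \<in> cont_funs" if "k \<in> {1..m}" for k
    unfolding cont_funs_def using cont_g[OF that] by (auto intro!: continuous_intros)
  have multiplier: "toeplitz_multiplier (?g k)" if "k \<in> {1..m}" for k
    using krein[OF that] by (intro toeplitz_multiplier_krein g_cont_funs that) (simp add: krein_algebra_def)
  have "\<exists>M. \<forall>t\<in>{0..2*pi}. \<bar>g k t\<bar> \<le> M" if "k \<in> {1..m}" for k
    using cont_funs_bounded[OF g_cont_funs[OF that]] by auto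
  then have "\<forall>k\<in>{1..m}. \<exists>M. \<forall>t\<in>{0..2*pi}. \<bar>g k t\<bar> \<le> M" by blast
  then have "\<exists>B. \<forall>k\<in>{1..m}. \<forall>t\<in>{0..2*pi}. \<bar>g k t\<bar> \<le> B k" by (rule bchoice)
  then obtain B where B: "\<And>k t. k \<in> {1..m} \<Longrightarrow> t \<in> {0..2*pi} \<Longrightarrow> \<bar>g k t\<bar> \<le> B k" by blast
  define M where "M = (\<Sum>k = 1..m. \<bar>B k\<bar>)"
  have M: "\<bar>g k t\<bar> \<le> M" if "k \<in> {1..m}" "t \<in> {0..2*pi}" for k t
  proof -
    have "\<bar>B k\<bar> \<le> M" unfolding M_def by (rule member_le_sum) (use that in auto)
    then show ?thesis using B[OF that] by linarith
  qed
  let ?h = "\<lambda>t. \<Sum>k = 1..m. (g k t)\<^sup>2"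
  let ?err = "\<lambda>h n i. cmod (LPO n (v n) (\<lambda>s. complex_of_real (h s)) (x n i) - complex_of_real (h (x n i)))"
  define S where "S = insert ?h (g ` {1..m})"
  have fin_S: "finite S" by (simp add: S_def)
  have cont_S: "continuous_on {0..2*pi} h" if "h \<in> S" for h
    using that unfolding S_def by (auto intro!: continuous_on_sum continuous_on_power cont_g)
  have "\<forall>h\<in>S. \<exists>c. \<forall>\<^sub>F n in sequentially. \<forall>i<n. ?err h n i \<le> c / real n"
  proof
    fix h assume h: "h \<in> S"
    show "\<exists>c. \<forall>\<^sub>F n in sequentially. \<forall>i<n. ?err h n i \<le> c / real n"
      by (rule eventually_LPO_error_le[OF points trig cont_S[OF h] approx[OF h[unfolded S_def]]])
  qed
  then have "\<exists>c. \<forall>h\<in>S. \<forall>\<^sub>F n in sequentially. \<forall>i<n. ?err h n i \<le> c h / real n"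
    by (rule bchoice)
  then obtain c where c: "\<forall>h\<in>S. \<forall>\<^sub>F n in sequentially. \<forall>i<n. ?err h n i \<le> c h / real n"
    by (rule exE)
  define d where "d = (\<Sum>h\<in>S. \<bar>c h\<bar>)"
  have cd: "c h \<le> d" if "h \<in> S" for h
  proof -
    have "\<bar>c h\<bar> \<le> d" unfolding d_def by (rule member_le_sum) (use that fin_S in auto)
    then show ?thesis by linarith
  qed
  have "\<forall>\<^sub>F n in sequentially. \<forall>h\<in>S. \<forall>i<n. ?err h n i \<le> c h / real n"
    by (rule eventually_ball_finite[OF fin_S c])
  then have err: "\<forall>\<^sub>F n in sequentially. \<forall>h\<in>S. \<forall>i<n. ?err h n i \<le> d / real n"
  proof eventually_elim
    case (elim n)
    have "c h / real n \<le> d / real n" if "h \<in> S" for h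
      by (rule divide_right_mono[OF cd[OF that]]) simp
    then show ?case using elim order_trans by blast
  qed
  \<comment> \<open>The \<open>n\<close> grid points contribute \<open>d / n\<close> and \<open>m\<close> times \<open>2 M d / n\<close> each.\<close>
  define C where "C = d + 2 * M * d * real m"
  have bound: "\<forall>\<^sub>F n in sequentially. \<forall>k\<in>{1..m}.
      frobenius_norm (precond (U n) (toeplitz n (?g k)) - toeplitz n (?g k)) \<le> sqrt C"
    using err eventually_gt_at_top[of 0]
  proof eventually_elim
    case (elim n)
    let ?f = "\<lambda>k. (frobenius_norm (precond (U n) (toeplitz n (?g k)) - toeplitz n (?g k)))\<^sup>2"
    have V: "unitary_matrix (vandermonde n (v n) (x n))" using unitary elim(2) by simp
    have "(\<Sum>k = 1..m. ?f k) \<le> real n * (d / real n + 2 * M * (d / real n) * real (card {1..m}))"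
      unfolding U_eq
      by (rule sum_precond_defects_le[OF finite_atLeastAtMost V cont_g M points]) (use elim(1) in \<open>auto simp: S_def\<close>)
    also have "\<dots> = C" using elim(2) by (simp add: C_def field_simps)
    finally have "(\<Sum>k = 1..m. ?f k) \<le> C" .
    moreover have "?f k \<le> (\<Sum>k = 1..m. ?f k)" if "k \<in> {1..m}" for k
      by (rule member_le_sum) (use that in auto)
    ultimately have "?f k \<le> C" if "k \<in> {1..m}" for k using that order_trans by blast
    then show ?case using real_le_rsqrt by blast
  qed
  have approximates: "precond_approximates U (?g k)" if k: "k \<in> {1..m}" for k
    unfolding precond_approximates_def
  proof (rule asymptotically_compact_frobenius[of _ "sqrt C"])
    show "\<forall>\<^sub>F n in sequentially. precond (U n) (toeplitz n (?g k)) - toeplitz n (?g k) \<in> carrier_mat n n \<and>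
        frobenius_norm (precond (U n) (toeplitz n (?g k)) - toeplitz n (?g k)) \<le> sqrt C"
      using bound by eventually_elim (use k in \<open>auto intro: minus_carrier_mat\<close>)
  qed
  let ?good = "\<lambda>f. toeplitz_multiplier f \<and> precond_approximates U f"
  let ?B = "{f \<in> cont_funs. ?good f \<and> ?good (\<lambda>t. cnj (f t))}"
  have "cstar_subalgebra ?B" by (rule cstar_subalgebra_approximated[OF carrier unitary_U])
  moreover have "?g ` {1..m} \<subseteq> ?B"
    using g_cont_funs multiplier approximates by auto
  ultimately have "f \<in> ?B" using f unfolding cstar_generated_def by blast
  then show ?thesis
    by (intro strong_cluster_if_asymptotically_compact) (simp add: precond_approximates_def)
qed

end
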